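(* Let $X$ be a maximal Gromov hyperbolic space whose Gromov boundary $\partial X$ is finite (with at least four points). Then $X$ is an injective metric space; that is, $X$ is hyperconvex.
   Context: **Gromov hyperbolic spaces.** For a metric space $X$ and $x,y,z\in X$, $(y|z)_x=\frac12(d(y,x)+d(z,x)-d(y,z))$. A geodesic metric space is Gromov hyperbolic if for some $\delta\ge0$ all geodesic triangles are $\delta$-slim. For proper $X$, $\partial X$ is the Gromov boundary (classes of geodesic rays at bounded distance) and $\overline X=X\cup\partial X$ is the Gromov compactification with the cone topology. $X$ is boundary continuous if for each $x$ the Gromov product $(\cdot|\cdot)_x$ extends to a continuous function $\overline X\times\overline X\to[0,+\infty]$. $X$ is geodesically complete if every geodesic (isometric embedding of an interval $I\subseteq\mathbb{R}$) extends to a bi-infinite geodesic $\mathbb{R}\to X$. A *good* Gromov hyperbolic space is one which is proper, geodesic, geodesically complete and boundary continuous. **Moebius maps.** For a good Gromov hyperbolic space $X$ and $x\in X$ let $\rho_x(\xi,\eta)=e^{-(\xi|\eta)_x}$ on $\partial X$. The cross-ratio $[\xi,\xi',\eta,\eta']=\frac{\rho_x(\xi,\eta)\rho_x(\xi',\eta')}{\rho_x(\xi,\eta')\rho_x(\xi',\eta)}$ of distinct $\xi,\xi',\eta,\eta'\in\partial X$ does not depend on $x$. A homeomorphism between boundaries is Moebius if it preserves cross-ratios. **Maximality.** For a good Gromov hyperbolic space $X$, a hyperbolic filling of $\partial X$ is a pair $(Y,f:\partial Y\to\partial X)$ with $Y$ a good Gromov hyperbolic space and $f$ a Moebius homeomorphism.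 $X$ is a *maximal Gromov hyperbolic space* if it is good and, for every hyperbolic filling $(Y,f)$ of $\partial X$, there is an isometric embedding $H:Y\to X$ whose extension to the Gromov boundaries is $f$. All boundaries considered are assumed to have at least four points. **Injectivity.** A metric space $X$ is injective if for every metric space $A$ and subspace $B\subset A$, every $1$-Lipschitz map $B\to X$ extends to a $1$-Lipschitz map $A\to X$. $X$ is hyperconvex if every family of closed balls $\{B(x_i,r_i)\}_{i\in I}$ in $X$ with $r_i+r_j\ge d(x_i,x_j)$ for all $i,j\in I$ has non-empty intersection. It is a known theorem that the two properties are equivalent. *)

theory Defs
  imports "HOL-Analysis.Analysis"
begin

section \<open>Geodesics and Gromov hyperbolicity\<close>

definition geodesic_on :: "'a metric \<Rightarrow> real set \<Rightarrow> (real \<Rightarrow> 'a) \<Rightarrow> bool" where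
  "geodesic_on X I \<gamma> \<longleftrightarrow>
     is_interval I \<and> \<gamma> \<in> I \<rightarrow> mspace X \<and> (\<forall>s\<in>I. \<forall>t\<in>I. mdist X (\<gamma> s) (\<gamma> t) = \<bar>s - t\<bar>)"

definition geodesic_segment :: "'a metric \<Rightarrow> 'a \<Rightarrow> 'a \<Rightarrow> 'a set \<Rightarrow> bool" where
  "geodesic_segment X x y S \<longleftrightarrow>
     (\<exists>\<gamma> L. L \<ge> 0 \<and> geodesic_on X {0..L} \<gamma> \<and> \<gamma> 0 = x \<and> \<gamma> L = y \<and> S = \<gamma> ` {0..L})"

definition geodesic_space :: "'a metric \<Rightarrow> bool" where
  "geodesic_space X \<longleftrightarrow> (\<forall>x\<in>mspace X. \<forall>y\<in>mspace X. \<exists>S. geodesic_segment X x y S)"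

definition proper_space :: "'a metric \<Rightarrow> bool" where
  "proper_space X \<longleftrightarrow> (\<forall>x\<in>mspace X. \<forall>r. compactin (mtopology_of X) (mcball_of X x r))"

definition geodesically_complete :: "'a metric \<Rightarrow> bool" where
  "geodesically_complete X \<longleftrightarrow>
     (\<forall>I \<gamma>. geodesic_on X I \<gamma> \<longrightarrow> (\<exists>\<gamma>'. geodesic_on X UNIV \<gamma>' \<and> (\<forall>t\<in>I. \<gamma>' t = \<gamma> t)))"

text \<open>Since the triangle ranges over all triples of vertices and all choices of sides, the condition
  on the side \<open>S\<close> below covers each of the three sides.\<close>

definition slim_triangles :: "'a metric \<Rightarrow> real \<Rightarrow> bool" where
  "slim_triangles X \<delta> \<longleftrightarrow>
     (\<forall>x y z S T U. geodesic_segment X x y S \<and> geodesic_segment X y z T \<and> geodesic_segment X z x U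
        \<longrightarrow> (\<forall>p\<in>S. \<exists>q\<in>T \<union> U. mdist X p q \<le> \<delta>))"

definition gromov_hyperbolic :: "'a metric \<Rightarrow> bool" where
  "gromov_hyperbolic X \<longleftrightarrow> geodesic_space X \<and> (\<exists>\<delta>\<ge>0. slim_triangles X \<delta>)"

definition gromov_product :: "'a metric \<Rightarrow> 'a \<Rightarrow> 'a \<Rightarrow> 'a \<Rightarrow> real" where
  "gromov_product X x y z = (mdist X y x + mdist X z x - mdist X y z) / 2"


section \<open>Gromov boundary and cone topology\<close>

text \<open>A ray is represented by any function on \<^typ>\<open>real\<close> that is geodesic on \<open>[0,\<infinity>)\<close>. Its values at
  negative arguments are irrelevant: functions agreeing on \<open>[0,\<infinity>)\<close> lie in the same class.\<close>

definition geodesic_rays :: "'a metric \<Rightarrow> (real \<Rightarrow> 'a) set" where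
  "geodesic_rays X = {\<gamma>. geodesic_on X {0..} \<gamma>}"

definition asymptotic :: "'a metric \<Rightarrow> ((real \<Rightarrow> 'a) \<times> (real \<Rightarrow> 'a)) set" where
  "asymptotic X = {(\<gamma>, \<gamma>'). \<gamma> \<in> geodesic_rays X \<and> \<gamma>' \<in> geodesic_rays X \<and>
                            (\<exists>C. \<forall>t\<ge>0. mdist X (\<gamma> t) (\<gamma>' t) \<le> C)}"

definition gromov_boundary :: "'a metric \<Rightarrow> (real \<Rightarrow> 'a) set set" where
  "gromov_boundary X = geodesic_rays X // asymptotic X"

type_synonym 'a bordified = "'a + (real \<Rightarrow> 'a) set"

definition compactification :: "'a metric \<Rightarrow> 'a bordified set" where
  "compactification X = mspace X <+> gromov_boundary X"

text \<open>\<open>generalized_ray X c e\<close>: \<open>c\<close> is a generalized ray in the sense of Bridson--Haefliger (Chapter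
  III.H.3) with endpoint \<open>c(\<infinity>) = e\<close>. A geodesic on \<open>[0,R]\<close> is extended by the constant \<open>c R\<close>.\<close>

definition generalized_ray :: "'a metric \<Rightarrow> (real \<Rightarrow> 'a) \<Rightarrow> 'a bordified \<Rightarrow> bool" where
  "generalized_ray X c e \<longleftrightarrow>
     (c \<in> geodesic_rays X \<and> e = Inr (asymptotic X `` {c})) \<or>
     (\<exists>R\<ge>0. geodesic_on X {0..R} c \<and> (\<forall>t\<ge>R. c t = c R) \<and> e = Inl (c R))"

definition locally_uniform_limit :: "'a metric \<Rightarrow> (nat \<Rightarrow> real \<Rightarrow> 'a) \<Rightarrow> (real \<Rightarrow> 'a) \<Rightarrow> bool" where
  "locally_uniform_limit X c c' \<longleftrightarrow>
     (\<forall>T. \<forall>\<epsilon>>0. \<exists>N. \<forall>n\<ge>N. \<forall>t\<in>{0..T}. mdist X (c n t) (c' t) < \<epsilon>)"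

text \<open>Convergence in the compactification, following Bridson--Haefliger, Definition III.H.3.6: there
  are generalized rays \<open>c n\<close> from a base point \<open>p\<close> to \<open>s n\<close> such that every subsequence of \<open>c\<close> has a
  subsequence converging, uniformly on compact sets, to a generalized ray with endpoint \<open>e\<close>.
  They fix \<open>p\<close> and show that the resulting topology does not depend on it (for proper
  hyperbolic \<open>X\<close>); we allow any \<open>p\<close>, which gives the same topology without the choice.\<close>

definition cone_limit :: "'a metric \<Rightarrow> (nat \<Rightarrow> 'a bordified) \<Rightarrow> 'a bordified \<Rightarrow> bool" where
  "cone_limit X s e \<longleftrightarrow>
     (\<exists>p\<in>mspace X. \<exists>c. (\<forall>n. c n 0 = p \<and> generalized_ray X (c n) (s n)) \<and>
        (\<forall>r :: nat \<Rightarrow> nat. strict_mono r \<longrightarrow>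
           (\<exists>(r' :: nat \<Rightarrow> nat) c'. strict_mono r' \<and> generalized_ray X c' e \<and>
                    locally_uniform_limit X (c \<circ> r \<circ> r') c')))"

definition cone_open :: "'a metric \<Rightarrow> 'a bordified set \<Rightarrow> bool" where
  "cone_open X U \<longleftrightarrow> U \<subseteq> compactification X \<and>
     (\<forall>s e. (\<forall>n. s n \<in> compactification X - U) \<and> cone_limit X s e \<longrightarrow> e \<notin> U)"

definition cone_topology :: "'a metric \<Rightarrow> 'a bordified topology" where
  "cone_topology X = topology (cone_open X)"

definition boundary_topology :: "'a metric \<Rightarrow> (real \<Rightarrow> 'a) set topology" where
  "boundary_topology X = pullback_topology (gromov_boundary X) Inr (cone_topology X)"

lemma cone_limit_subseq:
  assumes "cone_limit X s e" "strict_mono (r::nat \<Rightarrow> nat)"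
  shows "cone_limit X (s \<circ> r) e"
proof -
  obtain p c where p: "p \<in> mspace X"
    and c: "\<And>n. c n 0 = p \<and> generalized_ray X (c n) (s n)"
    and sub: "\<And>r :: nat \<Rightarrow> nat. strict_mono r \<Longrightarrow> \<exists>(r' :: nat \<Rightarrow> nat) c'. strict_mono r' \<and> generalized_ray X c' e \<and>
                    locally_uniform_limit X (c \<circ> r \<circ> r') c'"
    using assms(1) unfolding cone_limit_def by blast
  have "\<exists>(r' :: nat \<Rightarrow> nat) c'. strict_mono r' \<and> generalized_ray X c' e \<and>
          locally_uniform_limit X ((c \<circ> r) \<circ> q \<circ> r') c'" if "strict_mono q" for q :: "nat \<Rightarrow> nat"
    using sub[of "r \<circ> q"] strict_mono_o[OF assms(2) that] by (simp add: o_assoc)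
  then show ?thesis
    unfolding cone_limit_def using p c by (intro bexI[of _ p] exI[of _ "c \<circ> r"]) auto
qed

lemma istopology_cone_open: "istopology (cone_open X)"
  unfolding istopology_def
proof (intro conjI allI impI)
  fix U V assume U: "cone_open X U" and V: "cone_open X V"
  show "cone_open X (U \<inter> V)"
    unfolding cone_open_def
  proof (intro conjI allI impI)
    show "U \<inter> V \<subseteq> compactification X" using U by (auto simp: cone_open_def)
    fix s e assume s: "(\<forall>n. s n \<in> compactification X - U \<inter> V) \<and> cone_limit X s e"
    have miss: "e \<notin> W" if W: "cone_open X W" and inf: "infinite {n. s n \<notin> W}" for W
    proof -
      obtain r :: "nat \<Rightarrow> nat" where r: "strict_mono r" "\<And>n. r n \<in> {n. s n \<notin> W}"
        using infinite_enumerate[OF inf] by blast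
      then have "\<forall>n. (s \<circ> r) n \<in> compactification X - W" using s by auto
      moreover have "cone_limit X (s \<circ> r) e" using cone_limit_subseq s r(1) by blast
      ultimately show ?thesis using W unfolding cone_open_def by blast
    qed
    have "{n. s n \<notin> U} \<union> {n. s n \<notin> V} = UNIV" using s by auto
    then have "infinite {n. s n \<notin> U} \<or> infinite {n. s n \<notin> V}"
      by (metis finite_Un infinite_UNIV_nat)
    then show "e \<notin> U \<inter> V" using miss U V by blast
  qed
next
  fix K assume K: "\<forall>U\<in>K. cone_open X U"
  show "cone_open X (\<Union>K)"
    unfolding cone_open_def
  proof (intro conjI allI impI)
    show "\<Union>K \<subseteq> compactification X" using K by (auto simp: cone_open_def)
    fix s e assume s: "(\<forall>n. s n \<in> compactification X - \<Union>K) \<and> cone_limit X s e"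
    have "e \<notin> U" if "U \<in> K" for U
    proof -
      have "\<forall>n. s n \<in> compactification X - U" using s that by blast
      then show ?thesis using K that s unfolding cone_open_def by blast
    qed
    then show "e \<notin> \<Union>K" by blast
  qed
qed

lemma openin_cone_topology: "openin (cone_topology X) U \<longleftrightarrow> cone_open X U"
  by (simp add: cone_topology_def istopology_cone_open topology_inverse')

lemma topspace_cone_topology: "topspace (cone_topology X) = compactification X"
proof -
  have "cone_open X (compactification X)" by (auto simp: cone_open_def)
  moreover have "cone_open X (topspace (cone_topology X))"
    using openin_cone_topology openin_topspace by blast
  ultimately show ?thesis
    using openin_subset[of "cone_topology X"] unfolding openin_cone_topology
    by (meson cone_open_def subset_antisym)
qed

lemma topspace_boundary_topology: "topspace (boundary_topology X) = gromov_boundary X"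
  by (auto simp: boundary_topology_def topspace_pullback_topology topspace_cone_topology
      compactification_def)


section \<open>Good spaces\<close>

definition extends_gromov_product ::
    "'a metric \<Rightarrow> 'a \<Rightarrow> ('a bordified \<times> 'a bordified \<Rightarrow> ereal) \<Rightarrow> bool" where
  "extends_gromov_product X x g \<longleftrightarrow>
     continuous_map (prod_topology (cone_topology X) (cone_topology X))
       (top_of_set {0..\<infinity>}) g \<and>
     (\<forall>y\<in>mspace X. \<forall>z\<in>mspace X. g (Inl y, Inl z) = ereal (gromov_product X x y z))"

definition boundary_continuous :: "'a metric \<Rightarrow> bool" where
  "boundary_continuous X \<longleftrightarrow> (\<forall>x\<in>mspace X. \<exists>g. extends_gromov_product X x g)"

definition good_space :: "'a metric \<Rightarrow> bool" where
  "good_space X \<longleftrightarrow> gromov_hyperbolic X \<and> proper_space X \<and> geodesic_space X \<and>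
     geodesically_complete X \<and> boundary_continuous X"


section \<open>Moebius maps\<close>

text \<open>The extension of the Gromov product is unique on the compactification, since \<open>X\<close> is dense in
  it; only its values there are used.\<close>

definition boundary_product ::
    "'a metric \<Rightarrow> 'a \<Rightarrow> (real \<Rightarrow> 'a) set \<Rightarrow> (real \<Rightarrow> 'a) set \<Rightarrow> ereal" where
  "boundary_product X x \<xi> \<eta> = (SOME g. extends_gromov_product X x g) (Inr \<xi>, Inr \<eta>)"

definition visual_quasimetric ::
    "'a metric \<Rightarrow> 'a \<Rightarrow> (real \<Rightarrow> 'a) set \<Rightarrow> (real \<Rightarrow> 'a) set \<Rightarrow> real" where
  "visual_quasimetric X x \<xi> \<eta> =
     (if boundary_product X x \<xi> \<eta> = \<infinity> then 0
      else exp (- real_of_ereal (boundary_product X x \<xi> \<eta>)))"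

definition cross_ratio ::
    "'a metric \<Rightarrow> 'a \<Rightarrow> (real \<Rightarrow> 'a) set \<Rightarrow> (real \<Rightarrow> 'a) set \<Rightarrow> (real \<Rightarrow> 'a) set \<Rightarrow> (real \<Rightarrow> 'a) set \<Rightarrow> real"
  where
  "cross_ratio X x \<xi> \<xi>' \<eta> \<eta>' =
     (visual_quasimetric X x \<xi> \<eta> * visual_quasimetric X x \<xi>' \<eta>') /
     (visual_quasimetric X x \<xi> \<eta>' * visual_quasimetric X x \<xi>' \<eta>)"

text \<open>The cross-ratio does not depend on the base point, so base points are quantified universally.\<close>

definition moebius_homeomorphism ::
    "'b metric \<Rightarrow> 'a metric \<Rightarrow> ((real \<Rightarrow> 'b) set \<Rightarrow> (real \<Rightarrow> 'a) set) \<Rightarrow> bool" where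
  "moebius_homeomorphism Y X f \<longleftrightarrow>
     homeomorphic_map (boundary_topology Y) (boundary_topology X) f \<and>
     (\<forall>y\<in>mspace Y. \<forall>x\<in>mspace X.
      \<forall>\<xi>\<in>gromov_boundary Y. \<forall>\<xi>'\<in>gromov_boundary Y. \<forall>\<eta>\<in>gromov_boundary Y. \<forall>\<eta>'\<in>gromov_boundary Y.
        distinct [\<xi>, \<xi>', \<eta>, \<eta>'] \<longrightarrow>
        cross_ratio X x (f \<xi>) (f \<xi>') (f \<eta>) (f \<eta>') = cross_ratio Y y \<xi> \<xi>' \<eta> \<eta>')"


section \<open>Maximal Gromov hyperbolic spaces\<close>

definition hyperbolic_filling ::
    "'a metric \<Rightarrow> 'b metric \<Rightarrow> ((real \<Rightarrow> 'b) set \<Rightarrow> (real \<Rightarrow> 'a) set) \<Rightarrow> bool" where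
  "hyperbolic_filling X Y f \<longleftrightarrow> good_space Y \<and> moebius_homeomorphism Y X f"

definition isometric_embedding :: "'b metric \<Rightarrow> 'a metric \<Rightarrow> ('b \<Rightarrow> 'a) \<Rightarrow> bool" where
  "isometric_embedding Y X H \<longleftrightarrow>
     H \<in> mspace Y \<rightarrow> mspace X \<and>
     (\<forall>y\<in>mspace Y. \<forall>z\<in>mspace Y. mdist X (H y) (H z) = mdist Y y z)"

text \<open>The extension of an isometric embedding \<open>H\<close> to the boundary sends the class of a ray \<open>\<gamma>\<close> to the
  class of \<open>H \<circ> \<gamma>\<close>.\<close>

definition boundary_extension_is ::
    "'b metric \<Rightarrow> 'a metric \<Rightarrow> ('b \<Rightarrow> 'a) \<Rightarrow> ((real \<Rightarrow> 'b) set \<Rightarrow> (real \<Rightarrow> 'a) set) \<Rightarrow> bool" where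
  "boundary_extension_is Y X H f \<longleftrightarrow>
     (\<forall>\<gamma>\<in>geodesic_rays Y. f (asymptotic Y `` {\<gamma>}) = asymptotic X `` {H \<circ> \<gamma>})"

text \<open>The fillings \<open>Y\<close> range over all good metric spaces with points in \<^typ>\<open>real\<close>, with an
  arbitrary metric unrelated to the usual one. This loses nothing: a proper metric space is
  separable, so it has at most continuum many points and is isometric to a space of this
  form; see \<open>proper_space_inj_real\<close>.\<close>

definition maximal_gromov_hyperbolic :: "'a metric \<Rightarrow> bool" where
  "maximal_gromov_hyperbolic X \<longleftrightarrow> good_space X \<and>
     (\<forall>(Y :: real metric) f. hyperbolic_filling X Y f \<longrightarrow>
        (\<exists>H. isometric_embedding Y X H \<and> boundary_extension_is Y X H f))"

lemma proper_space_inj_real: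
  fixes X :: "'a metric"
  assumes "proper_space X"
  shows "\<exists>i :: 'a \<Rightarrow> real. inj_on i (mspace X)"
proof (cases "mspace X = {}")
  case False
  then obtain a where a: "a \<in> mspace X" by blast
  interpret Metric_space "mspace X" "mdist X" by simp
  have top: "mtopology_of X = mtopology" and cb: "mcball_of X = mcball"
    by (auto simp: mtopology_of_def mcball_of_def)
  have "\<exists>F. finite F \<and> F \<subseteq> mspace X \<and> mcball a (real m) \<subseteq> (\<Union>x\<in>F. mball x (1 / Suc k))" for m k
  proof -
    have "compactin mtopology (mcball a (real m))"
      using assms a unfolding proper_space_def top cb by blast
    then have "mtotally_bounded (mcball a (real m))" by (rule compactin_imp_mtotally_bounded)
    then show ?thesis unfolding mtotally_bounded_def
      by (metis mcball_subset_mspace of_nat_0_less_iff subset_trans zero_less_Suc zero_less_divide_1_iff)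
  qed
  then obtain F where F: "\<And>m k. finite (F m k)" "\<And>m k. F m k \<subseteq> mspace X"
      "\<And>m k. mcball a (real m) \<subseteq> (\<Union>x\<in>F m k. mball x (1 / Suc k))"
    by metis
  define D where "D = (\<Union>m k. F m k)"
  have cD: "countable D" unfolding D_def using F(1) by (simp add: countable_finite)
  have dense: "\<exists>d\<in>D. mdist X d x < e" if x: "x \<in> mspace X" and "e > 0" for x e
  proof -
    obtain m :: nat where "mdist X a x \<le> m" using real_arch_simple by blast
    moreover obtain k where k: "1 / real (Suc k) < e" using \<open>e > 0\<close> nat_approx_posE by blast
    ultimately have "x \<in> mcball a (real m)" using x a by simp
    then obtain d where "d \<in> F m k" "x \<in> mball d (1 / Suc k)" using F(3)[of m k] by blast
    moreover from this have "mdist X d x < e" using k unfolding in_mball by linarith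
    ultimately show ?thesis unfolding D_def by blast
  qed
  define P where "P x = {(d, q :: rat). d \<in> D \<and> mdist X d x < of_rat q}" for x
  have injP: "x = y" if x: "x \<in> mspace X" and y: "y \<in> mspace X" and eq: "P x = P y" for x y
  proof (rule ccontr)
    assume "x \<noteq> y"
    then have pos: "mdist X x y / 2 > 0" using x y by simp
    obtain d where d: "d \<in> D" "mdist X d x < mdist X x y / 2" using dense[OF x pos] by blast
    then obtain q where q: "mdist X d x < of_rat q" "of_rat q < mdist X x y / 2"
      using of_rat_dense by blast
    then have "(d, q) \<in> P y" using d eq by (auto simp: P_def)
    then have "mdist X d y < mdist X x y / 2" using q by (auto simp: P_def)
    moreover have "d \<in> mspace X" using d F(2) by (auto simp: D_def)
    ultimately show False using triangle[of x d y] d x y by (simp add: commute)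
  qed
  have "countable (D \<times> (UNIV :: rat set))" using cD by simp
  then obtain e :: "'a \<times> rat \<Rightarrow> nat" where e: "inj_on e (D \<times> UNIV)" by (auto simp: countable_def)
  obtain h :: "nat set \<Rightarrow> real" where h: "inj h"
    using nat_sets_eqpoll_reals unfolding eqpoll_def by (auto simp: bij_betw_def)
  have "inj_on (\<lambda>x. h (e ` P x)) (mspace X)"
  proof (rule inj_onI)
    fix x y assume "x \<in> mspace X" "y \<in> mspace X" "h (e ` P x) = h (e ` P y)"
    moreover then have "e ` P x = e ` P y" using h by (simp add: inj_eq)
    then have "P x = P y" using inj_on_image_eq_iff[OF e, of "P x" "P y"] by (auto simp: P_def)
    ultimately show "x = y" using injP by blast
  qed
  then show ?thesis by blast
qed auto


section \<open>Injective and hyperconvex metric spaces\<close>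

text \<open>The type argument is the type of the points of the test spaces \<open>A\<close>; leaving it free in a
  conclusion quantifies over all metric spaces.\<close>

definition injective_space :: "'b itself \<Rightarrow> 'a metric \<Rightarrow> bool" where
  "injective_space _ X \<longleftrightarrow>
     (\<forall>(A :: 'b metric) B h. B \<subseteq> mspace A \<and> h \<in> B \<rightarrow> mspace X \<and>
        (\<forall>b\<in>B. \<forall>c\<in>B. mdist X (h b) (h c) \<le> mdist A b c) \<longrightarrow>
        (\<exists>k. k \<in> mspace A \<rightarrow> mspace X \<and>
             (\<forall>a\<in>mspace A. \<forall>b\<in>mspace A. mdist X (k a) (k b) \<le> mdist A a b) \<and>
             (\<forall>b\<in>B. k b = h b)))"

text \<open>A family of closed balls is given by its set of pairs (centre, radius); repetitions in an
  indexed family affect neither the hypothesis nor the intersection.\<close>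

definition hyperconvex :: "'a metric \<Rightarrow> bool" where
  "hyperconvex X \<longleftrightarrow>
     (\<forall>S \<subseteq> mspace X \<times> (UNIV :: real set).
        (\<forall>(x, r)\<in>S. \<forall>(y, s)\<in>S. mdist X x y \<le> r + s) \<longrightarrow>
        (\<exists>z\<in>mspace X. \<forall>(x, r)\<in>S. z \<in> mcball_of X x r))"

end

theory Submission
  imports Defs
begin

text \<open>Let \<open>Z\<close> be the boundary and \<open>w \<xi> \<eta> = -2 (\<xi>|\<eta>)\<close> with respect to a base point. The functions
  \<open>f\<close> on \<open>Z\<close> with \<open>f \<xi> + f \<eta> \<ge> w \<xi> \<eta>\<close> for \<open>\<xi> \<noteq> \<eta>\<close>, where for every \<open>\<xi>\<close> equality holds for some \<open>\<eta>\<close>,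
  form with the maximum metric a variant of the tight span. It is a 1-Lipschitz retract of the set
  of all functions satisfying the inequalities, hence injective and hyperconvex. Outside a bounded set
  it consists of one ray for each point of \<open>Z\<close>, and so it is a good Gromov hyperbolic space whose
  boundary is \<open>Z\<close> with the given cross-ratios. The Busemann functions embed \<open>X\<close> isometrically
  into this space, since in \<open>X\<close> geodesics can be prolonged. By maximality the space also embeds into
  \<open>X\<close>, compatibly with the boundary, and this embedding is inverse to the first one.\<close>

section \<open>Rays and ends\<close>

text \<open>The diagonal is left out of the inequalities because (\<xi>|\<xi>) is infinite, so
  \<open>w \<xi> \<xi>\<close> would have to be -\<infinity>. Coordinates may therefore tend to
  -\<infinity>, and this is what produces the rays, in contrast to the compact tight span of a
  finite metric space. Finiteness of the boundary is used throughout: maxima of coordinate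
  differences exist, a pigeonhole argument finds the partner for which equality holds, and boundary
  topologies are discrete, so that only cross-ratios matter. Boundary continuity is the laborious
  part of goodness: an extension of the Gromov product is written down explicitly, by cutting every
  end at a level and adding the common depth beyond the cut. Two isometric embeddings in opposite
  directions need not be inverse to each other; compatibility with the boundary map fixes the
  coordinates up to one constant for each boundary point, and a comparison of three boundary points
  removes these constants.\<close>

lemma mdist_self [simp]: "x \<in> mspace X \<Longrightarrow> mdist X x x = 0"
  by simp

lemma mdist_reverse_triangle:
  assumes "x \<in> mspace X" "y \<in> mspace X" "z \<in> mspace X"
  shows "\<bar>mdist X x z - mdist X y z\<bar> \<le> mdist X x y"
  using mdist_triangle[OF assms(1,2,3)] mdist_triangle[OF assms(2,1,3)]
  by (simp add: mdist_commute[of X y x] abs_le_iff)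

lemma geodesic_onD:
  assumes "geodesic_on X I \<gamma>" "s \<in> I"
  shows "\<gamma> s \<in> mspace X" "t \<in> I \<Longrightarrow> mdist X (\<gamma> s) (\<gamma> t) = \<bar>s - t\<bar>"
  using assms unfolding geodesic_on_def by auto

lemma geodesic_on_subset:
  assumes "geodesic_on X I \<gamma>" "J \<subseteq> I" "is_interval J"
  shows "geodesic_on X J \<gamma>"
  using assms unfolding geodesic_on_def by blast

lemma gromov_product_commute: "gromov_product X x y z = gromov_product X x z y"
  by (simp add: gromov_product_def mdist_commute)

lemma gromov_product_nonneg:
  assumes "x \<in> mspace X" "y \<in> mspace X" "z \<in> mspace X"
  shows "0 \<le> gromov_product X x y z"
  using mdist_triangle[OF assms(2,1,3)] mdist_commute[of X z x] by (simp add: gromov_product_def)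

lemma continuous_map_euclidean_tendsto:
  "continuous_map T euclidean f \<longleftrightarrow> (\<forall>p\<in>topspace T. (f \<longlongrightarrow> f p) (atin T p))"
  by (simp add: continuous_map_atin limitin_canonical_iff)

lemma generalized_rayE:
  assumes "generalized_ray X d e"
  obtains (ray) "d \<in> geodesic_rays X" "e = Inr (asymptotic X `` {d})"
  | (segment) R where "R \<ge> 0" "geodesic_on X {0..R} d" "\<And>t. t \<ge> R \<Longrightarrow> d t = d R" "e = Inl (d R)"
  using assms unfolding generalized_ray_def by metis

lemma generalized_ray_in:
  assumes "generalized_ray X d e" "t \<ge> 0"
  shows "d t \<in> mspace X"
  using assms(1)
proof (cases rule: generalized_rayE)
  case ray
  then show ?thesis using assms(2) geodesic_onD(1)[of X "{0..}" d t] by (simp add: geodesic_rays_def)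
next
  case (segment R)
  have "d t = d (min t R)" using segment(3)[of t] by (simp add: min_def)
  then show ?thesis using assms(2) segment(1) geodesic_onD(1)[OF segment(2), of "min t R"] by simp
qed

lemma ray_dist:
  assumes "\<gamma> \<in> geodesic_rays X" "s \<ge> 0" "t \<ge> 0"
  shows "mdist X (\<gamma> s) (\<gamma> t) = \<bar>s - t\<bar>"
  using assms geodesic_onD(2)[of X "{0..}" \<gamma> s t] by (simp add: geodesic_rays_def)

lemma Inl_in_compactification [simp]: "Inl y \<in> compactification X \<longleftrightarrow> y \<in> mspace X"
  and Inr_in_compactification [simp]: "Inr \<xi> \<in> compactification X \<longleftrightarrow> \<xi> \<in> gromov_boundary X"
  unfolding compactification_def by auto

lemma compactificationE:
  assumes "a \<in> compactification X"
  obtains (point) y where "y \<in> mspace X" "a = Inl y" | (boundary) \<xi> where "\<xi> \<in> gromov_boundary X" "a = Inr \<xi>"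
  using assms unfolding compactification_def by auto

lemma geodesic_segment_reverse:
  assumes "geodesic_segment X x y S"
  shows "geodesic_segment X y x S"
proof -
  obtain \<gamma> L where \<gamma>: "L \<ge> 0" "geodesic_on X {0..L} \<gamma>" "\<gamma> 0 = x" "\<gamma> L = y" "S = \<gamma> ` {0..L}"
    using assms unfolding geodesic_segment_def by metis
  have "geodesic_on X {0..L} (\<lambda>t. \<gamma> (L - t))"
    unfolding geodesic_on_def
  proof (intro conjI ballI)
    fix s t assume st: "s \<in> {0..L}" "t \<in> {0..L}"
    then show "mdist X (\<gamma> (L - s)) (\<gamma> (L - t)) = \<bar>s - t\<bar>"
      using geodesic_onD(2)[OF \<gamma>(2), of "L - s" "L - t"] by (simp add: abs_minus_commute)
  qed (use geodesic_onD(1)[OF \<gamma>(2)] in \<open>auto simp: is_interval_cc\<close>)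
  moreover have "(\<lambda>t. \<gamma> (L - t)) ` {0..L} = \<gamma> ` {0..L}"
  proof -
    have "(\<lambda>t. L - t) ` {0..L} = {0..L}" using image_diff_atLeastAtMost[of L 0 L] by simp
    then show ?thesis by (metis image_image)
  qed
  ultimately show ?thesis unfolding geodesic_segment_def using \<gamma>
    by (intro exI[of _ "\<lambda>t. \<gamma> (L - t)"] exI[of _ L]) auto
qed

lemma ray_segment:
  assumes "\<gamma> \<in> geodesic_rays X" "L \<ge> 0"
  shows "geodesic_segment X (\<gamma> 0) (\<gamma> L) (\<gamma> ` {0..L})"
proof -
  have "geodesic_on X {0..L} \<gamma>"
    using assms geodesic_on_subset[of X "{0..}" \<gamma> "{0..L}"] by (auto simp: geodesic_rays_def is_interval_cc)
  then show ?thesis unfolding geodesic_segment_def using assms(2) by blast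
qed

lemma ray_in_mspace: "\<gamma> \<in> geodesic_rays X \<Longrightarrow> t \<ge> 0 \<Longrightarrow> \<gamma> t \<in> mspace X"
  unfolding geodesic_rays_def using geodesic_onD(1)[of X "{0..}"] by auto

lemma segment_dist:
  assumes "geodesic_segment X x y S" "p \<in> S"
  shows "p \<in> mspace X" "mdist X x p + mdist X p y = mdist X x y"
proof -
  obtain \<gamma> L where \<gamma>: "L \<ge> 0" "geodesic_on X {0..L} \<gamma>" "\<gamma> 0 = x" "\<gamma> L = y" "S = \<gamma> ` {0..L}"
    using assms unfolding geodesic_segment_def by metis
  obtain t where t: "t \<in> {0..L}" "p = \<gamma> t" using assms(2) \<gamma>(5) by blast
  have L: "0 \<in> {0..L}" "L \<in> {0..L}" using \<gamma>(1) by auto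
  show "p \<in> mspace X" using geodesic_onD(1)[OF \<gamma>(2) t(1)] t(2) by simp
  show "mdist X x p + mdist X p y = mdist X x y"
    using geodesic_onD(2)[OF \<gamma>(2) L(1) t(1)] geodesic_onD(2)[OF \<gamma>(2) t(1) L(2)]
      geodesic_onD(2)[OF \<gamma>(2) L] t \<gamma>(3,4) by simp
qed

lemma asymptotic_equiv: "equiv (geodesic_rays X) (asymptotic X)"
proof (rule equivI)
  show "asymptotic X \<subseteq> geodesic_rays X \<times> geodesic_rays X" by (auto simp: asymptotic_def)
  show "refl_on (geodesic_rays X) (asymptotic X)"
    by (auto simp: refl_on_def asymptotic_def ray_dist intro!: exI[of _ 0])
  show "sym (asymptotic X)" by (auto simp: sym_def asymptotic_def mdist_commute)
  show "trans (asymptotic X)"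
  proof (rule transI)
    fix \<alpha> \<beta> \<gamma> assume "(\<alpha>, \<beta>) \<in> asymptotic X" "(\<beta>, \<gamma>) \<in> asymptotic X"
    then obtain C D where r: "\<alpha> \<in> geodesic_rays X" "\<beta> \<in> geodesic_rays X" "\<gamma> \<in> geodesic_rays X"
      and C: "\<And>t. t \<ge> 0 \<Longrightarrow> mdist X (\<alpha> t) (\<beta> t) \<le> C" and D: "\<And>t. t \<ge> 0 \<Longrightarrow> mdist X (\<beta> t) (\<gamma> t) \<le> D"
      by (auto simp: asymptotic_def)
    have "mdist X (\<alpha> t) (\<gamma> t) \<le> C + D" if "t \<ge> 0" for t
      using C[OF that] D[OF that]
        mdist_triangle[OF ray_in_mspace[OF r(1) that] ray_in_mspace[OF r(2) that] ray_in_mspace[OF r(3) that]] by linarith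
    then show "(\<alpha>, \<gamma>) \<in> asymptotic X" using r by (auto simp: asymptotic_def)
  qed
qed

lemma boundary_rep:
  assumes "\<xi> \<in> gromov_boundary X" "\<gamma> \<in> \<xi>"
  shows "\<gamma> \<in> geodesic_rays X" "\<xi> = asymptotic X `` {\<gamma>}"
proof -
  obtain \<alpha> where \<alpha>: "\<alpha> \<in> geodesic_rays X" "\<xi> = asymptotic X `` {\<alpha>}"
    using assms(1) by (auto simp: gromov_boundary_def quotient_def)
  then have a: "(\<alpha>, \<gamma>) \<in> asymptotic X" using assms(2) by simp
  then show "\<gamma> \<in> geodesic_rays X" by (auto simp: asymptotic_def)
  show "\<xi> = asymptotic X `` {\<gamma>}" using \<alpha>(2) equiv_class_eq[OF asymptotic_equiv a] by simp
qed

lemma boundary_nonempty: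
  assumes "\<xi> \<in> gromov_boundary X"
  obtains \<gamma> where "\<gamma> \<in> \<xi>"
proof -
  obtain \<alpha> where \<alpha>: "\<alpha> \<in> geodesic_rays X" "\<xi> = asymptotic X `` {\<alpha>}"
    using assms by (auto simp: gromov_boundary_def quotient_def)
  then have "\<alpha> \<in> \<xi>" using equiv_class_self[OF asymptotic_equiv] by simp
  then show ?thesis using that by blast
qed

lemma ray_class:
  assumes "\<gamma> \<in> geodesic_rays X"
  shows "asymptotic X `` {\<gamma>} \<in> gromov_boundary X" "\<gamma> \<in> asymptotic X `` {\<gamma>}"
  using assms equiv_class_self[OF asymptotic_equiv] by (auto simp: gromov_boundary_def quotient_def)

text \<open>The generalized rays are the initial pieces of \<open>\<gamma>\<close>, stopped at time
  \<open>n\<close>. On \<open>{0..T}\<close> they agree with \<open>\<gamma>\<close> once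
  \<open>n \<ge> T\<close>, so the whole sequence converges.\<close>

lemma ray_cone_limit:
  assumes \<gamma>: "\<gamma> \<in> geodesic_rays X"
  shows "cone_limit X (\<lambda>n. Inl (\<gamma> (real n))) (Inr (asymptotic X `` {\<gamma>}))"
  unfolding cone_limit_def
proof (intro bexI[of _ "\<gamma> 0"] exI[of _ "\<lambda>n t. \<gamma> (min t (real n))"] conjI allI impI)
  show "\<gamma> 0 \<in> mspace X" using ray_in_mspace[OF \<gamma>] by simp
  fix n
  show "\<gamma> (min 0 (real n)) = \<gamma> 0" by simp
  have "geodesic_on X {0..real n} (\<lambda>t. \<gamma> (min t (real n)))"
    unfolding geodesic_on_def using ray_in_mspace[OF \<gamma>] by (auto simp: ray_dist[OF \<gamma>] is_interval_cc min_def)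
  then show "generalized_ray X (\<lambda>t. \<gamma> (min t (real n))) (Inl (\<gamma> (real n)))"
    unfolding generalized_ray_def by (intro disjI2 exI[of _ "real n"]) (auto simp: min_def)
next
  fix r :: "nat \<Rightarrow> nat" assume r: "strict_mono r"
  have "locally_uniform_limit X ((\<lambda>n t. \<gamma> (min t (real n))) \<circ> r \<circ> id) \<gamma>"
    unfolding locally_uniform_limit_def
  proof (intro allI impI)
    fix T \<epsilon> :: real assume \<epsilon>: "\<epsilon> > 0"
    obtain N :: nat where N: "T \<le> real N" using real_arch_simple by blast
    have "mdist X (\<gamma> (min t (real (r n)))) (\<gamma> t) < \<epsilon>" if "n \<ge> N" "t \<in> {0..T}" for n t
    proof -
      have "t \<le> real (r n)" using that N strict_mono_imp_increasing[OF r, of n] by simp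
      then show ?thesis using that(2) \<epsilon> ray_in_mspace[OF \<gamma>, of t] by simp
    qed
    then show "\<exists>N. \<forall>n\<ge>N. \<forall>t\<in>{0..T}. mdist X (((\<lambda>n t. \<gamma> (min t (real n))) \<circ> r \<circ> id) n t) (\<gamma> t) < \<epsilon>"
      by (intro exI[of _ N]) auto
  qed
  moreover have "generalized_ray X \<gamma> (Inr (asymptotic X `` {\<gamma>}))" using \<gamma> by (simp add: generalized_ray_def)
  ultimately show "\<exists>r' c'. strict_mono r' \<and> generalized_ray X c' (Inr (asymptotic X `` {\<gamma>})) \<and>
      locally_uniform_limit X ((\<lambda>n t. \<gamma> (min t (real n))) \<circ> r \<circ> r') c'"
    using strict_mono_id by (metis id_def)
qed

text \<open>Complements of cone-open sets are closed under cone limits. A sequence leaving a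
  neighbourhood of \<open>e\<close> infinitely often would have a subsequence in the complement,
  still with cone limit \<open>e\<close>.\<close>

lemma cone_limit_imp_limitin:
  assumes lim: "cone_limit X s e" and s: "\<And>n. s n \<in> compactification X" and e: "e \<in> compactification X"
  shows "limitin (cone_topology X) s e sequentially"
  unfolding limitin_def topspace_cone_topology openin_cone_topology
proof (intro conjI e allI impI)
  fix U assume U: "cone_open X U \<and> e \<in> U"
  show "\<forall>\<^sub>F n in sequentially. s n \<in> U"
  proof (rule ccontr)
    assume "\<not> ?thesis"
    then have "infinite {n. s n \<notin> U}"
      by (simp add: not_eventually frequently_cofinite flip: cofinite_eq_sequentially)
    then obtain r :: "nat \<Rightarrow> nat" where r: "strict_mono r" "\<And>n. r n \<in> {n. s n \<notin> U}"
      using infinite_enumerate by blast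
    have "cone_limit X (s \<circ> r) e" by (rule cone_limit_subseq[OF lim r(1)])
    moreover have "\<forall>n. (s \<circ> r) n \<in> compactification X - U" using s r(2) by auto
    ultimately show False using U unfolding cone_open_def by blast
  qed
qed

lemma ray_limitin:
  assumes "\<xi> \<in> gromov_boundary X" "\<gamma> \<in> \<xi>"
  shows "limitin (cone_topology X) (\<lambda>n. Inl (\<gamma> (real n))) (Inr \<xi>) sequentially"
  using ray_cone_limit[OF boundary_rep(1)[OF assms]] boundary_rep(2)[OF assms] assms(1)
    ray_in_mspace[OF boundary_rep(1)[OF assms]]
  by (intro cone_limit_imp_limitin) simp_all

lemma extension_limit:
  assumes g: "extends_gromov_product X x g"
    and a: "limitin (cone_topology X) \<sigma> a sequentially" and b: "limitin (cone_topology X) \<tau> b sequentially"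
  shows "(\<lambda>n. g (\<sigma> n, \<tau> n)) \<longlonglongrightarrow> g (a, b)"
proof -
  let ?T = "prod_topology (cone_topology X) (cone_topology X)"
  have "continuous_map ?T euclidean g"
    using g by (simp add: extends_gromov_product_def continuous_map_in_subtopology)
  moreover have "limitin ?T (\<lambda>n. (\<sigma> n, \<tau> n)) (a, b) sequentially"
    using a b by (simp add: limitin_pairwise comp_def)
  ultimately have "limitin euclidean (g \<circ> (\<lambda>n. (\<sigma> n, \<tau> n))) (g (a, b)) sequentially"
    by (rule continuous_map_limit)
  then show ?thesis by (simp add: limitin_canonical_iff comp_def)
qed

lemma extension_rays:
  assumes g: "extends_gromov_product X x g"
    and \<xi>: "\<xi> \<in> gromov_boundary X" "\<gamma> \<in> \<xi>" and \<eta>: "\<eta> \<in> gromov_boundary X" "\<gamma>' \<in> \<eta>"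
  shows "(\<lambda>n. ereal (gromov_product X x (\<gamma> (real n)) (\<gamma>' (real n)))) \<longlonglongrightarrow> g (Inr \<xi>, Inr \<eta>)"
proof -
  have "g (Inl (\<gamma> (real n)), Inl (\<gamma>' (real n))) = ereal (gromov_product X x (\<gamma> (real n)) (\<gamma>' (real n)))" for n
    using g ray_in_mspace[OF boundary_rep(1)[OF \<xi>], of "real n"] ray_in_mspace[OF boundary_rep(1)[OF \<eta>], of "real n"]
    by (simp add: extends_gromov_product_def)
  then show ?thesis using extension_limit[OF g ray_limitin[OF \<xi>] ray_limitin[OF \<eta>]] by simp
qed

lemma extension_point_ray:
  assumes g: "extends_gromov_product X x g" and y: "y \<in> mspace X"
    and \<eta>: "\<eta> \<in> gromov_boundary X" "\<gamma> \<in> \<eta>"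
  shows "(\<lambda>n. ereal (gromov_product X x y (\<gamma> (real n)))) \<longlonglongrightarrow> g (Inl y, Inr \<eta>)"
proof -
  have "g (Inl y, Inl (\<gamma> (real n))) = ereal (gromov_product X x y (\<gamma> (real n)))" for n
    using g y ray_in_mspace[OF boundary_rep(1)[OF \<eta>], of "real n"] by (simp add: extends_gromov_product_def)
  moreover have "limitin (cone_topology X) (\<lambda>n. Inl y) (Inl y) sequentially"
    using y by (simp add: limitin_const_iff topspace_cone_topology)
  ultimately show ?thesis using extension_limit[OF g _ ray_limitin[OF \<eta>], of "\<lambda>_. Inl y"] by simp
qed

lemma slimD:
  assumes "slim_triangles X \<delta>" "geodesic_segment X x y S" "geodesic_segment X y z T"
    "geodesic_segment X z x U" "p \<in> S"
  obtains q where "q \<in> T" "mdist X p q \<le> \<delta>" | q where "q \<in> U" "mdist X p q \<le> \<delta>"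
  using assms unfolding slim_triangles_def by blast

text \<open>The gain is a bound free of the constant \<open>C\<close> of the asymptotic relation: it
  is uniform over all rays of a class from one point and so survives limits. In a long triangle with
  apex \<open>\<gamma> 0\<close> the point \<open>\<gamma> s\<close> is too far from the short side,
  hence close to \<open>\<gamma>'\<close>; comparing distances from the apex costs another
  \<open>\<delta>\<close>.\<close>

lemma asymptotic_rays_close:
  assumes X: "geodesic_space X" "slim_triangles X \<delta>"
    and as: "(\<gamma>, \<gamma>') \<in> asymptotic X" and p: "\<gamma> 0 = \<gamma>' 0" and s: "s \<ge> 0"
  shows "mdist X (\<gamma> s) (\<gamma>' s) \<le> 2 * \<delta>"
proof -
  obtain C where r: "\<gamma> \<in> geodesic_rays X" "\<gamma>' \<in> geodesic_rays X"
    and C: "\<And>t. t \<ge> 0 \<Longrightarrow> mdist X (\<gamma> t) (\<gamma>' t) \<le> C"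
    using as by (auto simp: asymptotic_def)
  note in_X = ray_in_mspace[OF r(1)] ray_in_mspace[OF r(2)]
  \<comment> \<open>So large that a point within \<open>\<delta>\<close> of
    \<open>\<gamma> s\<close> on the side from \<open>\<gamma> t\<close> to
    \<open>\<gamma>' t\<close>, whose length is at most \<open>C\<close>, would contradict
    \<open>t - s \<le> \<delta> + C\<close>.\<close>
  define t where "t = s + \<bar>C\<bar> + \<bar>\<delta>\<bar> + 1"
  have t: "t \<ge> 0" "s \<le> t" using s by (auto simp: t_def)
  obtain T where T: "geodesic_segment X (\<gamma> t) (\<gamma>' t) T"
    using X(1) in_X(1)[OF t(1)] in_X(2)[OF t(1)] unfolding geodesic_space_def by blast
  have U: "geodesic_segment X (\<gamma>' t) (\<gamma> 0) (\<gamma>' ` {0..t})"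
    using geodesic_segment_reverse[OF ray_segment[OF r(2) t(1)]] p by simp
  have "\<gamma> s \<in> \<gamma> ` {0..t}" using s t by simp
  then show ?thesis
  proof (cases rule: slimD[OF X(2) ray_segment[OF r(1) t(1)] T U, consumes 1])
    case (1 q)
    note q = segment_dist[OF T 1(1)]
    have "mdist X (\<gamma> t) q \<le> C" using q(2) C[OF t(1)] mdist_nonneg[of X q "\<gamma>' t"] by linarith
    moreover have "mdist X (\<gamma> s) (\<gamma> t) \<le> mdist X (\<gamma> s) q + mdist X q (\<gamma> t)"
      by (intro mdist_triangle in_X q s t)
    ultimately have "t - s \<le> \<delta> + C" using 1(2) ray_dist[OF r(1) s t(1)] t(2) mdist_commute[of X q] by simp
    then have False by (simp add: t_def)
    then show ?thesis ..
  next
    case (2 q)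
    then obtain u where u: "u \<ge> 0" "q = \<gamma>' u" by auto
    have "mdist X (\<gamma> 0) (\<gamma> s) = s" "mdist X (\<gamma> 0) (\<gamma>' u) = u"
      using ray_dist[OF r(1) _ s, of 0] ray_dist[OF r(2) _ u(1), of 0] p s u by auto
    then have "\<bar>s - u\<bar> \<le> \<delta>"
      using mdist_reverse_triangle[OF in_X(1)[OF s] in_X(2)[OF u(1)] in_X(1)[of 0]] 2(2) u(2)
      by (simp add: mdist_commute)
    moreover have "mdist X (\<gamma> s) (\<gamma>' s) \<le> mdist X (\<gamma> s) (\<gamma>' u) + mdist X (\<gamma>' u) (\<gamma>' s)"
      by (intro mdist_triangle in_X s u)
    ultimately show ?thesis using 2(2) u ray_dist[OF r(2) u(1) s] by (simp add: abs_minus_commute)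
  qed
qed

text \<open>All approximating rays start at \<open>p\<close> and lie in the class \<xi>, hence stay
  uniformly close to one of them, and so does a limit ray. A limit segment is impossible, since it
  stops while the rays keep moving.\<close>

lemma cone_limit_const_boundary:
  assumes X: "geodesic_space X" "slim_triangles X \<delta>"
    and \<xi>: "\<xi> \<in> gromov_boundary X" and lim: "cone_limit X (\<lambda>_. Inr \<xi>) e"
  shows "e = Inr \<xi>"
proof -
  obtain p cn where p: "p \<in> mspace X" and cn: "\<And>n. cn n 0 = p" "\<And>n. generalized_ray X (cn n) (Inr \<xi>)"
    and sub: "\<And>r :: nat \<Rightarrow> nat. strict_mono r \<Longrightarrow> \<exists>(r' :: nat \<Rightarrow> nat) c'. strict_mono r' \<and>
      generalized_ray X c' e \<and> locally_uniform_limit X (cn \<circ> r \<circ> r') c'"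
    using lim unfolding cone_limit_def by blast
  obtain r cl where cl: "generalized_ray X cl e" and lul: "locally_uniform_limit X (cn \<circ> id \<circ> r) cl"
    using sub[of id] strict_mono_id by (auto simp: id_def strict_mono_def)
  have near: "\<exists>n. \<forall>t\<in>{0..T}. mdist X (cn n t) (cl t) < \<epsilon>" if "\<epsilon> > 0" for T \<epsilon>
    using lul that unfolding locally_uniform_limit_def by (simp add: comp_def) blast
  have cn_ray: "cn n \<in> geodesic_rays X" "\<xi> = asymptotic X `` {cn n}" for n
    using cn(2)[of n] by (auto simp: generalized_ray_def)
  from cl show ?thesis
  proof (cases rule: generalized_rayE)
    case ray
    have "mdist X (cn 0 t) (cl t) \<le> 2 * \<delta> + 1" if t: "t \<ge> 0" for t
    proof -
      obtain n where n: "\<forall>u\<in>{0..t}. mdist X (cn n u) (cl u) < 1" using near[of 1 t] by auto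
      have "cn n \<in> asymptotic X `` {cn 0}" using ray_class(2)[OF cn_ray(1)[of n]] cn_ray(2) by metis
      then have "(cn 0, cn n) \<in> asymptotic X" by simp
      from asymptotic_rays_close[OF X this _ t] have "mdist X (cn 0 t) (cn n t) \<le> 2 * \<delta>" using cn(1) by simp
      moreover have "mdist X (cn 0 t) (cl t) \<le> mdist X (cn 0 t) (cn n t) + mdist X (cn n t) (cl t)"
        using cn_ray(1) t by (intro mdist_triangle ray_in_mspace generalized_ray_in[OF cl])
      moreover have "mdist X (cn n t) (cl t) < 1" using n t by simp
      ultimately show ?thesis by linarith
    qed
    then have "(cn 0, cl) \<in> asymptotic X" using cn_ray(1) ray(1) by (auto simp: asymptotic_def)
    from equiv_class_eq[OF asymptotic_equiv this] show ?thesis using ray(2) cn_ray(2)[of 0] by simp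
  next
    case (segment R)
    have R: "R \<in> {0..R}" "0 \<in> {0..R}" "R + 1 \<ge> 0" using segment(1) by auto
    have clR: "cl R \<in> mspace X" "cl 0 \<in> mspace X" using geodesic_onD(1)[OF segment(2)] R by auto
    \<comment> \<open>At time \<open>R + 1\<close> the ray has covered \<open>R + 1\<close>, the
      limit only \<open>R\<close>; two errors below 1/2 cannot make up the difference.\<close>
    obtain n where n: "\<forall>t\<in>{0..R+1}. mdist X (cn n t) (cl t) < 1/2" using near[of "1/2" "R + 1"] by auto
    have n0: "mdist X (cn n 0) (cl 0) < 1/2" "mdist X (cn n (R + 1)) (cl R) < 1/2"
      using n[rule_format, of 0] n[rule_format, of "R + 1"] R segment(3)[of "R + 1"] by auto
    have d: "cn n 0 \<in> mspace X" "cn n (R + 1) \<in> mspace X" using ray_in_mspace[OF cn_ray(1)] R by auto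
    have "mdist X (cn n 0) (cn n (R + 1)) \<le> mdist X (cn n 0) (cl 0) + mdist X (cl 0) (cn n (R + 1))"
      by (rule mdist_triangle[OF d(1) clR(2) d(2)])
    also have "mdist X (cl 0) (cn n (R + 1)) \<le> mdist X (cl 0) (cl R) + mdist X (cl R) (cn n (R + 1))"
      by (rule mdist_triangle[OF clR(2,1) d(2)])
    finally have "R + 1 < R + 1"
      using n0 geodesic_onD(2)[OF segment(2) R(2,1)] segment(1) mdist_commute[of X "cl R"]
        ray_dist[OF cn_ray(1)[of n] _ R(3), of 0] by simp
    then show ?thesis by simp
  qed
qed

text \<open>A constant boundary sequence has no second limit, so points are closed, and a finite T1
  space is discrete. The topological half of the Moebius condition thereby reduces to
  bijectivity.\<close>

lemma boundary_topology_discrete: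
  assumes X: "gromov_hyperbolic X" and fin: "finite (gromov_boundary X)"
  shows "boundary_topology X = discrete_topology (gromov_boundary X)"
proof (rule finite_t1_space_imp_discrete_topology)
  obtain \<delta> where \<delta>: "geodesic_space X" "slim_triangles X \<delta>" using X by (auto simp: gromov_hyperbolic_def)
  show "topspace (boundary_topology X) = gromov_boundary X" by (rule topspace_boundary_topology)
  show "t1_space (boundary_topology X)"
    unfolding t1_space_def topspace_boundary_topology
  proof (intro allI impI ballI)
    fix \<xi> \<eta> assume \<xi>\<eta>: "\<xi> \<in> gromov_boundary X" "\<eta> \<in> gromov_boundary X" "\<xi> \<noteq> \<eta>"
    let ?U = "compactification X - {Inr \<eta>}"
    have "cone_open X ?U"
      unfolding cone_open_def
    proof (intro conjI allI impI)
      fix s e assume s: "(\<forall>n. s n \<in> compactification X - ?U) \<and> cone_limit X s e"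
      then have "s n = Inr \<eta>" for n by blast
      then have "s = (\<lambda>_. Inr \<eta>)" by blast
      then show "e \<notin> ?U" using cone_limit_const_boundary[OF \<delta>, of \<eta> e] s \<xi>\<eta> by simp
    qed auto
    then have "openin (boundary_topology X) (Inr -` ?U \<inter> gromov_boundary X)"
      unfolding boundary_topology_def openin_pullback_topology openin_cone_topology by blast
    moreover have "\<xi> \<in> Inr -` ?U \<inter> gromov_boundary X" "\<eta> \<notin> Inr -` ?U \<inter> gromov_boundary X"
      using \<xi>\<eta> by auto
    ultimately show "\<exists>U. openin (boundary_topology X) U \<and> \<xi> \<in> U \<and> \<eta> \<notin> U" by blast
  qed
qed (rule fin)

text \<open>If the Gromov products of two rays are unbounded, then thinness, applied in the two triangles
  of the quadrilateral with vertices \<open>\<gamma> 0\<close>, \<open>\<gamma> n\<close>, \<open>\<gamma>' n\<close>, \<open>\<gamma>' 0\<close>, makes the rays asymptotic.\<close>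

lemma distinct_ends_product_finite:
  assumes X: "geodesic_space X" "slim_triangles X \<delta>" and x: "x \<in> mspace X"
    and g: "extends_gromov_product X x g"
    and \<xi>: "\<xi> \<in> gromov_boundary X" and \<eta>: "\<eta> \<in> gromov_boundary X" and ne: "\<xi> \<noteq> \<eta>"
  shows "g (Inr \<xi>, Inr \<eta>) \<noteq> \<infinity>"
proof
  assume inf: "g (Inr \<xi>, Inr \<eta>) = \<infinity>"
  obtain \<gamma> where \<gamma>: "\<gamma> \<in> \<xi>" using boundary_nonempty[OF \<xi>] .
  obtain \<gamma>' where \<gamma>': "\<gamma>' \<in> \<eta>" using boundary_nonempty[OF \<eta>] .
  note r = boundary_rep(1)[OF \<xi> \<gamma>] boundary_rep(1)[OF \<eta> \<gamma>']
  note in_X = ray_in_mspace[OF r(1)] ray_in_mspace[OF r(2)]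
  define D where "D = mdist X (\<gamma> 0) (\<gamma>' 0)"
  have big: "\<forall>\<^sub>F n in sequentially. B < gromov_product X x (\<gamma> (real n)) (\<gamma>' (real n))" for B
    using extension_rays[OF g \<xi> \<gamma> \<eta> \<gamma>'] unfolding inf tendsto_PInfty by simp
  have "mdist X (\<gamma> s) (\<gamma>' s) \<le> 4 * \<delta> + 3 * D" if s: "s \<ge> 0" for s
  proof -
    have "\<forall>\<^sub>F n in sequentially. s \<le> real n"
      using filterlim_real_sequentially by (auto simp: filterlim_at_top)
    \<comment> \<open>Every point of a geodesic from \<open>\<gamma> n\<close> to
      \<open>\<gamma>' n\<close> has distance from \<open>x\<close> at least the Gromov product, so
      for this \<open>n\<close> none is within \<open>\<delta>\<close> of
      \<open>\<gamma> s\<close>.\<close>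
    from eventually_happens[OF eventually_conj[OF this big[of "s + \<delta> + mdist X x (\<gamma> 0)"]]]
    obtain n where n: "s \<le> real n"
      "s + \<delta> + mdist X x (\<gamma> 0) < gromov_product X x (\<gamma> (real n)) (\<gamma>' (real n))" by auto
    let ?a = "\<gamma> (real n)" and ?b = "\<gamma>' (real n)" and ?p = "\<gamma> 0" and ?p' = "\<gamma>' 0"
    have ab: "?a \<in> mspace X" "?b \<in> mspace X" "?p \<in> mspace X" "?p' \<in> mspace X" using in_X by auto
    obtain T where T: "geodesic_segment X ?a ?b T" using X(1) ab unfolding geodesic_space_def by blast
    obtain U where U: "geodesic_segment X ?b ?p U" using X(1) ab unfolding geodesic_space_def by blast
    obtain V where V: "geodesic_segment X ?p ?p' V" using X(1) ab unfolding geodesic_space_def by blast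
    have n0: "real n \<ge> 0" by simp
    note S = ray_segment[OF r(1) n0] and S' = ray_segment[OF r(2) n0]
    have sS: "\<gamma> s \<in> \<gamma> ` {0..real n}" using s n(1) by simp
    have ps: "mdist X ?p (\<gamma> s) = s" using ray_dist[OF r(1) _ s, of 0] s by simp
    have "\<exists>u\<ge>0. mdist X (\<gamma> s) (\<gamma>' u) \<le> 2 * \<delta> + D"
      using sS
    proof (cases rule: slimD[OF X(2) S T U, consumes 1])
      case (1 q)
      note q = segment_dist[OF T 1(1)]
      have "mdist X ?p q \<le> s + \<delta>" using mdist_triangle[OF ab(3) in_X(1)[OF s] q(1)] ps 1(2) by linarith
      moreover have "gromov_product X x ?a ?b \<le> mdist X x q"
        using mdist_triangle[OF ab(1) q(1) x] mdist_triangle[OF ab(2) q(1) x] q(2)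
          mdist_commute[of X ?b q] mdist_commute[of X q x]
        by (simp add: gromov_product_def)
      moreover have "mdist X x q \<le> mdist X x ?p + mdist X ?p q" by (intro mdist_triangle x ab q)
      ultimately have False using n(2) by linarith
      then show ?thesis ..
    next
      case (2 q)
      note q = segment_dist[OF U 2(1)]
      from 2(1) show ?thesis
      proof (cases rule: slimD[OF X(2) U V S', consumes 1])
        case (1 q')
        note q' = segment_dist[OF V 1(1)]
        have "mdist X q' ?p' \<le> D" using q'(2) mdist_nonneg[of X ?p q'] unfolding D_def by linarith
        moreover have "mdist X (\<gamma> s) ?p' \<le> mdist X (\<gamma> s) q + mdist X q ?p'"
          by (intro mdist_triangle in_X q s) simp
        moreover have "mdist X q ?p' \<le> mdist X q q' + mdist X q' ?p'"
          by (intro mdist_triangle q q' ab)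
        ultimately show ?thesis using 1(2) 2(2) by (intro exI[of _ 0]) simp
      next
        case (2 q')
        then obtain u where u: "u \<ge> 0" "q' = \<gamma>' u" by auto
        have "mdist X (\<gamma> s) (\<gamma>' u) \<le> mdist X (\<gamma> s) q + mdist X q (\<gamma>' u)"
          by (intro mdist_triangle in_X q s u)
        then show ?thesis using 2(2)[unfolded u(2)] \<open>mdist X (\<gamma> s) q \<le> \<delta>\<close> u(1) mdist_nonneg[of X ?p ?p']
          unfolding D_def by (intro exI[of _ u] conjI) linarith+
      qed
    qed
    then obtain u where u: "u \<ge> 0" "mdist X (\<gamma> s) (\<gamma>' u) \<le> 2 * \<delta> + D" by blast
    have pu: "mdist X ?p' (\<gamma>' u) = u" using ray_dist[OF r(2) _ u(1), of 0] u(1) by simp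
    have "u \<le> D + mdist X ?p (\<gamma>' u)"
      using mdist_triangle[OF ab(4,3) in_X(2)[OF u(1)]] pu mdist_commute[of X ?p ?p'] by (simp add: D_def)
    moreover have "mdist X ?p (\<gamma>' u) \<le> s + (2 * \<delta> + D)"
      using mdist_triangle[OF ab(3) in_X(1)[OF s] in_X(2)[OF u(1)]] ps u(2) by linarith
    moreover have "s \<le> mdist X ?p (\<gamma>' u) + (2 * \<delta> + D)"
      using mdist_triangle[OF ab(3) in_X(2)[OF u(1)] in_X(1)[OF s]] ps u(2) mdist_commute[of X "\<gamma> s"] by simp
    moreover have "mdist X ?p (\<gamma>' u) \<le> D + u"
      using mdist_triangle[OF ab(3,4) in_X(2)[OF u(1)]] pu by (simp add: D_def)
    ultimately have "\<bar>u - s\<bar> \<le> 2 * \<delta> + 2 * D" by (simp add: abs_le_iff)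
    moreover have "mdist X (\<gamma> s) (\<gamma>' s) \<le> mdist X (\<gamma> s) (\<gamma>' u) + mdist X (\<gamma>' u) (\<gamma>' s)"
      by (intro mdist_triangle in_X s u)
    ultimately show ?thesis using u(2) ray_dist[OF r(2) u(1) s] by linarith
  qed
  then have "(\<gamma>, \<gamma>') \<in> asymptotic X" using r by (auto simp: asymptotic_def)
  from equiv_class_eq[OF asymptotic_equiv this]
  show False using boundary_rep(2)[OF \<xi> \<gamma>] boundary_rep(2)[OF \<eta> \<gamma>'] ne by simp
qed

lemma visual_quasimetric_finite:
  "boundary_product X x \<xi> \<eta> = ereal p \<Longrightarrow> visual_quasimetric X x \<xi> \<eta> = exp (- p)"
  by (simp add: visual_quasimetric_def)

text \<open>Each of the four terms \<open>b\<close> occurs once in the numerator and once in the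
  denominator and cancels. Boundary products of this form with the same \<open>w\<close> thus give
  the same cross-ratios, whatever the base points.\<close>

lemma cross_ratio_formula:
  fixes b :: "'z \<Rightarrow> real"
  assumes p: "\<And>i j. i \<in> Z \<Longrightarrow> j \<in> Z \<Longrightarrow> i \<noteq> j \<Longrightarrow>
      boundary_product X x (e i) (e j) = ereal ((b i + b j - w i j) / 2)"
    and Z: "i \<in> Z" "i' \<in> Z" "j \<in> Z" "j' \<in> Z" "distinct [i, i', j, j']"
  shows "cross_ratio X x (e i) (e i') (e j) (e j') = exp ((w i j + w i' j' - w i j' - w i' j) / 2)"
proof -
  have q: "visual_quasimetric X x (e k) (e l) = exp (- ((b k + b l - w k l) / 2))"
    if "k \<in> Z" "l \<in> Z" "k \<noteq> l" for k l
    by (rule visual_quasimetric_finite[OF p[OF that]])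
  have "cross_ratio X x (e i) (e i') (e j) (e j') =
      exp (- ((b i + b j - w i j) / 2) + - ((b i' + b j' - w i' j') / 2) -
        (- ((b i + b j' - w i j') / 2) + - ((b i' + b j - w i' j) / 2)))"
    using Z by (simp only: cross_ratio_def q distinct.simps exp_add exp_diff) (simp add: q exp_add exp_diff)
  also have "\<dots> = exp ((w i j + w i' j' - w i j' - w i' j) / 2)"
    by (simp add: field_simps)
  finally show ?thesis .
qed

text \<open>By continuity one pair of rays determines the value, which makes the arbitrary choice of
  the extension in \<open>boundary_product\<close> harmless.\<close>

lemma boundary_product_eqI:
  assumes X: "good_space X" and x: "x \<in> mspace X"
    and \<xi>: "\<xi> \<in> gromov_boundary X" "\<gamma> \<in> \<xi>" and \<eta>: "\<eta> \<in> gromov_boundary X" "\<gamma>' \<in> \<eta>"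
    and lim: "(\<lambda>n. ereal (gromov_product X x (\<gamma> (real n)) (\<gamma>' (real n)))) \<longlonglongrightarrow> p"
  shows "boundary_product X x \<xi> \<eta> = p"
proof -
  have "\<exists>g. extends_gromov_product X x g"
    using X x by (simp add: good_space_def boundary_continuous_def)
  then have "extends_gromov_product X x (SOME g. extends_gromov_product X x g)" by (rule someI_ex)
  from extension_rays[OF this \<xi> \<eta>] show ?thesis
    unfolding boundary_product_def using lim LIMSEQ_unique by blast
qed

section \<open>Tight functions\<close>

text \<open>The restriction to \<open>i \<noteq> j\<close> reflects the infinite Gromov product of a
  boundary point with itself. An inequality on the diagonal would bound every coordinate from below
  and destroy the ends.\<close>

definition admissible :: "'z set \<Rightarrow> ('z \<Rightarrow> 'z \<Rightarrow> real) \<Rightarrow> ('z \<Rightarrow> real) \<Rightarrow> bool" where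
  "admissible Z w f \<longleftrightarrow> (\<forall>i\<in>Z. \<forall>j\<in>Z. i \<noteq> j \<longrightarrow> w i j \<le> f i + f j)"

definition tight :: "'z set \<Rightarrow> ('z \<Rightarrow> 'z \<Rightarrow> real) \<Rightarrow> ('z \<Rightarrow> real) \<Rightarrow> bool" where
  "tight Z w f \<longleftrightarrow> admissible Z w f \<and> (\<forall>i\<in>Z. \<exists>j\<in>Z. j \<noteq> i \<and> f i + f j = w i j)"

lemma admissibleD: "admissible Z w f \<Longrightarrow> i \<in> Z \<Longrightarrow> j \<in> Z \<Longrightarrow> i \<noteq> j \<Longrightarrow> w i j \<le> f i + f j"
  unfolding admissible_def by simp

lemma tight_minimal:
  assumes "tight Z w f" "admissible Z w g" "\<And>i. i \<in> Z \<Longrightarrow> g i \<le> f i" "i \<in> Z"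
  shows "g i = f i"
proof -
  obtain j where j: "j \<in> Z" "j \<noteq> i" "f i + f j = w i j"
    using assms(1,4) unfolding tight_def by blast
  have "w i j \<le> g i + g j"
    using admissibleD[OF assms(2,4) j(1)] j(2) by simp
  with j show ?thesis using assms(3)[of i] assms(3)[of j] assms(4) by linarith
qed

text \<open>The coordinates are lowered one after the other to the least admissible value; a coordinate
  that has become tight stays tight, since its partner cannot be lowered any more.\<close>

lemma tight_retraction:
  fixes w :: "'z \<Rightarrow> 'z \<Rightarrow> real"
  assumes fin: "finite Z" and card: "2 \<le> card Z"
    and sym: "\<forall>i\<in>Z. \<forall>j\<in>Z. w i j = w j i"
  shows "\<exists>r. (\<forall>f. admissible Z w f \<longrightarrow> tight Z w (r f) \<and> (\<forall>i\<in>Z. r f i \<le> f i)) \<and>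
     (\<forall>f g D. admissible Z w f \<and> admissible Z w g \<and> (\<forall>i\<in>Z. \<bar>f i - g i\<bar> \<le> D) \<longrightarrow>
        (\<forall>i\<in>Z. \<bar>r f i - r g i\<bar> \<le> D))"
proof -
  have partial: "\<exists>r. (\<forall>f. admissible Z w f \<longrightarrow> admissible Z w (r f) \<and> (\<forall>i\<in>Z. r f i \<le> f i) \<and>
            (\<forall>i\<in>S. \<exists>j\<in>Z. j \<noteq> i \<and> r f i + r f j = w i j)) \<and>
       (\<forall>f g D. admissible Z w f \<and> admissible Z w g \<and> (\<forall>i\<in>Z. \<bar>f i - g i\<bar> \<le> D) \<longrightarrow>
        (\<forall>i\<in>Z. \<bar>r f i - r g i\<bar> \<le> D))" if "S \<subseteq> Z" for S
    using finite_subset[OF that fin] that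
  proof (induction S rule: finite_induct)
    case empty
    show ?case by (rule exI[of _ "\<lambda>f. f"]) auto
  next
    case (insert k S)
    then have k: "k \<in> Z" by simp
    from insert.prems have "S \<subseteq> Z" by simp
    from insert.IH[OF this]
    obtain r where r: "\<And>f. admissible Z w f \<Longrightarrow> admissible Z w (r f)"
        "\<And>f i. admissible Z w f \<Longrightarrow> i \<in> Z \<Longrightarrow> r f i \<le> f i"
        "\<And>f i. admissible Z w f \<Longrightarrow> i \<in> S \<Longrightarrow> \<exists>j\<in>Z. j \<noteq> i \<and> r f i + r f j = w i j"
        "\<And>f g D i. admissible Z w f \<Longrightarrow> admissible Z w g \<Longrightarrow> \<forall>i\<in>Z. \<bar>f i - g i\<bar> \<le> D \<Longrightarrow> i \<in> Z \<Longrightarrow>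
          \<bar>r f i - r g i\<bar> \<le> D"
      by (elim exE conjE) blast
    have fZ: "finite (Z - {k})" using fin by simp
    have neZ: "Z - {k} \<noteq> {}"
    proof
      assume "Z - {k} = {}"
      then have "Z = {k}" using k by blast
      then show False using card by simp
    qed
    define q where "q f = Max ((\<lambda>j. w k j - f j) ` (Z - {k}))" for f :: "'z \<Rightarrow> real"
    define u where "u f = f(k := q f)" for f :: "'z \<Rightarrow> real"
    have q_ge: "w k j - f j \<le> q f" if "j \<in> Z" "j \<noteq> k" for f j
      unfolding q_def using fZ that by (intro Max_ge) auto
    have q_eq: "\<exists>j\<in>Z. j \<noteq> k \<and> q f = w k j - f j" for f
    proof -
      have "q f \<in> (\<lambda>j. w k j - f j) ` (Z - {k})"
        unfolding q_def using fZ neZ by (intro Max_in) auto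
      then show ?thesis by auto
    qed
    have q_le: "q f \<le> f k" if "admissible Z w f" for f
    proof -
      obtain j where j: "j \<in> Z" "j \<noteq> k" "q f = w k j - f j" using q_eq by blast
      then show ?thesis using admissibleD[OF that k j(1)] by auto
    qed
    have u_adm: "admissible Z w (u f)" if f: "admissible Z w f" for f
      unfolding admissible_def
    proof (intro ballI impI)
      fix i j assume ij: "i \<in> Z" "j \<in> Z" "i \<noteq> j"
      consider "i = k" | "j = k" | "i \<noteq> k" "j \<noteq> k" by blast
      then show "w i j \<le> u f i + u f j"
      proof cases
        case 1 then show ?thesis using q_ge[of j f] ij by (simp add: u_def)
      next
        case 2 then show ?thesis using q_ge[of i f] ij sym[rule_format, of i k] by (simp add: u_def)
      next
        case 3 then show ?thesis using f ij by (simp add: u_def admissible_def)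
      qed
    qed
    have u_tight: "\<exists>j\<in>Z. j \<noteq> i \<and> u f i + u f j = w i j"
      if f: "admissible Z w f" and i: "i \<in> insert k S" "i \<in> Z"
        and tS: "i \<in> S \<Longrightarrow> \<exists>j\<in>Z. j \<noteq> i \<and> f i + f j = w i j" for f i
    proof (cases "i = k")
      case True
      obtain j where "j \<in> Z" "j \<noteq> k" "q f = w k j - f j" using q_eq by blast
      then show ?thesis using True by (intro bexI[of _ j]) (auto simp: u_def)
    next
      case False
      then obtain j where j: "j \<in> Z" "j \<noteq> i" "f i + f j = w i j" using tS i by blast
      have "q f = f k" if "j = k"
        using q_le[OF f] q_ge[of i f] that j sym[rule_format, of i k] i False k by auto
      then show ?thesis using j False by (intro bexI[of _ j]) (auto simp: u_def)
    qed
    have u_lip: "\<bar>u f i - u g i\<bar> \<le> D" if D: "\<forall>i\<in>Z. \<bar>f i - g i\<bar> \<le> D" and i: "i \<in> Z" for f g D i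
    proof -
      have "q f \<le> q g + D" if D: "\<forall>i\<in>Z. \<bar>f i - g i\<bar> \<le> D" for f g
      proof -
        obtain j where j: "j \<in> Z" "j \<noteq> k" "q f = w k j - f j" using q_eq by blast
        then show ?thesis using q_ge[of j g] D[rule_format, of j] by linarith
      qed
      from this[of f g] this[of g f] have "\<bar>q f - q g\<bar> \<le> D"
        using D by (simp add: abs_minus_commute abs_le_iff)
      then show ?thesis using D i by (auto simp: u_def)
    qed
    show ?case
    proof (intro exI[of _ "\<lambda>f. u (r f)"] conjI allI impI ballI)
      fix f assume f: "admissible Z w f"
      show "admissible Z w (u (r f))" by (intro u_adm r f)
      show "u (r f) i \<le> f i" if "i \<in> Z" for i
        using r(2)[OF f that] q_le[OF r(1)[OF f]] unfolding u_def by auto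
      show "\<exists>j\<in>Z. j \<noteq> i \<and> u (r f) i + u (r f) j = w i j" if "i \<in> insert k S" for i
        using u_tight[OF r(1)[OF f] that] r(3)[OF f] that insert.prems by blast
    next
      fix f g D i
      assume "admissible Z w f \<and> admissible Z w g \<and> (\<forall>i\<in>Z. \<bar>f i - g i\<bar> \<le> D)" "i \<in> Z"
      then show "\<bar>u (r f) i - u (r g) i\<bar> \<le> D"
        by (intro u_lip ballI r(4)) auto
    qed
  qed
  from partial[OF order_refl] show ?thesis unfolding tight_def by (elim ex_forward) simp
qed

text \<open>The coordinate \<open>c y i\<close> plays the role of the Busemann function of the boundary point \<open>i\<close>
  at \<open>y\<close>; it tends to \<open>-\<infinity>\<close> along rays toward \<open>i\<close>.\<close>

locale tight_model =
  fixes Z :: "'z set" and w :: "'z \<Rightarrow> 'z \<Rightarrow> real" and Y :: "'y metric" and c :: "'y \<Rightarrow> 'z \<Rightarrow> real"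
  assumes finite_Z: "finite Z" and card_Z: "3 \<le> card Z"
    and w_sym: "i \<in> Z \<Longrightarrow> j \<in> Z \<Longrightarrow> w i j = w j i"
    and coord_tight: "y \<in> mspace Y \<Longrightarrow> tight Z w (c y)"
    and coord_surj: "tight Z w f \<Longrightarrow> \<exists>y\<in>mspace Y. \<forall>i\<in>Z. c y i = f i"
    and dist_eq: "y \<in> mspace Y \<Longrightarrow> z \<in> mspace Y \<Longrightarrow>
      mdist Y y z = Max ((\<lambda>i. \<bar>c y i - c z i\<bar>) ` Z)"
begin

lemma Z_nonempty: "Z \<noteq> {}"
  using card_Z by auto

lemma coord_ge: "y \<in> mspace Y \<Longrightarrow> i \<in> Z \<Longrightarrow> j \<in> Z \<Longrightarrow> i \<noteq> j \<Longrightarrow> w i j \<le> c y i + c y j"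
  using coord_tight unfolding tight_def admissible_def by blast

lemma coord_partner:
  assumes "y \<in> mspace Y" "i \<in> Z"
  obtains j where "j \<in> Z" "j \<noteq> i" "c y i + c y j = w i j"
  using coord_tight[OF assms(1)] assms(2) unfolding tight_def by blast

lemma coord_le_dist: "y \<in> mspace Y \<Longrightarrow> z \<in> mspace Y \<Longrightarrow> i \<in> Z \<Longrightarrow> \<bar>c y i - c z i\<bar> \<le> mdist Y y z"
  using finite_Z by (simp add: dist_eq)

lemma dist_le:
  "y \<in> mspace Y \<Longrightarrow> z \<in> mspace Y \<Longrightarrow> (\<And>i. i \<in> Z \<Longrightarrow> \<bar>c y i - c z i\<bar> \<le> D) \<Longrightarrow> mdist Y y z \<le> D"
  using finite_Z Z_nonempty by (simp add: dist_eq)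

lemma dist_attained:
  assumes "y \<in> mspace Y" "z \<in> mspace Y"
  obtains i where "i \<in> Z" "mdist Y y z = \<bar>c y i - c z i\<bar>"
proof -
  have "Max ((\<lambda>i. \<bar>c y i - c z i\<bar>) ` Z) \<in> (\<lambda>i. \<bar>c y i - c z i\<bar>) ` Z"
    using finite_Z Z_nonempty by (intro Max_in) auto
  then show ?thesis using that by (auto simp: dist_eq[OF assms])
qed

lemma coord_eqI:
  assumes "y \<in> mspace Y" "z \<in> mspace Y" "\<And>i. i \<in> Z \<Longrightarrow> c y i = c z i"
  shows "y = z"
proof -
  have "mdist Y y z \<le> 0" by (intro dist_le) (auto simp: assms)
  then show ?thesis using mdist_zero[OF assms(1,2)] mdist_nonneg[of Y y z] by linarith
qed

section \<open>Retraction onto the model, intersection of balls, injectivity\<close>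

definition retr :: "('z \<Rightarrow> real) \<Rightarrow> 'y" where
  "retr = (SOME \<rho>. (\<forall>f. admissible Z w f \<longrightarrow> \<rho> f \<in> mspace Y \<and> (\<forall>i\<in>Z. c (\<rho> f) i \<le> f i)) \<and>
     (\<forall>f g D. admissible Z w f \<and> admissible Z w g \<and> (\<forall>i\<in>Z. \<bar>f i - g i\<bar> \<le> D) \<longrightarrow>
        mdist Y (\<rho> f) (\<rho> g) \<le> D))"

lemma retr_exists:
  "\<exists>\<rho>. (\<forall>f. admissible Z w f \<longrightarrow> \<rho> f \<in> mspace Y \<and> (\<forall>i\<in>Z. c (\<rho> f) i \<le> f i)) \<and>
     (\<forall>f g D. admissible Z w f \<and> admissible Z w g \<and> (\<forall>i\<in>Z. \<bar>f i - g i\<bar> \<le> D) \<longrightarrow>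
        mdist Y (\<rho> f) (\<rho> g) \<le> D)"
proof -
  have "2 \<le> card Z" "\<forall>i\<in>Z. \<forall>j\<in>Z. w i j = w j i" using card_Z w_sym by auto
  from tight_retraction[OF finite_Z this]
  obtain r where r: "\<And>f. admissible Z w f \<Longrightarrow> tight Z w (r f)"
      "\<And>f i. admissible Z w f \<Longrightarrow> i \<in> Z \<Longrightarrow> r f i \<le> f i"
      "\<And>f g D i. admissible Z w f \<Longrightarrow> admissible Z w g \<Longrightarrow> \<forall>i\<in>Z. \<bar>f i - g i\<bar> \<le> D \<Longrightarrow> i \<in> Z \<Longrightarrow>
          \<bar>r f i - r g i\<bar> \<le> D"
    by (elim exE conjE) blast
  define \<rho> where "\<rho> f = (SOME y. y \<in> mspace Y \<and> (\<forall>i\<in>Z. c y i = r f i))" for f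
  have \<rho>: "\<rho> f \<in> mspace Y \<and> (\<forall>i\<in>Z. c (\<rho> f) i = r f i)" if "admissible Z w f" for f
    unfolding \<rho>_def by (rule someI_ex) (use coord_surj[OF r(1)[OF that]] in \<open>simp add: Bex_def\<close>)
  show ?thesis
  proof (intro exI[of _ \<rho>] conjI allI impI ballI)
    fix f g D assume "admissible Z w f \<and> admissible Z w g \<and> (\<forall>i\<in>Z. \<bar>f i - g i\<bar> \<le> D)"
    then show "mdist Y (\<rho> f) (\<rho> g) \<le> D"
      by (intro dist_le) (auto simp: \<rho> intro: r(3))
  qed (use \<rho> r(2) in auto)
qed

lemma
  assumes "admissible Z w f"
  shows retr_in: "retr f \<in> mspace Y" and retr_le: "i \<in> Z \<Longrightarrow> c (retr f) i \<le> f i"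
  using someI_ex[OF retr_exists, folded retr_def, THEN conjunct1] assms by auto

lemma retr_dist_le:
  assumes "admissible Z w f" "admissible Z w g" "\<And>i. i \<in> Z \<Longrightarrow> \<bar>f i - g i\<bar> \<le> D"
  shows "mdist Y (retr f) (retr g) \<le> D"
  using someI_ex[OF retr_exists, folded retr_def, THEN conjunct2, rule_format, of f g D] assms
  by simp

lemma coord_admissible: "y \<in> mspace Y \<Longrightarrow> admissible Z w (c y)"
  using coord_tight unfolding tight_def by blast

text \<open>The retraction only lowers coordinates, and tight functions are minimal among the
  admissible ones.\<close>

lemma retr_eq:
  assumes "y \<in> mspace Y" "\<And>i. i \<in> Z \<Longrightarrow> f i = c y i"
  shows "retr f = y"
proof -
  have f: "admissible Z w f"
    using coord_admissible[OF assms(1)] assms(2) unfolding admissible_def by auto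
  show ?thesis
    using tight_minimal[OF coord_tight[OF assms(1)] coord_admissible[OF retr_in[OF f]]] retr_le[OF f]
    by (intro coord_eqI retr_in f assms) (auto simp: assms(2))
qed

text \<open>A ball is a box in coordinates, and this is the largest function below all upper faces.
  The same formula serves for common points of balls, for the extension of Lipschitz maps and for
  the prolongation of geodesics; only the set \<open>S\<close> differs.\<close>

definition envelope :: "('y \<times> real) set \<Rightarrow> 'z \<Rightarrow> real" where
  "envelope S i = Inf ((\<lambda>(y, r). c y i + r) ` S)"

definition compatible :: "('y \<times> real) set \<Rightarrow> bool" where
  "compatible S \<longleftrightarrow> S \<noteq> {} \<and> S \<subseteq> mspace Y \<times> UNIV \<and> (\<forall>(y, r)\<in>S. \<forall>(z, s)\<in>S. mdist Y y z \<le> r + s)"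

lemma compatibleD: "compatible S \<Longrightarrow> (y, r) \<in> S \<Longrightarrow> (z, s) \<in> S \<Longrightarrow> mdist Y y z \<le> r + s"
  unfolding compatible_def by blast

lemma compatible_in: "compatible S \<Longrightarrow> (y, r) \<in> S \<Longrightarrow> y \<in> mspace Y"
  unfolding compatible_def by blast

lemma envelope_ge:
  assumes "compatible S" "\<And>y r. (y, r) \<in> S \<Longrightarrow> a \<le> c y i + r"
  shows "a \<le> envelope S i"
  unfolding envelope_def using assms by (intro cInf_greatest) (auto simp: compatible_def)

lemma envelope_lower:
  assumes S: "compatible S" "(y, r) \<in> S" "i \<in> Z"
  shows "c y i - r \<le> envelope S i"
proof (rule envelope_ge[OF S(1)])
  fix z s assume z: "(z, s) \<in> S"
  show "c y i - r \<le> c z i + s"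
    using coord_le_dist[OF compatible_in[OF S(1,2)] compatible_in[OF S(1) z] S(3)]
      compatibleD[OF S(1,2) z] by linarith
qed

lemma envelope_upper:
  assumes S: "compatible S" "(y, r) \<in> S" "i \<in> Z"
  shows "envelope S i \<le> c y i + r"
  unfolding envelope_def
proof (rule cInf_lower)
  show "bdd_below ((\<lambda>(y, r). c y i + r) ` S)"
  proof (rule bdd_belowI2)
    fix p assume p: "p \<in> S"
    obtain z s where "p = (z, s)" by force
    moreover from this have z: "(z, s) \<in> S" using p by simp
    ultimately show "c y i - r \<le> (case p of (y, r) \<Rightarrow> c y i + r)"
      using coord_le_dist[OF compatible_in[OF S(1,2)] compatible_in[OF S(1) z] S(3)]
        compatibleD[OF S(1,2) z] by simp
  qed
qed (use S in force)

text \<open>For every member \<open>(y, r)\<close> the lower face at \<open>j\<close> and the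
  inequality of \<open>y\<close> already give \<open>w i j - envelope S j \<le> c y i + r\<close>;
  then pass to the infimum over the members.\<close>

lemma envelope_admissible:
  assumes S: "compatible S"
  shows "admissible Z w (envelope S)"
  unfolding admissible_def
proof (intro ballI impI)
  fix i j assume ij: "i \<in> Z" "j \<in> Z" "i \<noteq> j"
  have "w i j - envelope S j \<le> envelope S i"
  proof (rule envelope_ge[OF S])
    fix y r assume y: "(y, r) \<in> S"
    then show "w i j - envelope S j \<le> c y i + r"
      using envelope_lower[OF S y ij(2)] coord_ge[OF compatible_in[OF S y] ij] by linarith
  qed
  then show "w i j \<le> envelope S i + envelope S j" by linarith
qed

text \<open>One positive strict bound for all weights. The depth threshold \<open>- 2 * W\<close>
  and the slimness constant \<open>5 * W\<close> are multiples of it.\<close>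

definition W :: real where
  "W = 1 + (\<Sum>i\<in>Z. \<Sum>j\<in>Z. \<bar>w i j\<bar>)"

lemma W_pos: "W > 0"
  unfolding W_def by (intro add_pos_nonneg sum_nonneg) auto

lemma w_bound:
  assumes "i \<in> Z" "j \<in> Z"
  shows "\<bar>w i j\<bar> < W"
proof -
  have "\<bar>w i j\<bar> \<le> (\<Sum>j\<in>Z. \<bar>w i j\<bar>)" using assms finite_Z by (intro member_le_sum) auto
  also have "\<dots> \<le> (\<Sum>i\<in>Z. \<Sum>j\<in>Z. \<bar>w i j\<bar>)" using assms finite_Z
    by (intro member_le_sum[where f="\<lambda>i. \<Sum>j\<in>Z. \<bar>w i j\<bar>"]) (auto intro: sum_nonneg)
  finally show ?thesis by (simp add: W_def)
qed

lemma Y_nonempty: "mspace Y \<noteq> {}"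
proof -
  have "w i j \<le> W + W" if "i \<in> Z" "j \<in> Z" for i j
    using w_bound[OF that] W_pos by linarith
  then have "admissible Z w (\<lambda>_. W)"
    unfolding admissible_def by simp
  then show ?thesis using retr_in by blast
qed

text \<open>In every coordinate the envelope differs from \<open>c y\<close> by at most
  \<open>r\<close>. The retraction is 1-Lipschitz and sends \<open>c y\<close> back to
  \<open>y\<close>, so it keeps this bound.\<close>

lemma compatible_common_point:
  assumes S: "compatible S"
  shows "retr (envelope S) \<in> mspace Y" "(y, r) \<in> S \<Longrightarrow> mdist Y y (retr (envelope S)) \<le> r"
proof -
  show "retr (envelope S) \<in> mspace Y" by (intro retr_in envelope_admissible S)
  show "mdist Y y (retr (envelope S)) \<le> r" if y: "(y, r) \<in> S"
  proof -
    have yY: "y \<in> mspace Y" using compatible_in[OF S y] .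
    have "mdist Y (retr (c y)) (retr (envelope S)) \<le> r"
    proof (intro retr_dist_le coord_admissible envelope_admissible S yY)
      fix i assume "i \<in> Z"
      then show "\<bar>c y i - envelope S i\<bar> \<le> r"
        using envelope_lower[OF S y] envelope_upper[OF S y] by (simp add: abs_le_iff) (smt (verit))
    qed
    then show ?thesis by (simp add: retr_eq[OF yY])
  qed
qed

theorem hyperconvex_model: "hyperconvex Y"
  unfolding hyperconvex_def
proof (intro allI impI)
  fix S :: "('y \<times> real) set"
  assume S: "S \<subseteq> mspace Y \<times> UNIV" "\<forall>(x, r)\<in>S. \<forall>(y, s)\<in>S. mdist Y x y \<le> r + s"
  show "\<exists>z\<in>mspace Y. \<forall>(x, r)\<in>S. z \<in> mcball_of Y x r"
  proof (cases "S = {}")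
    case True
    then show ?thesis using Y_nonempty by auto
  next
    case False
    then have "compatible S" using S by (simp add: compatible_def)
    then show ?thesis
      using compatible_common_point by (intro bexI[of _ "retr (envelope S)"]) (auto simp: compatible_in)
  qed
qed

text \<open>McShane's formula extends each coordinate; the retraction brings the values back into \<open>Y\<close>.\<close>

theorem injective_model: "injective_space TYPE('b) Y"
  unfolding injective_space_def
proof (intro allI impI)
  fix A :: "'b metric" and B h
  assume "B \<subseteq> mspace A \<and> h \<in> B \<rightarrow> mspace Y \<and> (\<forall>b\<in>B. \<forall>c\<in>B. mdist Y (h b) (h c) \<le> mdist A b c)"
  then have B: "B \<subseteq> mspace A" and h: "\<And>b. b \<in> B \<Longrightarrow> h b \<in> mspace Y"
    and lip: "\<And>b b'. b \<in> B \<Longrightarrow> b' \<in> B \<Longrightarrow> mdist Y (h b) (h b') \<le> mdist A b b'" by auto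
  show "\<exists>k. k \<in> mspace A \<rightarrow> mspace Y \<and>
             (\<forall>a\<in>mspace A. \<forall>b\<in>mspace A. mdist Y (k a) (k b) \<le> mdist A a b) \<and> (\<forall>b\<in>B. k b = h b)"
  proof (cases "B = {}")
    case True
    obtain y where "y \<in> mspace Y" using Y_nonempty by blast
    then show ?thesis using True by (intro exI[of _ "\<lambda>_. y"]) auto
  next
    case False
    define S where "S a = (\<lambda>b. (h b, mdist A a b)) ` B" for a
    have S: "compatible (S a)" if a: "a \<in> mspace A" for a
    proof -
      have "mdist Y (h b) (h b') \<le> mdist A a b + mdist A a b'" if "b \<in> B" "b' \<in> B" for b b'
      proof -
        have "mdist A b b' \<le> mdist A b a + mdist A a b'"
          using a B that by (intro mdist_triangle) auto
        then show ?thesis using lip[OF that] by (simp add: mdist_commute)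
      qed
      then show ?thesis using False h by (auto simp: compatible_def S_def)
    qed
    have shift: "envelope (S a) i \<le> envelope (S a') i + mdist A a a'"
      if a: "a \<in> mspace A" "a' \<in> mspace A" and i: "i \<in> Z" for a a' i
    proof -
      have "envelope (S a) i - mdist A a a' \<le> envelope (S a') i"
      proof (rule envelope_ge[OF S[OF a(2)]])
        fix y r assume "(y, r) \<in> S a'"
        then obtain b where b: "b \<in> B" "y = h b" "r = mdist A a' b" by (auto simp: S_def)
        have "envelope (S a) i \<le> c (h b) i + mdist A a b"
          using b i by (intro envelope_upper S a) (auto simp: S_def)
        moreover have "mdist A a b \<le> mdist A a a' + mdist A a' b"
          using a b B by (intro mdist_triangle) auto
        ultimately show "envelope (S a) i - mdist A a a' \<le> c y i + r" using b by simp
      qed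
      then show ?thesis by simp
    qed
    show ?thesis
    proof (intro exI[of _ "\<lambda>a. retr (envelope (S a))"] conjI ballI)
      show "(\<lambda>a. retr (envelope (S a))) \<in> mspace A \<rightarrow> mspace Y"
        using compatible_common_point S by auto
    next
      fix a b assume ab: "a \<in> mspace A" "b \<in> mspace A"
      show "mdist Y (retr (envelope (S a))) (retr (envelope (S b))) \<le> mdist A a b"
      proof (intro retr_dist_le envelope_admissible S ab)
        fix i assume "i \<in> Z"
        from shift[OF ab this] shift[OF ab(2,1) this]
        show "\<bar>envelope (S a) i - envelope (S b) i\<bar> \<le> mdist A a b"
          by (simp add: mdist_commute[of A b a] abs_le_iff)
      qed
    next
      fix b assume b: "b \<in> B"
      \<comment> \<open>The ball of radius 0 squeezes the envelope to the coordinates of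
        \<open>h b\<close>.\<close>
      then have "(h b, 0) \<in> S b" using B by (force simp: S_def)
      then have "envelope (S b) i = c (h b) i" if "i \<in> Z" for i
        using envelope_lower[of "S b" "h b" 0 i] envelope_upper[of "S b" "h b" 0 i] S b B that by fastforce
      then show "retr (envelope (S b)) = h b" by (intro retr_eq h b)
    qed
  qed
qed

subsection \<open>Geodesics\<close>

text \<open>A certificate that \<open>\<gamma>\<close> runs from end \<open>i\<close> toward end
  \<open>j\<close>: one coordinate rises and the other falls at unit speed, while the pair stays
  tight because its sum is constant.\<close>

definition moves :: "(real \<Rightarrow> 'y) \<Rightarrow> 'z \<Rightarrow> 'z \<Rightarrow> real \<Rightarrow> real \<Rightarrow> bool" where
  "moves \<gamma> i j s t \<longleftrightarrow> c (\<gamma> t) i - c (\<gamma> s) i = t - s \<and> c (\<gamma> s) j - c (\<gamma> t) j = t - s \<and>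
     c (\<gamma> s) i + c (\<gamma> s) j = w i j"

text \<open>If coordinate \<open>i\<close> rises by the full distance, the inequality at
  \<open>x\<close> forces its partner at \<open>y\<close> to fall by at least as much. It cannot
  fall by more, so the pair is tight at \<open>x\<close> as well.\<close>

lemma moving_pair_aux:
  assumes xy: "x \<in> mspace Y" "y \<in> mspace Y" and i: "i \<in> Z" "c y i - c x i = mdist Y x y"
  obtains j where "j \<in> Z" "j \<noteq> i" "c x j - c y j = mdist Y x y" "c x i + c x j = w i j"
proof -
  obtain j where j: "j \<in> Z" "j \<noteq> i" "c y i + c y j = w i j" using coord_partner[OF xy(2) i(1)] .
  have "w i j \<le> c x i + c x j" using coord_ge[OF xy(1) i(1) j(1)] j(2) by simp
  moreover have "c x j - c y j \<le> mdist Y x y" using coord_le_dist[OF xy j(1)] by linarith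
  ultimately have "c x j - c y j = mdist Y x y" "c x i + c x j = w i j" using i(2) j(3) by linarith+
  then show ?thesis using that j by simp
qed

lemma moving_pair:
  assumes xy: "x \<in> mspace Y" "y \<in> mspace Y"
  obtains i j where "i \<in> Z" "j \<in> Z" "i \<noteq> j" "c y i - c x i = mdist Y x y"
    "c x j - c y j = mdist Y x y" "c x i + c x j = w i j"
proof -
  obtain i where i: "i \<in> Z" "mdist Y x y = \<bar>c x i - c y i\<bar>" using dist_attained[OF xy] .
  show ?thesis
  proof (cases "c y i \<ge> c x i")
    case True
    then have i': "c y i - c x i = mdist Y x y" using i(2) by linarith
    obtain j where "j \<in> Z" "j \<noteq> i" "c x j - c y j = mdist Y x y" "c x i + c x j = w i j"
      using moving_pair_aux[OF xy i(1) i'] .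
    then show ?thesis using that[of i j] i(1) i' by simp
  next
    case False
    then have i': "c x i - c y i = mdist Y y x" using i(2) mdist_commute[of Y x y] by linarith
    obtain j where j: "j \<in> Z" "j \<noteq> i" "c y j - c x j = mdist Y y x" "c y i + c y j = w i j"
      using moving_pair_aux[OF xy(2,1) i(1) i'] .
    moreover have "c x j + c x i = w j i" using j(3,4) i' w_sym[OF i(1) j(1)] by linarith
    ultimately show ?thesis using that[of j i] i(1) i' mdist_commute[of Y x y] by simp
  qed
qed

lemma geodesic_coord:
  assumes "geodesic_on Y I \<gamma>" "s \<in> I" "t \<in> I" "i \<in> Z"
  shows "\<bar>c (\<gamma> s) i - c (\<gamma> t) i\<bar> \<le> \<bar>s - t\<bar>"
  using coord_le_dist[OF geodesic_onD(1)[OF assms(1,2)] geodesic_onD(1)[OF assms(1,3)] assms(4)]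
    geodesic_onD(2)[OF assms(1,2,3)] by simp

lemma moves_exists:
  assumes g: "geodesic_on Y I \<gamma>" and st: "s \<in> I" "t \<in> I" "s \<le> t"
  obtains i j where "i \<in> Z" "j \<in> Z" "i \<noteq> j" "moves \<gamma> i j s t"
proof -
  have d: "mdist Y (\<gamma> s) (\<gamma> t) = t - s" using geodesic_onD(2)[OF g st(1,2)] st(3) by simp
  obtain i j where "i \<in> Z" "j \<in> Z" "i \<noteq> j" "c (\<gamma> t) i - c (\<gamma> s) i = t - s"
    "c (\<gamma> s) j - c (\<gamma> t) j = t - s" "c (\<gamma> s) i + c (\<gamma> s) j = w i j"
    using moving_pair[OF geodesic_onD(1)[OF g st(1)] geodesic_onD(1)[OF g st(2)]] unfolding d .
  then show ?thesis using that by (simp add: moves_def)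
qed

text \<open>Coordinates are 1-Lipschitz along a geodesic, so a total change equal to the length
  leaves no slack on any subinterval.\<close>

lemma moves_mono:
  assumes g: "geodesic_on Y I \<gamma>" and ij: "i \<in> Z" "j \<in> Z"
    and st: "s \<in> I" "t \<in> I" "s' \<in> I" "t' \<in> I" "s \<le> s'" "s' \<le> t'" "t' \<le> t"
    and m: "moves \<gamma> i j s t"
  shows "moves \<gamma> i j s' t'"
proof -
  have step: "c (\<gamma> v) k - c (\<gamma> u) k \<le> v - u" "c (\<gamma> u) k - c (\<gamma> v) k \<le> v - u"
    if "u \<in> I" "v \<in> I" "u \<le> v" "k \<in> Z" for u v k
    using geodesic_coord[OF g that(1,2,4)] that(3) by (auto simp: abs_le_iff)
  note steps = step[OF st(1,3,5)] step[OF st(3,4,6)] step[OF st(4,2,7)]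
  show ?thesis
    using steps(1,3,5)[OF ij(1)] steps(2,4,6)[OF ij(2)] m unfolding moves_def by linarith
qed

text \<open>A single pair works for all of \<open>I\<close>, even when \<open>I\<close> is
  unbounded: a pair that fails on an interval fails on every larger one, so if each of the finitely
  many pairs failed somewhere, all would fail together on one interval, against
  \<open>moves_exists\<close>.\<close>

lemma geodesic_moves:
  assumes g: "geodesic_on Y I \<gamma>" and I: "I \<noteq> {}"
  obtains i j where "i \<in> Z" "j \<in> Z" "i \<noteq> j" "\<And>s t. s \<in> I \<Longrightarrow> t \<in> I \<Longrightarrow> s \<le> t \<Longrightarrow> moves \<gamma> i j s t"
proof (rule ccontr)
  assume no: "\<not> thesis"
  note witness = that
  have bad: "\<exists>s t. s \<in> I \<and> t \<in> I \<and> s \<le> t \<and> \<not> moves \<gamma> i j s t"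
    if ij: "i \<in> Z" "j \<in> Z" "i \<noteq> j" for i j
  proof (rule ccontr)
    assume "\<not> ?thesis"
    then have "moves \<gamma> i j s t" if "s \<in> I" "t \<in> I" "s \<le> t" for s t using that by simp
    from witness[OF ij this] no show False by simp
  qed
  define P where "P = {(i, j). i \<in> Z \<and> j \<in> Z \<and> i \<noteq> j}"
  have "P \<subseteq> Z \<times> Z" by (auto simp: P_def)
  then have "finite P" using finite_Z finite_subset by blast
  have ex: "\<exists>s t. s \<in> I \<and> t \<in> I \<and> s \<le> t \<and> (\<forall>(i, j)\<in>Q. \<not> moves \<gamma> i j s t)" if "Q \<subseteq> P" for Q
    using finite_subset[OF that \<open>finite P\<close>] that
  proof (induction Q rule: finite_induct)
    case empty
    obtain t where "t \<in> I" using I by blast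
    then show ?case by (intro exI[of _ t]) simp
  next
    case (insert p Q)
    obtain i j where p: "p = (i, j)" by force
    then have ij: "i \<in> Z" "j \<in> Z" "i \<noteq> j" using insert.prems by (auto simp: P_def)
    obtain s t where st: "s \<in> I" "t \<in> I" "s \<le> t" "\<forall>(i, j)\<in>Q. \<not> moves \<gamma> i j s t"
      using insert by auto
    obtain s' t' where st': "s' \<in> I" "t' \<in> I" "s' \<le> t'" "\<not> moves \<gamma> i j s' t'"
      using bad[OF ij] by blast
    have mm: "min s s' \<in> I" "max t t' \<in> I" using st st' by (auto simp: min_def max_def)
    have "\<not> moves \<gamma> i j (min s s') (max t t')"
      using moves_mono[OF g ij(1,2) mm st'(1,2)] st' by auto
    moreover have "\<not> moves \<gamma> k l (min s s') (max t t')" if "(k, l) \<in> Q" for k l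
    proof -
      have "k \<in> Z" "l \<in> Z" using that insert.prems by (auto simp: P_def)
      from moves_mono[OF g this mm st(1,2)] show ?thesis using st that by auto
    qed
    ultimately show ?case using st(3) mm p
      by (intro exI[of _ "min s s'"] exI[of _ "max t t'"]) auto
  qed
  obtain s t where st: "s \<in> I" "t \<in> I" "s \<le> t" "\<forall>(i, j)\<in>P. \<not> moves \<gamma> i j s t"
    using ex[OF order_refl] by blast
  obtain i j where "i \<in> Z" "j \<in> Z" "i \<noteq> j" "moves \<gamma> i j s t" using moves_exists[OF g st(1-3)] .
  then show False using st(4) by (auto simp: P_def)
qed

lemma geodesic_pair:
  assumes g: "geodesic_on Y I \<gamma>" and I: "I \<noteq> {}"
  obtains i j a b where "i \<in> Z" "j \<in> Z" "i \<noteq> j" "a + b = w i j"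
    "\<And>t. t \<in> I \<Longrightarrow> c (\<gamma> t) i = a + t" "\<And>t. t \<in> I \<Longrightarrow> c (\<gamma> t) j = b - t"
proof -
  obtain i j where ij: "i \<in> Z" "j \<in> Z" "i \<noteq> j"
    and m: "\<And>s t. s \<in> I \<Longrightarrow> t \<in> I \<Longrightarrow> s \<le> t \<Longrightarrow> moves \<gamma> i j s t" using geodesic_moves[OF g I] by blast
  obtain t0 where t0: "t0 \<in> I" using I by blast
  show ?thesis
  proof (rule that[OF ij, of "c (\<gamma> t0) i - t0" "c (\<gamma> t0) j + t0"])
    show "c (\<gamma> t0) i - t0 + (c (\<gamma> t0) j + t0) = w i j"
      using m[OF t0 t0] by (simp add: moves_def)
    fix t assume t: "t \<in> I"
    show "c (\<gamma> t) i = c (\<gamma> t0) i - t0 + t" "c (\<gamma> t) j = c (\<gamma> t0) j + t0 - t"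
      using m[OF t t0] m[OF t0 t] by (cases "t \<le> t0"; simp add: moves_def)+
  qed
qed

text \<open>The envelope extends the curve to a 1-Lipschitz family of admissible functions, but
  beyond an end of \<open>I\<close> it turns one of the coordinates \<open>i\<close>,
  \<open>j\<close> upward. Prescribing both as linear functions keeps admissibility and makes the
  pair tight, and coordinate \<open>i\<close> alone then gives the lower bound for distances. The
  pair is a parameter so that a line toward a chosen end can be produced.\<close>

lemma geodesic_extension:
  assumes g: "geodesic_on Y I \<gamma>" and I: "I \<noteq> {}" and ij: "i \<in> Z" "j \<in> Z" "i \<noteq> j" "a + b = w i j"
    and ci: "\<And>t. t \<in> I \<Longrightarrow> c (\<gamma> t) i = a + t" and cj: "\<And>t. t \<in> I \<Longrightarrow> c (\<gamma> t) j = b - t"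
  obtains \<gamma>' where "geodesic_on Y UNIV \<gamma>'" "\<And>t. t \<in> I \<Longrightarrow> \<gamma>' t = \<gamma> t"
    "\<And>t. c (\<gamma>' t) i = a + t" "\<And>t. c (\<gamma>' t) j = b - t"
proof -
  define S where "S t = (\<lambda>s. (\<gamma> s, \<bar>t - s\<bar>)) ` I" for t
  have \<gamma>: "\<gamma> s \<in> mspace Y" if "s \<in> I" for s using geodesic_onD(1)[OF g that] .
  have S: "compatible (S t)" for t
    using I \<gamma> by (auto simp: compatible_def S_def geodesic_onD(2)[OF g])
  define h where "h t = (envelope (S t))(i := a + t, j := b - t)" for t
  have hij: "h t i = a + t" "h t j = b - t" for t using ij(3) by (auto simp: h_def)
  have hk: "h t k = envelope (S t) k" if "k \<noteq> i" "k \<noteq> j" for t k using that by (auto simp: h_def)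
  have h_i: "w i k \<le> h t i + h t k" if k: "k \<in> Z" "k \<noteq> i" for t k
  proof (cases "k = j")
    case True then show ?thesis using ij(4) by (simp add: hij)
  next
    case False
    have "w i k - (a + t) \<le> envelope (S t) k"
    proof (rule envelope_ge[OF S])
      fix y r assume "(y, r) \<in> S t"
      then obtain s where s: "s \<in> I" "y = \<gamma> s" "r = \<bar>t - s\<bar>" by (auto simp: S_def)
      have "w i k \<le> c (\<gamma> s) i + c (\<gamma> s) k" using coord_ge[OF \<gamma>[OF s(1)] ij(1) k(1)] k(2) by simp
      then show "w i k - (a + t) \<le> c y k + r" using ci[OF s(1)] s by simp
    qed
    then show ?thesis by (simp add: hij hk[OF k(2) False])
  qed
  have h_j: "w j k \<le> h t j + h t k" if k: "k \<in> Z" "k \<noteq> j" for t k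
  proof (cases "k = i")
    case True then show ?thesis using ij(4) w_sym[OF ij(1,2)] by (simp add: hij)
  next
    case False
    have "w j k - (b - t) \<le> envelope (S t) k"
    proof (rule envelope_ge[OF S])
      fix y r assume "(y, r) \<in> S t"
      then obtain s where s: "s \<in> I" "y = \<gamma> s" "r = \<bar>t - s\<bar>" by (auto simp: S_def)
      have "w j k \<le> c (\<gamma> s) j + c (\<gamma> s) k" using coord_ge[OF \<gamma>[OF s(1)] ij(2) k(1)] k(2) by simp
      then show "w j k - (b - t) \<le> c y k + r" using cj[OF s(1)] s by simp
    qed
    then show ?thesis by (simp add: hij hk[OF False k(2)])
  qed
  have adm: "admissible Z w (h t)" for t
    unfolding admissible_def
  proof (intro ballI impI)
    fix k l assume kl: "k \<in> Z" "l \<in> Z" "k \<noteq> l"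
    consider "k = i" | "k = j" | "l = i" | "l = j" | "k \<noteq> i" "k \<noteq> j" "l \<noteq> i" "l \<noteq> j" by blast
    then show "w k l \<le> h t k + h t l"
    proof cases
      case 1 then show ?thesis using h_i[of l t] kl by simp
    next
      case 2 then show ?thesis using h_j[of l t] kl by simp
    next
      case 3 then show ?thesis using h_i[of k t] kl w_sym[of k l] by simp
    next
      case 4 then show ?thesis using h_j[of k t] kl w_sym[of k l] by simp
    next
      case 5 then show ?thesis
        using admissibleD[OF envelope_admissible[OF S] kl] by (simp add: hk)
    qed
  qed
  have lip: "h t k \<le> h t' k + \<bar>t - t'\<bar>" if k: "k \<in> Z" for t t' k
  proof -
    consider "k = i" | "k = j" | "k \<noteq> i" "k \<noteq> j" by blast
    then show ?thesis
    proof cases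
      case 3
      have "envelope (S t) k - \<bar>t - t'\<bar> \<le> envelope (S t') k"
      proof (rule envelope_ge[OF S])
        fix y r assume "(y, r) \<in> S t'"
        then obtain s where s: "s \<in> I" "y = \<gamma> s" "r = \<bar>t' - s\<bar>" by (auto simp: S_def)
        have "envelope (S t) k \<le> c (\<gamma> s) k + \<bar>t - s\<bar>"
          using s(1) by (intro envelope_upper[OF S _ k]) (auto simp: S_def)
        then show "envelope (S t) k - \<bar>t - t'\<bar> \<le> c y k + r" using s by simp
      qed
      then show ?thesis using 3 by (simp add: hk)
    qed (simp_all add: hij)
  qed
  define \<gamma>' where "\<gamma>' t = retr (h t)" for t
  have \<gamma>': "\<gamma>' t \<in> mspace Y" for t unfolding \<gamma>'_def by (rule retr_in[OF adm])
  \<comment> \<open>The retraction can lower neither coordinate: their sum already equals the least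
    value \<open>w i j\<close>.\<close>
  have "c (\<gamma>' t) i \<le> a + t" "c (\<gamma>' t) j \<le> b - t" "w i j \<le> c (\<gamma>' t) i + c (\<gamma>' t) j" for t
    using retr_le[OF adm ij(1), of t] retr_le[OF adm ij(2), of t] coord_ge[OF \<gamma>' ij(1-3)]
    by (simp_all add: \<gamma>'_def hij)
  then have c': "c (\<gamma>' t) i = a + t" "c (\<gamma>' t) j = b - t" for t
    using ij(4) by (smt (verit))+
  have "geodesic_on Y UNIV \<gamma>'"
    unfolding geodesic_on_def
  proof (intro conjI ballI)
    fix s t
    have "mdist Y (\<gamma>' s) (\<gamma>' t) \<le> \<bar>s - t\<bar>"
      unfolding \<gamma>'_def
    proof (intro retr_dist_le adm)
      fix k assume "k \<in> Z"
      from lip[OF this, of s t] lip[OF this, of t s]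
      show "\<bar>h s k - h t k\<bar> \<le> \<bar>s - t\<bar>" by (simp add: abs_minus_commute abs_le_iff)
    qed
    moreover have "\<bar>s - t\<bar> \<le> mdist Y (\<gamma>' s) (\<gamma>' t)"
      using coord_le_dist[OF \<gamma>' \<gamma>' ij(1), of s t] by (simp add: c')
    ultimately show "mdist Y (\<gamma>' s) (\<gamma>' t) = \<bar>s - t\<bar>" by simp
  qed (use \<gamma>' in \<open>auto simp: is_interval_univ\<close>)
  moreover have "\<gamma>' t = \<gamma> t" if t: "t \<in> I" for t
    unfolding \<gamma>'_def
  proof (rule retr_eq[OF \<gamma>[OF t]])
    fix k assume k: "k \<in> Z"
    have "(\<gamma> t, 0) \<in> S t" using t by (force simp: S_def)
    from envelope_lower[OF S this k] envelope_upper[OF S this k]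
    show "h t k = c (\<gamma> t) k" using hij hk ci[OF t] cj[OF t] by (cases "k = i"; cases "k = j") auto
  qed
  ultimately show ?thesis using that c' by blast
qed

lemma geodesically_complete_model: "geodesically_complete Y"
  unfolding geodesically_complete_def
proof (intro allI impI)
  fix I \<gamma> assume g: "geodesic_on Y I \<gamma>"
  have *: "\<exists>\<gamma>'. geodesic_on Y UNIV \<gamma>' \<and> (\<forall>t\<in>I. \<gamma>' t = \<gamma> t)"
    if g: "geodesic_on Y I \<gamma>" and I: "I \<noteq> {}" for I \<gamma>
  proof -
    obtain i j a b where "i \<in> Z" "j \<in> Z" "i \<noteq> j" "a + b = w i j"
      "\<And>t. t \<in> I \<Longrightarrow> c (\<gamma> t) i = a + t" "\<And>t. t \<in> I \<Longrightarrow> c (\<gamma> t) j = b - t"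
      using geodesic_pair[OF g I] by blast
    from geodesic_extension[OF g I this] show ?thesis by metis
  qed
  show "\<exists>\<gamma>'. geodesic_on Y UNIV \<gamma>' \<and> (\<forall>t\<in>I. \<gamma>' t = \<gamma> t)"
  proof (cases "I = {}")
    \<comment> \<open>The empty set is an interval too; any line, here through a point
      \<open>y\<close>, extends the empty geodesic.\<close>
    case True
    obtain y where y: "y \<in> mspace Y" using Y_nonempty by blast
    then have "geodesic_on Y {0} (\<lambda>_. y)" by (auto simp: geodesic_on_def is_interval_def)
    from *[OF this] show ?thesis using True by auto
  next
    case False then show ?thesis using * g by blast
  qed
qed

text \<open>Affine interpolation of coordinates is admissible by convexity but need not be tight,
  hence the retraction. The resulting curve is 1-Lipschitz and joins points at distance
  \<open>L\<close> in time \<open>L\<close>, so no piece of it can be shorter than its parameter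
  length.\<close>

lemma geodesic_space_model: "geodesic_space Y"
  unfolding geodesic_space_def
proof (intro ballI)
  fix x y assume xy: "x \<in> mspace Y" "y \<in> mspace Y"
  define L where "L = mdist Y x y"
  define h where "h t i = c x i + (t / L) * (c y i - c x i)" for t i
  show "\<exists>S. geodesic_segment Y x y S"
  proof (cases "L = 0")
    case True
    then have "x = y" using xy by (simp add: L_def)
    then show ?thesis unfolding geodesic_segment_def
      by (intro exI[of _ "{x}"] exI[of _ "\<lambda>_. x"] exI[of _ 0]) (auto simp: geodesic_on_def xy is_interval_def)
  next
    case False
    then have L: "L > 0" by (simp add: L_def order_less_le)
    have adm: "admissible Z w (h t)" if "t \<in> {0..L}" for t
      unfolding admissible_def
    proof (intro ballI impI)
      fix i j assume ij: "i \<in> Z" "j \<in> Z" "i \<noteq> j"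
      have "0 \<le> t / L" "t / L \<le> 1" using that L by auto
      then have "(1 - t / L) * w i j + (t / L) * w i j \<le>
          (1 - t / L) * (c x i + c x j) + (t / L) * (c y i + c y j)"
        using coord_ge[OF xy(1) ij] coord_ge[OF xy(2) ij] by (intro add_mono mult_left_mono) auto
      then show "w i j \<le> h t i + h t j" by (simp add: h_def algebra_simps)
    qed
    define \<gamma> where "\<gamma> t = retr (h t)" for t
    have \<gamma>: "\<gamma> t \<in> mspace Y" if "t \<in> {0..L}" for t unfolding \<gamma>_def by (rule retr_in[OF adm[OF that]])
    have ends: "\<gamma> 0 = x" "\<gamma> L = y"
      using L unfolding \<gamma>_def by (auto intro!: retr_eq xy simp: h_def)
    have up: "mdist Y (\<gamma> s) (\<gamma> t) \<le> \<bar>s - t\<bar>" if st: "s \<in> {0..L}" "t \<in> {0..L}" for s t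
      unfolding \<gamma>_def
    proof (intro retr_dist_le adm st)
      fix i assume i: "i \<in> Z"
      have "h s i - h t i = (s - t) / L * (c y i - c x i)" by (simp add: h_def field_simps diff_divide_distrib)
      then have "\<bar>h s i - h t i\<bar> = \<bar>s - t\<bar> / L * \<bar>c y i - c x i\<bar>" using L by (simp add: abs_mult)
      also have "\<dots> \<le> \<bar>s - t\<bar> / L * L"
        using coord_le_dist[OF xy i] L by (intro mult_left_mono) (auto simp: L_def abs_minus_commute)
      finally show "\<bar>h s i - h t i\<bar> \<le> \<bar>s - t\<bar>" using L by simp
    qed
    have "mdist Y (\<gamma> s) (\<gamma> t) = \<bar>s - t\<bar>" if st: "s \<in> {0..L}" "t \<in> {0..L}" and "s \<le> t" for s t
    proof -
      have "L \<le> mdist Y x (\<gamma> s) + mdist Y (\<gamma> s) (\<gamma> t) + mdist Y (\<gamma> t) y"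
        using mdist_triangle[OF xy(1) \<gamma>[OF st(1)] xy(2)] mdist_triangle[OF \<gamma>[OF st(1)] \<gamma>[OF st(2)] xy(2)]
        unfolding L_def by linarith
      then show ?thesis using up[of 0 s] up[of t L] up[OF st] st \<open>s \<le> t\<close> L ends by auto
    qed
    then have "mdist Y (\<gamma> s) (\<gamma> t) = \<bar>s - t\<bar>" if "s \<in> {0..L}" "t \<in> {0..L}" for s t
      using that mdist_commute[of Y "\<gamma> s" "\<gamma> t"] abs_minus_commute[of s t] linear[of s t] by metis
    then have "geodesic_on Y {0..L} \<gamma>"
      unfolding geodesic_on_def using \<gamma> by (simp add: is_interval_cc)
    then show ?thesis unfolding geodesic_segment_def using ends L
      by (intro exI[of _ "\<gamma> ` {0..L}"] exI[of _ \<gamma>] exI[of _ L]) auto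
  qed
qed

text \<open>By Bolzano-Weierstrass in the coordinates. Only admissibility is carried over to the
  limit function; retracting it gives a point of \<open>Y\<close>, and the Lipschitz bound turns
  coordinate convergence into convergence to that point.\<close>

lemma proper_model: "proper_space Y"
  unfolding proper_space_def
proof (intro ballI allI)
  interpret M: Metric_space "mspace Y" "mdist Y" by simp
  have top: "mtopology_of Y = M.mtopology" and cb: "mcball_of Y = M.mcball"
    by (auto simp: mtopology_of_def mcball_of_def)
  fix x R assume x: "x \<in> mspace Y"
  show "compactin (mtopology_of Y) (mcball_of Y x R)"
    unfolding top cb M.compactin_sequentially
  proof (intro conjI allI impI)
    show "M.mcball x R \<subseteq> mspace Y" by auto
    fix \<sigma> :: "nat \<Rightarrow> 'y" assume "range \<sigma> \<subseteq> M.mcball x R"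
    then have \<sigma>: "\<sigma> n \<in> mspace Y" "mdist Y x (\<sigma> n) \<le> R" for n
      using range_subsetD by fastforce+
    have "bounded ((\<lambda>f. f i) ` range (\<lambda>n. c (\<sigma> n)))" if i: "i \<in> Z" for i
    proof (rule boundedI[of _ "\<bar>c x i\<bar> + R"])
      fix a assume "a \<in> (\<lambda>f. f i) ` range (\<lambda>n. c (\<sigma> n))"
      then obtain n where "a = c (\<sigma> n) i" by auto
      then show "norm a \<le> \<bar>c x i\<bar> + R"
        using coord_le_dist[OF x \<sigma>(1)[of n] i] \<sigma>(2)[of n] by simp
    qed
    then have "\<forall>d\<subseteq>Z. \<exists>l r. strict_mono (r :: nat \<Rightarrow> nat) \<and>
        (\<forall>e>0. eventually (\<lambda>n. \<forall>i\<in>d. dist (c (\<sigma> (r n)) i) (l i) < e) sequentially)"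
      by (rule compact_lemma_general[where proj="\<lambda>f i. f i" and unproj="\<lambda>f. f", OF finite_Z]) simp_all
    from this[THEN spec, THEN mp, OF order_refl]
    obtain l r where r: "strict_mono (r :: nat \<Rightarrow> nat)"
      and l: "\<And>e. e > 0 \<Longrightarrow> eventually (\<lambda>n. \<forall>i\<in>Z. dist (c (\<sigma> (r n)) i) (l i) < e) sequentially"
      by (auto simp: image_image)
    have adm: "admissible Z w l"
      unfolding admissible_def
    proof (intro ballI impI)
      fix i j assume ij: "i \<in> Z" "j \<in> Z" "i \<noteq> j"
      show "w i j \<le> l i + l j"
      proof (rule field_le_epsilon)
        fix e :: real assume "e > 0"
        then obtain n where "\<forall>i\<in>Z. dist (c (\<sigma> (r n)) i) (l i) < e / 2"
          using eventually_happens[OF l[of "e / 2"]] by auto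
        then have "\<bar>c (\<sigma> (r n)) i - l i\<bar> < e / 2" "\<bar>c (\<sigma> (r n)) j - l j\<bar> < e / 2"
          using ij by (auto simp: dist_real_def)
        then show "w i j \<le> l i + l j + e"
          using coord_ge[OF \<sigma>(1)[of "r n"] ij] by linarith
      qed
    qed
    define y where "y = retr l"
    have y: "y \<in> mspace Y" unfolding y_def by (rule retr_in[OF adm])
    have conv: "eventually (\<lambda>n. mdist Y (\<sigma> (r n)) y < e) sequentially" if "e > 0" for e
    proof -
      have "mdist Y (\<sigma> (r n)) y \<le> e / 2" if n: "\<forall>i\<in>Z. dist (c (\<sigma> (r n)) i) (l i) < e / 2" for n
      proof -
        have "mdist Y (retr (c (\<sigma> (r n)))) y \<le> e / 2"
          unfolding y_def using n
          by (intro retr_dist_le coord_admissible \<sigma> adm) (auto simp: dist_real_def less_imp_le)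
        then show ?thesis by (simp add: retr_eq[OF \<sigma>(1)])
      qed
      then show ?thesis using l[of "e / 2"] \<open>e > 0\<close> by (auto elim!: eventually_mono) fastforce
    qed
    have "mdist Y x y \<le> R"
    proof (rule field_le_epsilon)
      fix e :: real assume "e > 0"
      then obtain n where "mdist Y (\<sigma> (r n)) y < e" using eventually_happens[OF conv[of e]] by auto
      then show "mdist Y x y \<le> R + e"
        using mdist_triangle[OF x \<sigma>(1) y, of "r n"] \<sigma>(2)[of "r n"] by linarith
    qed
    then have "y \<in> M.mcball x R" using x y by simp
    moreover have "limitin M.mtopology (\<sigma> \<circ> r) y sequentially"
      unfolding M.limit_metric_sequentially
      using y conv \<sigma>(1) by (auto simp: eventually_sequentially)
    ultimately show "\<exists>l r. l \<in> M.mcball x R \<and> strict_mono r \<and> limitin M.mtopology (\<sigma> \<circ> r) l sequentially"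
      using r by blast
  qed
qed

subsection \<open>Hyperbolicity\<close>

text \<open>A point with a very negative coordinate \<open>i\<close> lies on the end of \<open>Y\<close> belonging to \<open>i\<close>: there
  every other coordinate is tight with \<open>i\<close> and the distance is read off the coordinate \<open>i\<close> alone.\<close>

lemma deep_pair:
  assumes p: "p \<in> mspace Y" and i: "i \<in> Z" "c p i < - 2 * W"
    and kl: "k \<in> Z" "l \<in> Z" "k \<noteq> l" "c p k + c p l = w k l"
  shows "k = i \<or> l = i"
proof (rule ccontr)
  assume "\<not> ?thesis"
  \<comment> \<open>Added together, these inequalities would put a signed sum of three weights below
    \<open>- 4 * W\<close>, although it exceeds \<open>- 3 * W\<close>.\<close>
  then have "w i k \<le> c p i + c p k" "w i l \<le> c p i + c p l"
    using coord_ge[OF p i(1) kl(1)] coord_ge[OF p i(1) kl(2)] by auto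
  then show False
    using kl(4) i(2) w_bound[OF i(1) kl(1)] w_bound[OF i(1) kl(2)] w_bound[OF kl(1,2)]
    by (simp add: abs_less_iff)
qed

lemma deep_star:
  assumes p: "p \<in> mspace Y" and i: "i \<in> Z" "c p i < - 2 * W" and j: "j \<in> Z" "j \<noteq> i"
  shows "c p i + c p j = w i j"
proof -
  obtain k where k: "k \<in> Z" "k \<noteq> j" "c p j + c p k = w j k" using coord_partner[OF p j(1)] .
  have "k = i" using deep_pair[OF p i j(1) k(1) _ k(3)] k(2) j(2) by auto
  then show ?thesis using k(3) w_sym[OF i(1) j(1)] by simp
qed

lemma coord_sum_lower:
  assumes "p \<in> mspace Y" "i \<in> Z" "j \<in> Z" "i \<noteq> j"
  shows "- W < c p i + c p j"
  using coord_ge[OF assms] w_bound[OF assms(2,3)] by linarith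

lemma deep_dist:
  assumes p: "p \<in> mspace Y" and i: "i \<in> Z" "c p i < - 2 * W" and x: "x \<in> mspace Y"
  shows "mdist Y x p = \<bar>c x i - c p i\<bar>"
proof (rule antisym)
  show "mdist Y x p \<le> \<bar>c x i - c p i\<bar>"
  proof (rule dist_le[OF x p])
    fix k assume k: "k \<in> Z"
    show "\<bar>c x k - c p k\<bar> \<le> \<bar>c x i - c p i\<bar>"
    proof (cases "k = i")
      case False
      have pk: "c p k = w i k - c p i" using deep_star[OF p i k False] by simp
      have low: "w i k - c x i \<le> c x k" using coord_ge[OF x i(1) k] False by simp
      show ?thesis
      proof (cases "c x i \<le> c p i")
        case True
        then have "c x i < - 2 * W" using i by simp
        from deep_star[OF x i(1) this k False] show ?thesis using pk by simp
      next
        case gt: False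
        obtain l where l: "l \<in> Z" "l \<noteq> k" "c x k + c x l = w k l" using coord_partner[OF x k] .
        \<comment> \<open>The upper bound comes from the partner \<open>l\<close> of
          \<open>k\<close> at \<open>x\<close>. If \<open>l \<noteq> i\<close>, three weights enter,
          and \<open>- 2 * c p i > 4 * W\<close> absorbs them.\<close>
        have "c x k \<le> w i k + c x i - 2 * c p i"
        proof (cases "l = i")
          case True
          then show ?thesis using l(3) gt w_sym[OF i(1) k] by simp
        next
          case False
          then have "w i l \<le> c x i + c x l" using coord_ge[OF x i(1) l(1)] by simp
          then show ?thesis
            using l(3) i(2) w_bound[OF i(1) l(1)] w_bound[OF i(1) k] w_bound[OF k l(1)]
            by (simp add: abs_less_iff)
        qed
        then show ?thesis using low pk gt by (simp add: abs_le_iff)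
      qed
    qed simp
  qed
qed (rule coord_le_dist[OF x p i(1)])

text \<open>The moving pair of the geodesic is tight at the deep point and so contains
  \<open>i\<close>. Hence coordinate \<open>i\<close> is linear on all of \<open>I\<close>, not just
  on the deep part.\<close>

lemma deep_line:
  assumes g: "geodesic_on Y I \<gamma>" and s: "s \<in> I" and i: "i \<in> Z" "c (\<gamma> s) i < - 2 * W"
  obtains a where "\<And>t. t \<in> I \<Longrightarrow> c (\<gamma> t) i = a + t" | a where "\<And>t. t \<in> I \<Longrightarrow> c (\<gamma> t) i = a - t"
proof -
  have "I \<noteq> {}" using s by blast
  from geodesic_pair[OF g this] obtain k l a b where kl: "k \<in> Z" "l \<in> Z" "k \<noteq> l" "a + b = w k l"
    and ca: "\<And>t. t \<in> I \<Longrightarrow> c (\<gamma> t) k = a + t" and cb: "\<And>t. t \<in> I \<Longrightarrow> c (\<gamma> t) l = b - t" by metis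
  have "c (\<gamma> s) k + c (\<gamma> s) l = w k l" using ca[OF s] cb[OF s] kl(4) by simp
  from deep_pair[OF geodesic_onD(1)[OF g s] i kl(1-3) this] show ?thesis
    using that ca cb by metis
qed

lemma segment_between:
  assumes S: "geodesic_segment Y x y S" and q: "q \<in> S" "c q i < - 2 * W" and p: "p \<in> S" and i: "i \<in> Z"
  shows "min (c x i) (c y i) \<le> c p i \<and> c p i \<le> max (c x i) (c y i)"
proof -
  obtain \<gamma> L where \<gamma>: "L \<ge> 0" "geodesic_on Y {0..L} \<gamma>" "\<gamma> 0 = x" "\<gamma> L = y" "S = \<gamma> ` {0..L}"
    using S unfolding geodesic_segment_def by metis
  obtain s t where s: "s \<in> {0..L}" "q = \<gamma> s" and t: "t \<in> {0..L}" "p = \<gamma> t" using p q \<gamma>(5) by blast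
  have L: "0 \<in> {0..L}" "L \<in> {0..L}" using \<gamma>(1) by auto
  have "c (\<gamma> s) i < - 2 * W" using q s by simp
  from deep_line[OF \<gamma>(2) s(1) i this] show ?thesis
  proof cases
    case (1 a)
    show ?thesis using 1[OF L(1)] 1[OF L(2)] 1[OF t(1)] \<gamma>(3,4) t by auto
  next
    case (2 a)
    show ?thesis using 2[OF L(1)] 2[OF L(2)] 2[OF t(1)] \<gamma>(3,4) t by auto
  qed
qed

lemma segment_ivt:
  assumes S: "geodesic_segment Y x y S" and i: "i \<in> Z"
    and v: "min (c x i) (c y i) \<le> v" "v \<le> max (c x i) (c y i)"
  shows "\<exists>q\<in>S. c q i = v"
proof -
  obtain \<gamma> L where \<gamma>: "L \<ge> 0" "geodesic_on Y {0..L} \<gamma>" "\<gamma> 0 = x" "\<gamma> L = y" "S = \<gamma> ` {0..L}"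
    using S unfolding geodesic_segment_def by metis
  have "1-lipschitz_on {0..L} (\<lambda>t. c (\<gamma> t) i)"
    using geodesic_coord[OF \<gamma>(2) _ _ i] by (intro lipschitz_onI) (auto simp: dist_real_def)
  then have cont: "continuous_on {0..L} (\<lambda>t. c (\<gamma> t) i)"
    by (rule lipschitz_on_continuous_on)
  have "\<exists>t\<ge>0. t \<le> L \<and> c (\<gamma> t) i = v"
  proof (cases "c x i \<le> c y i")
    case True
    then show ?thesis using IVT'[OF _ _ \<gamma>(1) cont, of v] v \<gamma>(3,4) by auto
  next
    case False
    then show ?thesis using IVT2'[OF _ _ \<gamma>(1) cont, of v] v \<gamma>(3,4) by auto
  qed
  then show ?thesis using \<gamma>(5) by auto
qed

text \<open>A partner is at least \<open>- 2 * W\<close> and a weight below \<open>W\<close>, so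
  coordinates in the core lie between \<open>- 2 * W\<close> and \<open>3 * W\<close>.\<close>

lemma core_dist:
  assumes x: "x \<in> mspace Y" "\<And>i. i \<in> Z \<Longrightarrow> - 2 * W \<le> c x i"
    and y: "y \<in> mspace Y" "\<And>i. i \<in> Z \<Longrightarrow> - 2 * W \<le> c y i"
  shows "mdist Y x y \<le> 5 * W"
proof -
  have up: "c z i \<le> 3 * W" if z: "z \<in> mspace Y" "\<And>i. i \<in> Z \<Longrightarrow> - 2 * W \<le> c z i" and i: "i \<in> Z" for z i
  proof -
    obtain j where j: "j \<in> Z" "j \<noteq> i" "c z i + c z j = w i j" using coord_partner[OF z(1) i] .
    then show ?thesis using w_bound[OF i j(1)] z(2)[OF j(1)] by linarith
  qed
  show ?thesis
  proof (rule dist_le[OF x(1) y(1)])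
    fix i assume i: "i \<in> Z"
    show "\<bar>c x i - c y i\<bar> \<le> 5 * W"
      using x(2)[OF i] y(2)[OF i] up[OF x i] up[OF y i] by (simp add: abs_le_iff)
  qed
qed

lemma segment_in:
  assumes "geodesic_segment Y x y S"
  shows "S \<subseteq> mspace Y" "x \<in> S" "y \<in> S"
proof -
  obtain \<gamma> L where \<gamma>: "L \<ge> 0" "geodesic_on Y {0..L} \<gamma>" "\<gamma> 0 = x" "\<gamma> L = y" "S = \<gamma> ` {0..L}"
    using assms unfolding geodesic_segment_def by metis
  show "S \<subseteq> mspace Y" using geodesic_onD(1)[OF \<gamma>(2)] \<gamma>(5) by auto
  have "0 \<in> {0..L}" "L \<in> {0..L}" using \<gamma>(1) by auto
  then show "x \<in> S" "y \<in> S" using \<gamma>(3-5) by (metis imageI)+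
qed

text \<open>If \<open>p\<close> is deep in end \<open>i\<close>, the other two sides cross the level
  \<open>c p i\<close>, and there the crossing point is \<open>p\<close>. If \<open>p\<close> is in
  the core, any core point on these sides will do. Without one, \<open>y\<close> is deep in some end
  \<open>i\<close>, and so is \<open>x\<close>: otherwise the sides would meet the level
  \<open>- 2 * W\<close> of coordinate \<open>i\<close> at a point deep in a second end, against
  \<open>coord_sum_lower\<close>. Then all of \<open>S\<close> is deep in \<open>i\<close>,
  including \<open>p\<close>.\<close>

lemma slim_model: "slim_triangles Y (5 * W)"
  unfolding slim_triangles_def
proof (intro allI impI ballI)
  fix x y z S T U p
  assume "geodesic_segment Y x y S \<and> geodesic_segment Y y z T \<and> geodesic_segment Y z x U" and p: "p \<in> S"
  then have S: "geodesic_segment Y x y S" and T: "geodesic_segment Y y z T" and U: "geodesic_segment Y z x U"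
    by auto
  have in_Y: "q \<in> mspace Y" if "q \<in> S \<union> T \<union> U" for q
    using that segment_in(1)[OF S] segment_in(1)[OF T] segment_in(1)[OF U] by blast
  have pY: "p \<in> mspace Y" using in_Y p by blast
  have ivt: "\<exists>q\<in>T \<union> U. c q i = v"
    if i: "i \<in> Z" and v: "min (c x i) (c y i) \<le> v" "v \<le> max (c x i) (c y i)" for i v
  proof (cases "min (c y i) (c z i) \<le> v \<and> v \<le> max (c y i) (c z i)")
    case True
    then show ?thesis using segment_ivt[OF T i, of v] by blast
  next
    case False
    then have "min (c z i) (c x i) \<le> v \<and> v \<le> max (c z i) (c x i)" using v by (auto simp: min_def max_def split: if_splits)
    then show ?thesis using segment_ivt[OF U i, of v] by blast
  qed
  show "\<exists>q\<in>T \<union> U. mdist Y p q \<le> 5 * W"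
  proof (cases "\<exists>i\<in>Z. c p i < - 2 * W")
    case True
    then obtain i where i: "i \<in> Z" "c p i < - 2 * W" by blast
    obtain q where q: "q \<in> T \<union> U" "c q i = c p i"
      using ivt[OF i(1)] segment_between[OF S p i(2) p i(1)] by blast
    then have "mdist Y q p = 0" using deep_dist[OF pY i in_Y, of q] by simp
    then show ?thesis using q(1) W_pos mdist_commute[of Y q p] by (intro bexI[of _ q]) auto
  next
    case p_core: False
    have "\<exists>q\<in>T \<union> U. \<forall>i\<in>Z. - 2 * W \<le> c q i"
    proof (rule ccontr)
      assume no: "\<not> ?thesis"
      have ex: "\<exists>i\<in>Z. c q i < - 2 * W" if "q \<in> T \<union> U" for q
        using no that by (auto simp: not_le)
      obtain i where i: "i \<in> Z" "c y i < - 2 * W" using ex[of y] segment_in(2)[OF T] by blast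
      have "c x i < - 2 * W"
      proof (rule ccontr)
        assume "\<not> ?thesis"
        then obtain q where q: "q \<in> T \<union> U" "c q i = - 2 * W"
          using ivt[OF i(1), of "- 2 * W"] i(2) by auto
        obtain k where k: "k \<in> Z" "c q k < - 2 * W" using ex[OF q(1)] by blast
        have "q \<in> mspace Y" "k \<noteq> i" using in_Y q k by auto
        then show False using coord_sum_lower[of q k i] k q(2) i(1) W_pos by simp
      qed
      then have "c p i < - 2 * W"
        using segment_between[OF S segment_in(3)[OF S] i(2) p i(1)] i(2)
        by (auto simp: max_def split: if_splits)
      then show False using p_core i(1) by blast
    qed
    then obtain q where q: "q \<in> T \<union> U" "\<And>i. i \<in> Z \<Longrightarrow> - 2 * W \<le> c q i" by blast
    have "mdist Y p q \<le> 5 * W"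
      using p_core q in_Y by (intro core_dist pY) (auto simp: not_less)
    then show ?thesis using q(1) by blast
  qed
qed

lemma hyperbolic_model: "gromov_hyperbolic Y"
  unfolding gromov_hyperbolic_def using geodesic_space_model slim_model W_pos by (intro conjI exI[of _ "5 * W"]) auto

subsection \<open>Boundary and cone topology\<close>

text \<open>Linearity is required from time 0 on. This loses no ray of a class, since the falling
  coordinate of a moving pair is linear along the whole ray.\<close>

definition toward :: "(real \<Rightarrow> 'y) \<Rightarrow> 'z \<Rightarrow> bool" where
  "toward \<gamma> i \<longleftrightarrow> (\<exists>a. \<forall>t\<ge>0. c (\<gamma> t) i = a - t)"

definition endp :: "'z \<Rightarrow> (real \<Rightarrow> 'y) set" where
  "endp i = {\<gamma> \<in> geodesic_rays Y. toward \<gamma> i}"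

lemma ray_toward:
  assumes "\<gamma> \<in> geodesic_rays Y"
  obtains i where "i \<in> Z" "\<gamma> \<in> endp i"
proof -
  have g: "geodesic_on Y {0..} \<gamma>" using assms by (simp add: geodesic_rays_def)
  have ne: "{0::real..} \<noteq> {}" by auto
  obtain i j a b where "j \<in> Z" "\<And>t. t \<in> {0..} \<Longrightarrow> c (\<gamma> t) j = b - t"
    using geodesic_pair[OF g ne] by metis
  then show ?thesis using that[of j] assms by (auto simp: endp_def toward_def)
qed

text \<open>Along rays at bounded distance both coordinates would tend to -\<infinity> at the same
  points, whereas the sum of two distinct coordinates stays above \<open>- W\<close>.\<close>

lemma endp_disjoint:
  assumes "\<gamma> \<in> endp i" "\<gamma>' \<in> endp j" "i \<in> Z" "j \<in> Z"
    and close: "\<And>t. t \<ge> 0 \<Longrightarrow> mdist Y (\<gamma> t) (\<gamma>' t) \<le> C"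
  shows "i = j"
proof (rule ccontr)
  assume ne: "i \<noteq> j"
  obtain a b where a: "\<And>t. t \<ge> 0 \<Longrightarrow> c (\<gamma> t) i = a - t" and b: "\<And>t. t \<ge> 0 \<Longrightarrow> c (\<gamma>' t) j = b - t"
    using assms(1,2) by (auto simp: endp_def toward_def)
  define t where "t = \<bar>a\<bar> + \<bar>b\<bar> + \<bar>C\<bar> + W"
  have t: "t \<ge> 0" using W_pos by (simp add: t_def)
  have in_Y: "\<gamma> t \<in> mspace Y" "\<gamma>' t \<in> mspace Y" using assms(1,2) t by (auto simp: endp_def ray_in_mspace)
  have "c (\<gamma>' t) i \<le> a - t + C"
    using coord_le_dist[OF in_Y assms(3)] close[OF t] a[OF t] by linarith
  moreover have "a + b + C - 2 * t \<le> - W"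
    using W_pos abs_ge_self[of a] abs_ge_self[of b] abs_ge_self[of C] unfolding t_def
    by (simp add: algebra_simps)
  ultimately show False using coord_sum_lower[OF in_Y(2) assms(3,4) ne] b[OF t] by linarith
qed

text \<open>Once deep, the distance is the difference of the coordinates \<open>i\<close>, which is
  constant in time; before that the triangle inequality suffices.\<close>

lemma endp_asymptotic:
  assumes "\<gamma> \<in> endp i" "\<gamma>' \<in> endp i" and i: "i \<in> Z"
  shows "(\<gamma>, \<gamma>') \<in> asymptotic Y"
proof -
  obtain a b where a: "\<And>t. t \<ge> 0 \<Longrightarrow> c (\<gamma> t) i = a - t" and b: "\<And>t. t \<ge> 0 \<Longrightarrow> c (\<gamma>' t) i = b - t"
    using assms(1,2) by (auto simp: endp_def toward_def)
  have rays: "\<gamma> \<in> geodesic_rays Y" "\<gamma>' \<in> geodesic_rays Y" using assms by (auto simp: endp_def)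
  define T where "T = \<bar>a\<bar> + 2 * W + 1"
  have T: "T \<ge> 0" using W_pos by (simp add: T_def)
  have far: "mdist Y (\<gamma>' t) (\<gamma> t) \<le> \<bar>b - a\<bar>" if "t \<ge> T" for t
  proof -
    have t: "t \<ge> 0" using that T by simp
    have "c (\<gamma> t) i < - 2 * W" using a[OF t] that by (simp add: T_def)
    from deep_dist[OF ray_in_mspace[OF rays(1) t] i this ray_in_mspace[OF rays(2) t]]
    show ?thesis using a[OF t] b[OF t] by simp
  qed
  have "mdist Y (\<gamma> t) (\<gamma>' t) \<le> \<bar>b - a\<bar> + 2 * T" if t: "t \<ge> 0" for t
  proof (cases "t \<ge> T")
    case True
    then show ?thesis using far[OF True] T mdist_commute[of Y "\<gamma> t" "\<gamma>' t"] by simp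
  next
    case False
    have "mdist Y (\<gamma> t) (\<gamma>' t) \<le> mdist Y (\<gamma> t) (\<gamma> T) + mdist Y (\<gamma> T) (\<gamma>' t)"
      using t T rays by (intro mdist_triangle ray_in_mspace) auto
    moreover have "mdist Y (\<gamma> T) (\<gamma>' t) \<le> mdist Y (\<gamma> T) (\<gamma>' T) + mdist Y (\<gamma>' T) (\<gamma>' t)"
      using t T rays by (intro mdist_triangle ray_in_mspace) auto
    ultimately show ?thesis
      using ray_dist[OF rays(1) t T] ray_dist[OF rays(2) T t] far[of T] t False
        mdist_commute[of Y "\<gamma> T" "\<gamma>' T"] by simp
  qed
  then show ?thesis using rays by (auto simp: asymptotic_def)
qed

lemma asymptotic_class:
  assumes "\<gamma> \<in> endp i" "i \<in> Z"
  shows "asymptotic Y `` {\<gamma>} = endp i"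
proof (intro subset_antisym subsetI)
  fix \<gamma>' assume "\<gamma>' \<in> endp i"
  then show "\<gamma>' \<in> asymptotic Y `` {\<gamma>}" using endp_asymptotic[OF assms(1) _ assms(2)] by simp
next
  fix \<gamma>' assume "\<gamma>' \<in> asymptotic Y `` {\<gamma>}"
  then obtain C where \<gamma>': "\<gamma>' \<in> geodesic_rays Y" and C: "\<And>t. t \<ge> 0 \<Longrightarrow> mdist Y (\<gamma> t) (\<gamma>' t) \<le> C"
    by (auto simp: asymptotic_def)
  obtain j where j: "j \<in> Z" "\<gamma>' \<in> endp j" using ray_toward[OF \<gamma>'] .
  have "i = j" using endp_disjoint[OF assms(1) j(2) assms(2) j(1) C] .
  then show "\<gamma>' \<in> endp i" using j by simp
qed

text \<open>A constant geodesic at any \<open>y\<close> is prolonged with \<open>i\<close>, tight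
  with its partner at \<open>y\<close>, prescribed as the falling coordinate.\<close>

lemma line_exists:
  assumes i: "i \<in> Z"
  obtains \<gamma> a where "geodesic_on Y UNIV \<gamma>" "\<And>t. c (\<gamma> t) i = a - t"
proof -
  obtain y where y: "y \<in> mspace Y" using Y_nonempty by blast
  have g: "geodesic_on Y {0} (\<lambda>_. y)" using y by (auto simp: geodesic_on_def is_interval_def)
  obtain j where j: "j \<in> Z" "j \<noteq> i" "c y i + c y j = w i j" using coord_partner[OF y i] .
  obtain \<gamma> where "geodesic_on Y UNIV \<gamma>" "\<And>t. c (\<gamma> t) i = c y i - t"
  proof (rule geodesic_extension[OF g _ j(1) i j(2), of "c y j" "c y i"])
    show "c y j + c y i = w j i" using j(3) w_sym[OF i j(1)] by simp
  qed (use that in auto)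
  then show ?thesis using that by blast
qed

lemma endp_nonempty:
  assumes "i \<in> Z"
  obtains \<gamma> where "\<gamma> \<in> endp i"
proof -
  obtain \<gamma> a where \<gamma>: "geodesic_on Y UNIV \<gamma>" "\<And>t. c (\<gamma> t) i = a - t" using line_exists[OF assms] by blast
  then have "\<gamma> \<in> endp i"
    using geodesic_on_subset[OF \<gamma>(1), of "{0..}"] by (auto simp: endp_def toward_def geodesic_rays_def is_interval_ci)
  then show ?thesis using that by blast
qed

lemma boundary_model: "gromov_boundary Y = endp ` Z"
proof (intro subset_antisym subsetI)
  fix \<xi> assume "\<xi> \<in> gromov_boundary Y"
  then obtain \<gamma> where \<gamma>: "\<gamma> \<in> geodesic_rays Y" "\<xi> = asymptotic Y `` {\<gamma>}"
    by (auto simp: gromov_boundary_def quotient_def)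
  obtain i where "i \<in> Z" "\<gamma> \<in> endp i" using ray_toward[OF \<gamma>(1)] .
  then show "\<xi> \<in> endp ` Z" using asymptotic_class[of \<gamma> i] \<gamma>(2) by simp
next
  fix \<xi> assume "\<xi> \<in> endp ` Z"
  then obtain i where i: "i \<in> Z" "\<xi> = endp i" by blast
  obtain \<gamma> where \<gamma>: "\<gamma> \<in> endp i" using endp_nonempty[OF i(1)] .
  then have "\<gamma> \<in> geodesic_rays Y" by (simp add: endp_def)
  then show "\<xi> \<in> gromov_boundary Y"
    using asymptotic_class[OF \<gamma> i(1)] i(2) by (auto simp: gromov_boundary_def quotient_def)
qed

lemma endp_inj:
  assumes "i \<in> Z" "j \<in> Z" "endp i = endp j"
  shows "i = j"
proof -
  obtain \<gamma> where \<gamma>: "\<gamma> \<in> endp i" using endp_nonempty[OF assms(1)] .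
  then have "mdist Y (\<gamma> t) (\<gamma> t) \<le> 0" if "t \<ge> 0" for t using ray_in_mspace[of \<gamma> Y t] that \<gamma> by (simp add: endp_def)
  then show ?thesis using endp_disjoint[OF \<gamma> _ assms(1,2)] \<gamma> assms(3) by auto
qed

text \<open>Only this direction is needed: the sets described here are cone-open, and they suffice to test
  continuity.\<close>

lemma cone_openI:
  assumes U: "U \<subseteq> compactification Y"
    and inner: "\<And>y. y \<in> mspace Y \<Longrightarrow> Inl y \<in> U \<Longrightarrow> \<exists>e>0. \<forall>z\<in>mspace Y. mdist Y y z < e \<longrightarrow> Inl z \<in> U"
    and outer: "\<And>i. i \<in> Z \<Longrightarrow> Inr (endp i) \<in> U \<Longrightarrow> \<exists>M. \<forall>z\<in>mspace Y. c z i < M \<longrightarrow> Inl z \<in> U"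
  shows "cone_open Y U"
  unfolding cone_open_def
proof (intro conjI allI impI U notI)
  fix s e
  assume s: "(\<forall>n. s n \<in> compactification Y - U) \<and> cone_limit Y s e" and eU: "e \<in> U"
  obtain p cn where p: "p \<in> mspace Y"
    and cn: "\<And>n. cn n 0 = p" "\<And>n. generalized_ray Y (cn n) (s n)"
    and sub: "\<And>r :: nat \<Rightarrow> nat. strict_mono r \<Longrightarrow> \<exists>(r' :: nat \<Rightarrow> nat) c'. strict_mono r' \<and>
      generalized_ray Y c' e \<and> locally_uniform_limit Y (cn \<circ> r \<circ> r') c'"
    using s unfolding cone_limit_def by blast
  obtain r cl where cl: "generalized_ray Y cl e" and lim: "locally_uniform_limit Y (cn \<circ> id \<circ> r) cl"
    using sub[of id] strict_mono_id by (auto simp: id_def strict_mono_def)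
  have near: "\<exists>n. \<forall>t\<in>{0..T}. mdist Y (cn n t) (cl t) < \<epsilon>" if "\<epsilon> > 0" for T \<epsilon>
    using lim that unfolding locally_uniform_limit_def by (simp add: comp_def) blast
  have notin: "s n \<notin> U" for n using s by blast
  from cl show False
  proof (cases rule: generalized_rayE)
    case ray
    obtain i where i: "i \<in> Z" "cl \<in> endp i" using ray_toward[OF ray(1)] .
    have e: "e = Inr (endp i)" using ray(2) asymptotic_class[OF i(2,1)] by simp
    obtain M where M: "\<And>z. z \<in> mspace Y \<Longrightarrow> c z i < M \<Longrightarrow> Inl z \<in> U" using outer[OF i(1)] eU e by blast
    obtain a where a: "\<And>t. t \<ge> 0 \<Longrightarrow> c (cl t) i = a - t" using i(2) by (auto simp: endp_def toward_def)
    \<comment> \<open>Below \<open>M\<close> to land in \<open>U\<close>, below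
      \<open>- 2 * W\<close> for \<open>deep_line\<close>, and at most \<open>c p i\<close> so that
      coordinate \<open>i\<close> cannot be of the rising kind on a ray from \<open>p\<close> that
      gets below this level.\<close>
    define M' where "M' = min (min M (- 2 * W)) (c p i)"
    have M': "M' \<le> M" "M' \<le> - 2 * W" "M' \<le> c p i" by (simp_all add: M'_def)
    define T where "T = \<bar>a\<bar> + \<bar>M'\<bar> + 1"
    have T: "T \<ge> 0" "a - T \<le> M' - 1" by (simp_all add: T_def)
    obtain n where n: "\<forall>t\<in>{0..T}. mdist Y (cn n t) (cl t) < 1" using near[of 1 T] by auto
    define d where "d = cn n"
    have d: "generalized_ray Y d (s n)" "d 0 = p" using cn by (auto simp: d_def)
    have "\<bar>c (d T) i - c (cl T) i\<bar> < 1"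
      using coord_le_dist[OF generalized_ray_in[OF d(1) T(1)] generalized_ray_in[OF cl T(1)] i(1)]
        n T(1) by (auto simp: d_def) (smt (verit) atLeastAtMost_iff)
    then have dT: "c (d T) i < M'" using a[OF T(1)] T(2) by linarith
    from d(1) show False
    proof (cases rule: generalized_rayE)
      case dray: ray
      have g: "geodesic_on Y {0..} d" using dray(1) by (simp add: geodesic_rays_def)
      have "T \<in> {0..}" "c (d T) i < - 2 * W" using T dT M' by auto
      from deep_line[OF g this(1) i(1) this(2)]
      obtain b where "\<And>t. t \<in> {0..} \<Longrightarrow> c (d t) i = b - t"
      proof cases
        case (1 b)
        have "c (d 0) i = b + 0" "c (d T) i = b + T" using 1[of 0] 1[of T] T(1) by auto
        then have False using dT d(2) M'(3) T(1) by simp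
        then show ?thesis ..
      qed (use that in blast)
      then have "d \<in> endp i" using dray(1) by (auto simp: endp_def toward_def)
      from asymptotic_class[OF this i(1)] have "s n = e" using dray(2) e by simp
      then show False using notin eU by blast
    next
      case (segment R)
      \<comment> \<open>The segment may stop before \<open>T\<close> and is constant
        afterwards.\<close>
      define T' where "T' = min T R"
      have T': "T' \<in> {0..R}" using T segment(1) by (auto simp: T'_def)
      have dT': "d T' = d T" using segment(3)[of T] by (auto simp: T'_def min_def)
      have R: "0 \<in> {0..R}" "R \<in> {0..R}" using segment(1) by auto
      have "c (d T') i < - 2 * W" using dT' dT M' by auto
      from deep_line[OF segment(2) T' i(1) this]
      have "c (d R) i \<le> c (d T') i"
      proof cases
        case (1 b)
        have "c (d 0) i = b + 0" "c (d T') i = b + T'" using 1[OF R(1)] 1[OF T'] by auto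
        then show ?thesis using dT dT' d(2) M'(3) T' by simp
      next
        case (2 b)
        show ?thesis using 2[OF R(2)] 2[OF T'] T' by simp
      qed
      then have "Inl (d R) \<in> U" using dT dT' M'(1) M geodesic_onD(1)[OF segment(2) R(2)] by simp
      then show False using notin segment(4) by metis
    qed
  next
    case (segment R)
    have R: "R \<in> {0..R}" "0 \<in> {0..R}" using segment(1) by auto
    have clR: "cl R \<in> mspace Y" "cl 0 \<in> mspace Y" using geodesic_onD(1)[OF segment(2)] R by auto
    obtain e0 where e0: "e0 > 0" "\<And>z. z \<in> mspace Y \<Longrightarrow> mdist Y (cl R) z < e0 \<Longrightarrow> Inl z \<in> U"
      using inner[OF clR(1)] eU segment(4) by blast
    \<comment> \<open>With errors below 1/2 at times 0 and \<open>R + 1\<close>, \<open>d\<close>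
      covers less than \<open>R + 1\<close> in that time. So it has stopped already, at a point
      within \<open>e0\<close> of \<open>cl R\<close>.\<close>
    define \<epsilon> where "\<epsilon> = min e0 (1/2)"
    have \<epsilon>: "\<epsilon> > 0" "\<epsilon> \<le> e0" "\<epsilon> \<le> 1/2" using e0(1) by (auto simp: \<epsilon>_def)
    obtain n where n: "\<forall>t\<in>{0..R+1}. mdist Y (cn n t) (cl t) < \<epsilon>" using near[OF \<epsilon>(1)] by blast
    define d where "d = cn n"
    have d: "generalized_ray Y d (s n)" "d 0 = p" using cn by (auto simp: d_def)
    have R1: "R + 1 \<ge> 0" using segment(1) by simp
    have d1: "d (R + 1) \<in> mspace Y" by (rule generalized_ray_in[OF d(1) R1])
    have n0: "mdist Y (d 0) (cl 0) < \<epsilon>" and nR: "mdist Y (d (R + 1)) (cl R) < \<epsilon>"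
      using n[rule_format, of 0] n[rule_format, of "R + 1"] R1 segment(3)[of "R + 1"]
      by (auto simp: d_def)
    have d0: "d 0 \<in> mspace Y" using d p by simp
    have "mdist Y (d 0) (d (R + 1)) \<le> mdist Y (d 0) (cl 0) + mdist Y (cl 0) (d (R + 1))"
      by (rule mdist_triangle[OF d0 clR(2) d1])
    also have "mdist Y (cl 0) (d (R + 1)) \<le> mdist Y (cl 0) (cl R) + mdist Y (cl R) (d (R + 1))"
      by (rule mdist_triangle[OF clR(2,1) d1])
    finally have short: "mdist Y (d 0) (d (R + 1)) < R + 1"
      using n0 nR \<epsilon>(3) geodesic_onD(2)[OF segment(2) R(2,1)] segment(1) mdist_commute[of Y "cl R" "d (R + 1)"]
      by simp
    from d(1) show False
    proof (cases rule: generalized_rayE)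
      case dray: ray
      then show False using short ray_dist[OF dray(1), of 0 "R + 1"] R1 by simp
    next
      case dseg: (segment R')
      have "R' < R + 1"
      proof (rule ccontr)
        assume "\<not> ?thesis"
        then have "0 \<in> {0..R'}" "R + 1 \<in> {0..R'}" using R1 by auto
        from geodesic_onD(2)[OF dseg(2) this] show False using short R1 by simp
      qed
      then have dR: "d (R + 1) = d R'" using dseg(3)[of "R + 1"] by simp
      have "mdist Y (cl R) (d R') < e0"
        using nR \<epsilon>(2) dR mdist_commute[of Y "cl R" "d R'"] by simp
      then have "Inl (d R') \<in> U" using e0(2) d1 dR by simp
      then show False using notin dseg(4) by metis
    qed
  qed
qed

lemma cone_continuousI:
  assumes img: "\<And>a. a \<in> compactification Y \<Longrightarrow> f a \<in> topspace T"
    and inner: "\<And>y V. y \<in> mspace Y \<Longrightarrow> openin T V \<Longrightarrow> f (Inl y) \<in> V \<Longrightarrow>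
      \<exists>e>0. \<forall>z\<in>mspace Y. mdist Y y z < e \<longrightarrow> f (Inl z) \<in> V"
    and outer: "\<And>i V. i \<in> Z \<Longrightarrow> openin T V \<Longrightarrow> f (Inr (endp i)) \<in> V \<Longrightarrow>
      \<exists>M. \<forall>z\<in>mspace Y. c z i < M \<longrightarrow> f (Inl z) \<in> V"
  shows "continuous_map (cone_topology Y) T f"
  unfolding continuous_map_def topspace_cone_topology openin_cone_topology
proof (intro conjI allI impI)
  show "f \<in> compactification Y \<rightarrow> topspace T" using img by blast
  fix V assume V: "openin T V"
  have Inl: "Inl z \<in> {x \<in> compactification Y. f x \<in> V} \<longleftrightarrow> f (Inl z) \<in> V" if "z \<in> mspace Y" for z
    using that by simp
  show "cone_open Y {x \<in> compactification Y. f x \<in> V}"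
  proof (rule cone_openI)
    fix y assume y: "y \<in> mspace Y" "Inl y \<in> {x \<in> compactification Y. f x \<in> V}"
    then show "\<exists>e>0. \<forall>z\<in>mspace Y. mdist Y y z < e \<longrightarrow> Inl z \<in> {x \<in> compactification Y. f x \<in> V}"
      using inner[OF y(1) V] Inl by simp
  next
    fix i assume "i \<in> Z" "Inr (endp i) \<in> {x \<in> compactification Y. f x \<in> V}"
    then show "\<exists>M. \<forall>z\<in>mspace Y. c z i < M \<longrightarrow> Inl z \<in> {x \<in> compactification Y. f x \<in> V}"
      using outer[OF _ V] Inl by simp
  qed blast
qed

section \<open>Continuous extension of the Gromov product\<close>

definition level :: "real \<Rightarrow> 'z \<Rightarrow> 'y" where
  "level K i = (SOME q. q \<in> mspace Y \<and> c q i = - K)"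

lemma level:
  assumes "i \<in> Z"
  shows "level K i \<in> mspace Y" "c (level K i) i = - K"
proof -
  obtain \<gamma> a where \<gamma>: "geodesic_on Y UNIV \<gamma>" "\<And>t. c (\<gamma> t) i = a - t" using line_exists[OF assms] by blast
  have "\<gamma> (a + K) \<in> mspace Y \<and> c (\<gamma> (a + K)) i = - K" using geodesic_onD(1)[OF \<gamma>(1)] \<gamma>(2) by simp
  then have "level K i \<in> mspace Y \<and> c (level K i) i = - K" unfolding level_def by (rule someI)
  then show "level K i \<in> mspace Y" "c (level K i) i = - K" by auto
qed

text \<open>For \<open>K > 2 * W\<close> this collapses each end beyond level \<open>- K\<close>,
  together with its boundary point, to the unique point at that level. It carries the finite part of
  the extended Gromov product.\<close>

definition trunc :: "real \<Rightarrow> 'y bordified \<Rightarrow> 'y" where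
  "trunc K a = (case a of
      Inl y \<Rightarrow> if \<exists>i\<in>Z. c y i < - K then level K (SOME i. i \<in> Z \<and> c y i < - K) else y
    | Inr e \<Rightarrow> level K (SOME i. i \<in> Z \<and> e = endp i))"

text \<open>How far a point lies beyond the cut in end \<open>i\<close>. The minimum of two depths
  is the part of the Gromov product that may become infinite.\<close>

definition depth :: "real \<Rightarrow> 'z \<Rightarrow> 'y bordified \<Rightarrow> ereal" where
  "depth K i a = (case a of Inl y \<Rightarrow> ereal (max 0 (- K - c y i)) | Inr e \<Rightarrow> if e = endp i then \<infinity> else 0)"

context
  fixes K :: real assumes K: "K > 2 * W"
begin

lemma deep_unique:
  assumes y: "y \<in> mspace Y" and i: "i \<in> Z" "c y i \<le> - K" and j: "j \<in> Z" "c y j \<le> - K"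
  shows "i = j"
  using coord_sum_lower[OF y i(1) j(1)] i(2) j(2) K W_pos by (cases "i = j") auto

lemma trunc_core: "(\<And>i. i \<in> Z \<Longrightarrow> - K \<le> c y i) \<Longrightarrow> trunc K (Inl y) = y"
  unfolding trunc_def by (auto simp flip: not_le)

lemma trunc_deep:
  assumes y: "y \<in> mspace Y" and i: "i \<in> Z" "c y i < - K"
  shows "trunc K (Inl y) = level K i"
proof -
  have "(SOME j. j \<in> Z \<and> c y j < - K) = i"
    using i deep_unique[OF y] by (intro some_equality) (auto simp: less_imp_le)
  then show ?thesis unfolding trunc_def using i by auto
qed

lemma trunc_end:
  assumes i: "i \<in> Z"
  shows "trunc K (Inr (endp i)) = level K i"
proof -
  have "(SOME j. j \<in> Z \<and> endp i = endp j) = i"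
    using i endp_inj by (intro some_equality) auto
  then show ?thesis unfolding trunc_def by simp
qed

lemma trunc_in:
  assumes "a \<in> compactification Y"
  shows "trunc K a \<in> mspace Y"
  using assms
proof (cases rule: compactificationE)
  case (point y)
  then show ?thesis
    by (cases "\<exists>i\<in>Z. c y i < - K") (auto simp: trunc_deep level trunc_core not_less)
next
  case (boundary \<xi>)
  then show ?thesis by (auto simp: boundary_model trunc_end level)
qed

lemma level_dist:
  assumes "i \<in> Z" "y \<in> mspace Y"
  shows "mdist Y y (level K i) = \<bar>c y i + K\<bar>"
proof -
  have "c (level K i) i < - 2 * W" using level[OF assms(1)] K by simp
  from deep_dist[OF level(1)[OF assms(1)] assms(1) this assms(2)] show ?thesis
    using level[OF assms(1)] by simp
qed

lemma level_closer:
  assumes y: "y \<in> mspace Y" "c y i < - K" and z: "z \<in> mspace Y" "- K \<le> c z i" and i: "i \<in> Z"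
  shows "mdist Y z (level K i) \<le> mdist Y z y"
  using level_dist[OF i z(1)] coord_le_dist[OF z(1) y(1) i] y(2) z(2) by linarith

text \<open>Two points beyond the cut in the same end have the same image. Otherwise they are moved
  one after the other: replacing a point by the level point of its end brings it closer to
  everything outside that end, and the truncated first point is still outside the end of the
  second.\<close>

lemma trunc_lipschitz:
  assumes y: "y \<in> mspace Y" and z: "z \<in> mspace Y"
  shows "mdist Y (trunc K (Inl y)) (trunc K (Inl z)) \<le> mdist Y y z"
proof -
  have one: "mdist Y (trunc K (Inl y)) z \<le> mdist Y y z"
    if y: "y \<in> mspace Y" and z: "z \<in> mspace Y" and yz: "\<And>i. i \<in> Z \<Longrightarrow> c y i < - K \<Longrightarrow> - K \<le> c z i" for y z
  proof (cases "\<exists>i\<in>Z. c y i < - K")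
    case True
    then obtain i where i: "i \<in> Z" "c y i < - K" by blast
    then show ?thesis
      using level_closer[OF y i(2) z yz[OF i] i(1)] trunc_deep[OF y i]
      by (simp add: mdist_commute)
  next
    case False
    then show ?thesis by (simp add: trunc_core not_less)
  qed
  show ?thesis
  proof (cases "\<exists>i\<in>Z. c y i < - K \<and> c z i < - K")
    case True
    then obtain i where i: "i \<in> Z" "c y i < - K" "c z i < - K" by blast
    then show ?thesis using trunc_deep[OF y i(1,2)] trunc_deep[OF z i(1,3)] level[OF i(1)] by simp
  next
    case False
    have ty: "trunc K (Inl y) \<in> mspace Y" using y by (intro trunc_in) simp
    have "- K \<le> c (trunc K (Inl y)) i" if i: "i \<in> Z" "c z i < - K" for i
    proof (cases "\<exists>j\<in>Z. c y j < - K")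
      case True
      then obtain j where j: "j \<in> Z" "c y j < - K" by blast
      then have "i \<noteq> j" using False i by blast
      then show ?thesis
        using coord_sum_lower[OF level(1)[OF j(1), of K] i(1) j(1)] level(2)[OF j(1)] trunc_deep[OF y j] K W_pos by simp
    next
      case no: False
      then show ?thesis using i by (simp add: trunc_core not_less)
    qed
    then have "mdist Y (trunc K (Inl z)) (trunc K (Inl y)) \<le> mdist Y z (trunc K (Inl y))"
      by (rule one[OF z ty])
    moreover have "mdist Y (trunc K (Inl y)) z \<le> mdist Y y z"
      using False by (intro one y z) (auto simp: not_less)
    ultimately show ?thesis by (simp add: mdist_commute)
  qed
qed

lemma trunc_continuous: "continuous_map (cone_topology Y) (mtopology_of Y) (trunc K)"
proof (rule cone_continuousI)
  interpret M: Metric_space "mspace Y" "mdist Y" by simp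
  have top: "mtopology_of Y = M.mtopology" by (simp add: mtopology_of_def)
  show "trunc K a \<in> topspace (mtopology_of Y)" if "a \<in> compactification Y" for a
    using trunc_in[OF that] by simp
  fix V assume V: "openin (mtopology_of Y) V"
  show "\<exists>e>0. \<forall>z\<in>mspace Y. mdist Y y z < e \<longrightarrow> trunc K (Inl z) \<in> V"
    if y: "y \<in> mspace Y" "trunc K (Inl y) \<in> V" for y
  proof -
    obtain e where e: "e > 0" "M.mball (trunc K (Inl y)) e \<subseteq> V"
      using V y(2) unfolding top M.openin_mtopology by blast
    have "trunc K (Inl z) \<in> V" if z: "z \<in> mspace Y" "mdist Y y z < e" for z
    proof -
      have "trunc K (Inl y) \<in> mspace Y" "trunc K (Inl z) \<in> mspace Y"
        using y z by (auto intro!: trunc_in)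
      then have "trunc K (Inl z) \<in> M.mball (trunc K (Inl y)) e"
        using trunc_lipschitz[OF y(1) z(1)] z(2) by simp
      then show ?thesis using e(2) by blast
    qed
    then show ?thesis using e(1) by blast
  qed
  show "\<exists>M. \<forall>z\<in>mspace Y. c z i < M \<longrightarrow> trunc K (Inl z) \<in> V" if i: "i \<in> Z" "trunc K (Inr (endp i)) \<in> V" for i
    using i by (intro exI[of _ "- K"]) (auto simp: trunc_deep trunc_end)
qed

lemma depth_nonneg: "0 \<le> depth K i a"
  by (auto simp: depth_def le_max_iff_disj zero_ereal_def split: sum.split)

lemma depth_continuous:
  assumes i: "i \<in> Z"
  shows "continuous_map (cone_topology Y) euclidean (depth K i)"
proof (rule cone_continuousI)
  fix V :: "ereal set" assume "openin euclidean V"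
  then have V: "open V" by simp
  show "\<exists>e>0. \<forall>z\<in>mspace Y. mdist Y y z < e \<longrightarrow> depth K i (Inl z) \<in> V"
    if y: "y \<in> mspace Y" "depth K i (Inl y) \<in> V" for y
  proof -
    have "continuous_on UNIV (\<lambda>u. ereal (max 0 (- K - u)))" by (intro continuous_intros)
    then have "open ((\<lambda>u. ereal (max 0 (- K - u))) -` V)" by (rule open_vimage[OF V])
    moreover have "c y i \<in> (\<lambda>u. ereal (max 0 (- K - u))) -` V" using y(2) by (simp add: depth_def)
    ultimately obtain e where e: "e > 0" "ball (c y i) e \<subseteq> (\<lambda>u. ereal (max 0 (- K - u))) -` V"
      using open_contains_ball_eq by blast
    have "depth K i (Inl z) \<in> V" if z: "z \<in> mspace Y" "mdist Y y z < e" for z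
    proof -
      have "c z i \<in> ball (c y i) e" using coord_le_dist[OF y(1) z(1) i] z(2) by (simp add: dist_real_def)
      then show ?thesis using e(2) by (auto simp: depth_def)
    qed
    then show ?thesis using e(1) by blast
  qed
  show "\<exists>M. \<forall>z\<in>mspace Y. c z j < M \<longrightarrow> depth K i (Inl z) \<in> V"
    if j: "j \<in> Z" "depth K i (Inr (endp j)) \<in> V" for j
  proof (cases "j = i")
    case True
    then have "\<infinity> \<in> V" using j by (simp add: depth_def)
    then obtain B where B: "{ereal B<..} \<subseteq> V" using open_PInfty[OF V] by blast
    show ?thesis
    proof (intro exI[of _ "- K - \<bar>B\<bar>"] ballI impI)
      fix z assume "c z j < - K - \<bar>B\<bar>"
      then have "B < max 0 (- K - c z i)" using True by auto
      then show "depth K i (Inl z) \<in> V" using B by (auto simp: depth_def simp del: ereal_max)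
    qed
  next
    case False
    then have V0: "0 \<in> V" using j endp_inj[OF i j(1)] by (auto simp: depth_def split: if_splits)
    show ?thesis
    proof (intro exI[of _ "- K"] ballI impI)
      fix z assume z: "z \<in> mspace Y" "c z j < - K"
      then have "- K \<le> c z i" using deep_unique[OF z(1) j(1) _ i] False by (meson less_imp_le not_le)
      then show "depth K i (Inl z) \<in> V" using V0 by (simp add: depth_def max_def zero_ereal_def)
    qed
  qed
qed simp

end

context
  fixes K :: real assumes K: "K > 2 * W"
begin

lemma deep_far:
  assumes y: "y \<in> mspace Y" and i: "i \<in> Z" "c y i < - K" and u: "u \<in> mspace Y" "- K \<le> c u i"
  shows "mdist Y y u = mdist Y (level K i) u + (- K - c y i)"
proof -
  have "mdist Y u y = \<bar>c u i - c y i\<bar>" using deep_dist[OF y i(1) _ u(1)] i(2) K by simp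
  then show ?thesis using level_dist[OF K i(1) u(1)] i(2) u(2) by (simp add: mdist_commute)
qed

text \<open>Paths out of end \<open>i\<close> pass through its level point, so \<open>y\<close> has
  the same excess in its distances to \<open>x\<close> and to \<open>z\<close>, and the excess
  cancels in the Gromov product.\<close>

lemma product_level:
  assumes x: "x \<in> mspace Y" "- K \<le> c x i" and y: "y \<in> mspace Y" and i: "i \<in> Z" "c y i < - K"
    and z: "z \<in> mspace Y" "- K \<le> c z i"
  shows "gromov_product Y x y z = gromov_product Y x (level K i) z"
  using deep_far[OF y i x] deep_far[OF y i z] by (simp add: gromov_product_def)

text \<open>Only an end containing both points contributes to the sum, by the length that the paths
  from \<open>x\<close> share beyond the cut. Summing over all ends avoids case distinctions in the
  proof of continuity.\<close>

lemma product_trunc: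
  assumes x: "x \<in> mspace Y" "\<And>i. i \<in> Z \<Longrightarrow> - K \<le> c x i" and y: "y \<in> mspace Y" and z: "z \<in> mspace Y"
  shows "gromov_product Y x y z = gromov_product Y x (trunc K (Inl y)) (trunc K (Inl z)) +
    (\<Sum>j\<in>Z. min (max 0 (- K - c y j)) (max 0 (- K - c z j)))"
proof (cases "\<exists>i\<in>Z. c y i < - K \<and> c z i < - K")
  case True
  then obtain i where i: "i \<in> Z" "c y i < - K" "c z i < - K" by blast
  have other: "min (max 0 (- K - c y j)) (max 0 (- K - c z j)) = 0" if j: "j \<in> Z - {i}" for j
  proof -
    have "- K < c y j" using deep_unique[OF K y i(1) _ , of j] i(2) j by (auto simp flip: not_le)
    then show ?thesis by simp
  qed
  have sum: "(\<Sum>j\<in>Z. min (max 0 (- K - c y j)) (max 0 (- K - c z j))) = min (- K - c y i) (- K - c z i)"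
    using sum.remove[OF finite_Z i(1), of "\<lambda>j. min (max 0 (- K - c y j)) (max 0 (- K - c z j))"]
      sum.neutral[of "Z - {i}" "\<lambda>j. min (max 0 (- K - c y j)) (max 0 (- K - c z j))"] other i(2,3) by simp
  have yz: "mdist Y y z = \<bar>c y i - c z i\<bar>" using deep_dist[OF z i(1) _ y] i(3) K by simp
  have xl: "mdist Y (level K i) x = c x i + K"
    using level_dist[OF K i(1) x(1)] x(2)[OF i(1)] mdist_commute[of Y x] by simp
  have yx: "mdist Y y x = c x i - c y i" "mdist Y z x = c x i - c z i"
    using deep_far[OF y i(1,2) x(1) x(2)[OF i(1)]] deep_far[OF z i(1,3) x(1) x(2)[OF i(1)]] xl by simp_all
  have "gromov_product Y x y z = c x i + K + min (- K - c y i) (- K - c z i)"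
    unfolding gromov_product_def yz yx by (simp add: min_def abs_if field_simps)
  moreover have "gromov_product Y x (level K i) (level K i) = c x i + K"
    using xl level[OF i(1)] by (simp add: gromov_product_def)
  ultimately show ?thesis
    using sum trunc_deep[OF K y i(1,2)] trunc_deep[OF K z i(1,3)] by simp
next
  case False
  have "min (max 0 (- K - c y j)) (max 0 (- K - c z j)) = 0" if "j \<in> Z" for j
    using False that by (cases "c y j < - K") (auto simp: min_def max_def not_less)
  then have sum: "(\<Sum>j\<in>Z. min (max 0 (- K - c y j)) (max 0 (- K - c z j))) = 0" by (intro sum.neutral) simp
  have one: "gromov_product Y x y z = gromov_product Y x (trunc K (Inl y)) z"
    if y: "y \<in> mspace Y" and z: "z \<in> mspace Y" and yz: "\<And>i. i \<in> Z \<Longrightarrow> c y i < - K \<Longrightarrow> - K \<le> c z i" for y z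
  proof (cases "\<exists>i\<in>Z. c y i < - K")
    case True
    then obtain i where i: "i \<in> Z" "c y i < - K" by blast
    show ?thesis using product_level[OF x(1) x(2)[OF i(1)] y i z yz[OF i]] trunc_deep[OF K y i] by simp
  next
    case False
    then show ?thesis by (simp add: trunc_core[OF K] not_less)
  qed
  have ty: "trunc K (Inl y) \<in> mspace Y" using y by (intro trunc_in[OF K]) simp
  have away: "- K \<le> c (trunc K (Inl y)) i" if i: "i \<in> Z" "c z i < - K" for i
  proof (cases "\<exists>j\<in>Z. c y j < - K")
    case True
    then obtain j where j: "j \<in> Z" "c y j < - K" by blast
    then have "i \<noteq> j" using False i by blast
    then show ?thesis
      using coord_sum_lower[OF level(1)[OF j(1), of K] i(1) j(1)] level(2)[OF j(1)] trunc_deep[OF K y j] K W_pos by simp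
  next
    case no: False
    then show ?thesis using i by (simp add: trunc_core[OF K] not_less)
  qed
  have "gromov_product Y x y z = gromov_product Y x (trunc K (Inl y)) z"
    using False by (intro one y z) (auto simp: not_less)
  also have "\<dots> = gromov_product Y x (trunc K (Inl z)) (trunc K (Inl y))"
    using one[OF z ty away] gromov_product_commute by metis
  finally show ?thesis using sum gromov_product_commute by simp
qed

text \<open>The right side of \<open>product_trunc\<close> makes sense on the whole
  compactification. Its terms are continuous, and their nonnegativity excludes the form \<infinity>
  - \<infinity>, where addition on \<open>ereal\<close> is not continuous.\<close>

lemma extension_exists:
  assumes x: "x \<in> mspace Y" "\<And>i. i \<in> Z \<Longrightarrow> - K \<le> c x i"
  shows "extends_gromov_product Y x (\<lambda>(a, b).
    ereal (gromov_product Y x (trunc K a) (trunc K b)) + (\<Sum>j\<in>Z. min (depth K j a) (depth K j b)))"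
    (is "extends_gromov_product Y x ?g")
  unfolding extends_gromov_product_def
proof (intro conjI ballI)
  let ?C = "cone_topology Y" and ?T = "prod_topology (cone_topology Y) (cone_topology Y)"
  let ?p = "\<lambda>q. gromov_product Y x (trunc K (fst q)) (trunc K (snd q))"
  have fst: "continuous_map ?T ?C fst" and snd: "continuous_map ?T ?C snd"
    by (simp_all add: continuous_map_fst continuous_map_snd)
  have tr: "continuous_map ?T (mtopology_of Y) (\<lambda>q. trunc K (fst q))"
    "continuous_map ?T (mtopology_of Y) (\<lambda>q. trunc K (snd q))"
    using continuous_map_compose[OF fst trunc_continuous[OF K]]
      continuous_map_compose[OF snd trunc_continuous[OF K]] by (simp_all add: comp_def)
  have const: "continuous_map ?T (mtopology_of Y) (\<lambda>_. x)" using x by simp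
  note dists = continuous_map_mdist[OF tr(1) const] continuous_map_mdist[OF tr(2) const]
    continuous_map_mdist[OF tr]
  have dep: "continuous_map ?T euclidean (\<lambda>q. depth K j (fst q))"
    "continuous_map ?T euclidean (\<lambda>q. depth K j (snd q))" if "j \<in> Z" for j
    using continuous_map_compose[OF fst depth_continuous[OF K that]]
      continuous_map_compose[OF snd depth_continuous[OF K that]] by (simp_all add: comp_def)
  have nonneg: "0 \<le> ?p q" if "q \<in> topspace ?T" for q
    using that by (intro gromov_product_nonneg x trunc_in[OF K]) (auto simp: topspace_cone_topology)
  have sum_ge0: "0 \<le> (\<Sum>j\<in>S. min (depth K j a) (depth K j b))" for S a b
    using depth_nonneg[OF K] by (intro sum_nonneg) simp
  have sum_cont: "((\<lambda>q. \<Sum>j\<in>S. min (depth K j (fst q)) (depth K j (snd q))) \<longlongrightarrow>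
      (\<Sum>j\<in>S. min (depth K j (fst q0)) (depth K j (snd q0)))) (atin ?T q0)"
    if S: "S \<subseteq> Z" and q0: "q0 \<in> topspace ?T" for S q0
    using finite_subset[OF S finite_Z] S
  proof (induction S rule: finite_induct)
    case (insert j S)
    have j: "j \<in> Z" using insert.prems by simp
    have "((\<lambda>q. min (depth K j (fst q)) (depth K j (snd q))) \<longlongrightarrow>
        min (depth K j (fst q0)) (depth K j (snd q0))) (atin ?T q0)"
      using dep[OF j, unfolded continuous_map_euclidean_tendsto] q0 by (intro tendsto_min) blast+
    then show ?case
      using insert sum_ge0[of "fst q0" "snd q0" S] depth_nonneg[OF K, of j "fst q0"]
        depth_nonneg[OF K, of j "snd q0"]
      by (simp, intro tendsto_add_ereal_nonneg) (auto simp: min_def)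
  qed simp
  have "continuous_map ?T euclidean ?g"
    unfolding continuous_map_euclidean_tendsto
  proof
    fix q0 assume q0: "q0 \<in> topspace ?T"
    have "(?p \<longlongrightarrow> ?p q0) (atin ?T q0)"
      unfolding gromov_product_def using dists[unfolded continuous_map_euclidean_tendsto] q0
      by (intro tendsto_intros) (blast | simp)+
    then have "((\<lambda>q. ereal (?p q)) \<longlongrightarrow> ereal (?p q0)) (atin ?T q0)" by (rule tendsto_ereal)
    moreover have "(\<Sum>j\<in>Z. min (depth K j (fst q0)) (depth K j (snd q0))) \<noteq> - \<infinity>"
      using sum_ge0[of "fst q0" "snd q0" Z] by auto
    ultimately have "((\<lambda>q. ereal (?p q) + (\<Sum>j\<in>Z. min (depth K j (fst q)) (depth K j (snd q)))) \<longlongrightarrow>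
        ereal (?p q0) + (\<Sum>j\<in>Z. min (depth K j (fst q0)) (depth K j (snd q0)))) (atin ?T q0)"
      using sum_cont[OF order_refl q0] by (intro tendsto_add_ereal_nonneg) auto
    then show "(?g \<longlongrightarrow> ?g q0) (atin ?T q0)" by (simp add: case_prod_unfold)
  qed
  moreover have "?g q \<in> {0..\<infinity>}" if "q \<in> topspace ?T" for q
    using nonneg[OF that] sum_ge0[of "fst q" "snd q" Z] by (auto simp: case_prod_unfold)
  ultimately show "continuous_map ?T (top_of_set {0..\<infinity>}) ?g"
    by (auto simp: continuous_map_in_subtopology)
  fix y z assume y: "y \<in> mspace Y" and z: "z \<in> mspace Y"
  have "(\<Sum>j\<in>Z. min (depth K j (Inl y)) (depth K j (Inl z))) =
      ereal (\<Sum>j\<in>Z. min (max 0 (- K - c y j)) (max 0 (- K - c z j)))"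
    by (simp add: depth_def ereal_min flip: sum_ereal)
  then show "?g (Inl y, Inl z) = ereal (gromov_product Y x y z)"
    using product_trunc[OF x y z] by simp
qed

end

section \<open>Goodness of the model and its boundary products\<close>

theorem good_model: "good_space Y"
  unfolding good_space_def boundary_continuous_def
proof (intro conjI ballI hyperbolic_model proper_model geodesic_space_model geodesically_complete_model)
  fix x assume x: "x \<in> mspace Y"
  \<comment> \<open>The cut is placed so far out that \<open>x\<close> lies inside it in every
    end.\<close>
  define K where "K = 2 * W + 1 + (\<Sum>i\<in>Z. \<bar>c x i\<bar>)"
  have "(\<Sum>i\<in>Z. \<bar>c x i\<bar>) \<ge> 0" by (intro sum_nonneg) auto
  then have K: "K > 2 * W" unfolding K_def by linarith
  have "- K \<le> c x i" if "i \<in> Z" for i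
  proof -
    have "\<bar>c x i\<bar> \<le> (\<Sum>i\<in>Z. \<bar>c x i\<bar>)" using that finite_Z by (intro member_le_sum) auto
    then show ?thesis using W_pos by (simp add: K_def)
  qed
  then show "\<exists>g. extends_gromov_product Y x g" using extension_exists[OF K x] by blast
qed

text \<open>As soon as the ray is deep and below \<open>y\<close>, \<open>deep_dist\<close> gives
  equality. So \<open>c\<close> is the Busemann function up to a constant, with the limit attained
  at a finite time.\<close>

lemma distance_to_end:
  assumes y: "y \<in> mspace Y" and \<gamma>: "\<gamma> \<in> endp i" and i: "i \<in> Z"
  shows "\<forall>\<^sub>F n in sequentially. mdist Y y (\<gamma> (real n)) = c y i - c (\<gamma> (real n)) i"
proof -
  obtain a where a: "\<And>t. t \<ge> 0 \<Longrightarrow> c (\<gamma> t) i = a - t" using \<gamma> by (auto simp: endp_def toward_def)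
  have "mdist Y y (\<gamma> (real n)) = c y i - c (\<gamma> (real n)) i"
    if n: "real n > a + 2 * W + \<bar>c y i\<bar>" for n
  proof -
    have "c (\<gamma> (real n)) i < - 2 * W" "c (\<gamma> (real n)) i \<le> c y i" using a[of "real n"] n W_pos by auto
    then show ?thesis using deep_dist[OF ray_in_mspace i _ y, of \<gamma> "real n"] \<gamma> by (auto simp: endp_def)
  qed
  moreover have "\<forall>\<^sub>F n in sequentially. a + 2 * W + \<bar>c y i\<bar> < real n"
    using filterlim_real_sequentially by (simp add: filterlim_at_top_dense)
  ultimately show ?thesis by (auto elim: eventually_mono)
qed

text \<open>The sequence is eventually constant: all three distances are then coordinate
  differences, and the coordinates of the two moving points cancel.\<close>

lemma product_of_ends:
  assumes x: "x \<in> mspace Y" and i: "i \<in> Z" "\<gamma> \<in> endp i" and j: "j \<in> Z" "\<gamma>' \<in> endp j" and ne: "i \<noteq> j"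
  shows "(\<lambda>n. ereal (gromov_product Y x (\<gamma> (real n)) (\<gamma>' (real n)))) \<longlonglongrightarrow> ereal ((c x i + c x j - w i j) / 2)"
proof (rule tendsto_eventually)
  obtain a b where a: "\<And>t. t \<ge> 0 \<Longrightarrow> c (\<gamma> t) i = a - t" and b: "\<And>t. t \<ge> 0 \<Longrightarrow> c (\<gamma>' t) j = b - t"
    using i(2) j(2) by (auto simp: endp_def toward_def)
  have rays: "\<gamma> \<in> geodesic_rays Y" "\<gamma>' \<in> geodesic_rays Y" using i j by (auto simp: endp_def)
  have "\<forall>\<^sub>F n in sequentially. \<bar>a\<bar> + \<bar>b\<bar> + 2 * W < real n"
    using filterlim_real_sequentially by (auto simp: filterlim_at_top_dense)
  with distance_to_end[OF x i(2,1)] distance_to_end[OF x j(2,1)]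
  show "\<forall>\<^sub>F n in sequentially. ereal (gromov_product Y x (\<gamma> (real n)) (\<gamma>' (real n))) =
      ereal ((c x i + c x j - w i j) / 2)"
  proof eventually_elim
    case (elim n)
    let ?y = "\<gamma> (real n)" and ?z = "\<gamma>' (real n)"
    have yz: "?y \<in> mspace Y" "?z \<in> mspace Y" using ray_in_mspace[OF rays(1)] ray_in_mspace[OF rays(2)] by auto
    have y: "c ?y i < - 2 * W" "c ?z j < - 2 * W" using a[of "real n"] b[of "real n"] elim(3) by auto
    have zi: "c ?z i = w i j - c ?z j" using deep_star[OF yz(2) j(1) y(2) i(1) ne] w_sym[OF i(1) j(1)] by simp
    have "mdist Y ?y ?z = \<bar>c ?z i - c ?y i\<bar>"
      using deep_dist[OF yz(1) i(1) y(1) yz(2)] mdist_commute[of Y ?y ?z] by simp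
    also have "\<dots> = w i j - c ?z j - c ?y i" using zi y w_bound[OF i(1) j(1)] W_pos by simp
    finally show ?case using elim(1,2) mdist_commute[of Y x] by (simp add: gromov_product_def)
  qed
qed

lemma boundary_product_model:
  assumes x: "x \<in> mspace Y" and ij: "i \<in> Z" "j \<in> Z" "i \<noteq> j"
  shows "boundary_product Y x (endp i) (endp j) = ereal ((c x i + c x j - w i j) / 2)"
proof -
  obtain \<gamma> where \<gamma>: "\<gamma> \<in> endp i" using endp_nonempty[OF ij(1)] .
  obtain \<gamma>' where \<gamma>': "\<gamma>' \<in> endp j" using endp_nonempty[OF ij(2)] .
  show ?thesis
    by (rule boundary_product_eqI[OF good_model x _ \<gamma> _ \<gamma>' product_of_ends[OF x ij(1) \<gamma> ij(2) \<gamma>' ij(3)]])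
      (use ij in \<open>auto simp: boundary_model\<close>)
qed

end

section \<open>Construction of a model with real points\<close>

lemma max_coordinate_metric:
  fixes c :: "'y \<Rightarrow> 'z \<Rightarrow> real"
  assumes Z: "finite Z" "Z \<noteq> {}" and inj: "\<And>y z. y \<in> M \<Longrightarrow> z \<in> M \<Longrightarrow> \<forall>i\<in>Z. c y i = c z i \<Longrightarrow> y = z"
  shows "Metric_space M (\<lambda>y z. Max ((\<lambda>i. \<bar>c y i - c z i\<bar>) ` Z))"
proof
  let ?d = "\<lambda>y z. Max ((\<lambda>i. \<bar>c y i - c z i\<bar>) ` Z)"
  have ge: "\<bar>c y i - c z i\<bar> \<le> ?d y z" if "i \<in> Z" for y z i using Z that by simp
  have le: "?d y z \<le> D" if "\<And>i. i \<in> Z \<Longrightarrow> \<bar>c y i - c z i\<bar> \<le> D" for y z D using Z that by simp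
  show nonneg: "0 \<le> ?d y z" for y z
  proof -
    obtain i where "i \<in> Z" using Z(2) by blast
    from ge[OF this, of y z] show ?thesis by linarith
  qed
  show "?d y z = ?d z y" for y z by (simp add: abs_minus_commute)
  show "?d y z = 0 \<longleftrightarrow> y = z" if "y \<in> M" "z \<in> M" for y z
  proof
    assume "?d y z = 0"
    then have "\<forall>i\<in>Z. c y i = c z i" using ge[of _ y z] by auto
    then show "y = z" by (rule inj[OF that])
  next
    assume "y = z"
    then have "?d y z \<le> 0" by (intro le) simp
    then show "?d y z = 0" using nonneg[of y z] by linarith
  qed
  show "?d x z \<le> ?d x y + ?d y z" for x y z
  proof (rule le)
    fix i assume "i \<in> Z"
    from ge[OF this, of x y] ge[OF this, of y z] show "\<bar>c x i - c z i\<bar> \<le> ?d x y + ?d y z" by linarith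
  qed
qed

lemma tight_cong: "(\<And>i. i \<in> Z \<Longrightarrow> f i = g i) \<Longrightarrow> tight Z w f = tight Z w g"
  by (simp add: tight_def admissible_def cong: bex_cong)

lemma tight_modelI:
  fixes c :: "'y \<Rightarrow> 'z \<Rightarrow> real"
  assumes Z: "finite Z" "3 \<le> card Z" and sym: "\<And>i j. i \<in> Z \<Longrightarrow> j \<in> Z \<Longrightarrow> w i j = w j i"
    and inj: "\<And>y z. y \<in> M \<Longrightarrow> z \<in> M \<Longrightarrow> \<forall>i\<in>Z. c y i = c z i \<Longrightarrow> y = z"
    and tight: "\<And>y. y \<in> M \<Longrightarrow> tight Z w (c y)"
    and surj: "\<And>f. tight Z w f \<Longrightarrow> \<exists>y\<in>M. \<forall>i\<in>Z. c y i = f i"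
  shows "tight_model Z w (metric (M, \<lambda>y z. Max ((\<lambda>i. \<bar>c y i - c z i\<bar>) ` Z))) c"
proof -
  have "Z \<noteq> {}" using Z(2) by auto
  then interpret Metric_space M "\<lambda>y z. Max ((\<lambda>i. \<bar>c y i - c z i\<bar>) ` Z)"
    using Z(1) inj by (intro max_coordinate_metric) auto
  show ?thesis
    by unfold_locales (use Z sym tight surj in \<open>simp_all add: mspace_metric mdist_metric\<close>)
qed

text \<open>Maximality is formulated for fillings with points in \<open>real\<close>. The model is
  first formed on functions; being proper, it injects into the reals, and its coordinates are
  transported along the injection.\<close>

lemma tight_model_exists:
  fixes Z :: "'z set"
  assumes Z: "finite Z" "3 \<le> card Z" and sym: "\<And>i j. i \<in> Z \<Longrightarrow> j \<in> Z \<Longrightarrow> w i j = w j i"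
  shows "\<exists>(Y :: real metric) c. tight_model Z w Y c"
proof -
  \<comment> \<open>The value 0 outside \<open>Z\<close> makes a point determined by its
    coordinates.\<close>
  define M where "M = {f. tight Z w f \<and> (\<forall>i. i \<notin> Z \<longrightarrow> f i = 0)}"
  have inj: "f = g" if "f \<in> M" "g \<in> M" "\<forall>i\<in>Z. f i = g i" for f g
  proof
    show "f i = g i" for i using that by (cases "i \<in> Z") (auto simp: M_def)
  qed
  have tight: "tight Z w f" if "f \<in> M" for f using that by (simp add: M_def)
  have surj: "\<exists>g\<in>M. \<forall>i\<in>Z. g i = f i" if "tight Z w f" for f
  proof (intro bexI[of _ "\<lambda>i. if i \<in> Z then f i else 0"])
    show "(\<lambda>i. if i \<in> Z then f i else 0) \<in> M"
      using that tight_cong[of Z f "\<lambda>i. if i \<in> Z then f i else 0"] by (simp add: M_def)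
  qed simp
  let ?Y = "metric (M, \<lambda>f g. Max ((\<lambda>i. \<bar>f i - g i\<bar>) ` Z))"
  interpret F: tight_model Z w ?Y "\<lambda>f. f"
  proof (rule tight_modelI[OF Z])
    show "w i j = w j i" if "i \<in> Z" "j \<in> Z" for i j using sym that .
  qed (fact inj tight surj)+
  have "Z \<noteq> {}" using Z(2) by auto
  then have "mspace ?Y = M"
    using max_coordinate_metric[OF Z(1), of M "\<lambda>f. f"] inj by (simp add: Metric_space.mspace_metric)
  then obtain e :: "('z \<Rightarrow> real) \<Rightarrow> real" where e: "inj_on e M"
    using proper_space_inj_real[OF F.proper_model] by auto
  define c where "c = inv_into M e"
  have c: "c (e f) = f" if "f \<in> M" for f using e that by (simp add: c_def)
  have "tight_model Z w (metric (e ` M, \<lambda>y z. Max ((\<lambda>i. \<bar>c y i - c z i\<bar>) ` Z))) c"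
  proof (intro tight_modelI Z sym)
    show "y = z" if "y \<in> e ` M" "z \<in> e ` M" "\<forall>i\<in>Z. c y i = c z i" for y z
    proof -
      obtain f g where "f \<in> M" "g \<in> M" "y = e f" "z = e g" using \<open>y \<in> e ` M\<close> \<open>z \<in> e ` M\<close> by auto
      then show ?thesis using inj[of f g] c that(3) by simp
    qed
    show "tight Z w (c y)" if "y \<in> e ` M" for y using that tight c by auto
    show "\<exists>y\<in>e ` M. \<forall>i\<in>Z. c y i = f i" if "tight Z w f" for f
      using surj[OF that] c by auto
  qed
  then show ?thesis by blast
qed

section \<open>Busemann coordinates\<close>

locale good_finite_boundary =
  fixes X :: "'a metric"
  assumes good: "good_space X" and finite_boundary: "finite (gromov_boundary X)"
    and card_boundary: "3 \<le> card (gromov_boundary X)"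
begin

abbreviation bd where "bd \<equiv> gromov_boundary X"

definition G where "G x = (SOME g. extends_gromov_product X x g)"

lemma G: "x \<in> mspace X \<Longrightarrow> extends_gromov_product X x (G x)"
  unfolding G_def by (rule someI_ex[of "extends_gromov_product X x"]) (use good in \<open>simp add: good_space_def boundary_continuous_def\<close>)

lemma boundary_product_G: "boundary_product X x \<xi> \<eta> = G x (Inr \<xi>, Inr \<eta>)"
  by (simp add: boundary_product_def G_def)

lemma in_X: "\<xi> \<in> bd \<Longrightarrow> \<gamma> \<in> \<xi> \<Longrightarrow> t \<ge> 0 \<Longrightarrow> \<gamma> t \<in> mspace X"
  by (rule ray_in_mspace[OF boundary_rep(1)])

definition base :: 'a where "base = (SOME x. x \<in> mspace X)"

lemma base: "base \<in> mspace X"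
proof -
  have "bd \<noteq> {}" using card_boundary by auto
  then obtain \<xi> where \<xi>: "\<xi> \<in> bd" by blast
  obtain \<gamma> where "\<gamma> \<in> \<xi>" using boundary_nonempty[OF \<xi>] .
  then have "\<gamma> 0 \<in> mspace X" using in_X[OF \<xi>] by simp
  then show ?thesis unfolding base_def by (rule someI)
qed

text \<open>The difference equals \<open>2 * gromov_product X x y z - mdist X x y\<close> at
  \<open>z = \<gamma> n\<close>. Boundary continuity gives it the same limit for all rays of the
  class, finite because the product lies between 0 and \<open>mdist X x y\<close>.\<close>

lemma busemann_exists:
  assumes x: "x \<in> mspace X" and y: "y \<in> mspace X" and \<xi>: "\<xi> \<in> bd"
  shows "\<exists>b. \<forall>\<gamma>\<in>\<xi>. (\<lambda>n. mdist X x (\<gamma> (real n)) - mdist X y (\<gamma> (real n))) \<longlonglongrightarrow> b"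
proof -
  let ?v = "G x (Inl y, Inr \<xi>)"
  note lim = extension_point_ray[OF G[OF x] y \<xi>]
  obtain \<gamma>0 where \<gamma>0: "\<gamma>0 \<in> \<xi>" using boundary_nonempty[OF \<xi>] .
  have "gromov_product X x y (\<gamma>0 (real n)) \<le> mdist X x y" for n
    using mdist_triangle[OF x y in_X[OF \<xi> \<gamma>0], of "real n"] mdist_commute[of X x]
    by (simp add: gromov_product_def)
  then have "?v \<le> ereal (mdist X x y)" by (intro LIMSEQ_le_const2[OF lim[OF \<gamma>0]]) auto
  moreover have "0 \<le> ?v"
    using gromov_product_nonneg[OF x y in_X[OF \<xi> \<gamma>0]] by (intro LIMSEQ_le_const[OF lim[OF \<gamma>0]]) auto
  ultimately obtain r where r: "?v = ereal r" by (cases ?v) auto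
  show ?thesis
  proof (intro exI[of _ "2 * r - mdist X x y"] ballI)
    fix \<gamma> assume \<gamma>: "\<gamma> \<in> \<xi>"
    have "(\<lambda>n. gromov_product X x y (\<gamma> (real n))) \<longlonglongrightarrow> r" using lim[OF \<gamma>] r by simp
    then have "(\<lambda>n. 2 * gromov_product X x y (\<gamma> (real n)) - mdist X x y) \<longlonglongrightarrow> 2 * r - mdist X x y"
      by (intro tendsto_intros)
    moreover have "2 * gromov_product X x y z - mdist X x y = mdist X x z - mdist X y z" for z
      by (simp add: gromov_product_def mdist_commute[of X _ x] field_simps)
    ultimately show "(\<lambda>n. mdist X x (\<gamma> (real n)) - mdist X y (\<gamma> (real n))) \<longlonglongrightarrow> 2 * r - mdist X x y"
      by simp
  qed
qed

definition bus :: "'a \<Rightarrow> (real \<Rightarrow> 'a) set \<Rightarrow> real" where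
  "bus x \<xi> = (SOME b. \<forall>\<gamma>\<in>\<xi>. (\<lambda>n. mdist X x (\<gamma> (real n)) - mdist X base (\<gamma> (real n))) \<longlonglongrightarrow> b)"

lemma bus_lim:
  assumes "x \<in> mspace X" "\<xi> \<in> bd" "\<gamma> \<in> \<xi>"
  shows "(\<lambda>n. mdist X x (\<gamma> (real n)) - mdist X base (\<gamma> (real n))) \<longlonglongrightarrow> bus x \<xi>"
  using someI_ex[OF busemann_exists[OF assms(1) base assms(2)], folded bus_def] assms(3) by blast

lemma bus_diff:
  assumes "x \<in> mspace X" "y \<in> mspace X" "\<xi> \<in> bd" "\<gamma> \<in> \<xi>"
  shows "(\<lambda>n. mdist X x (\<gamma> (real n)) - mdist X y (\<gamma> (real n))) \<longlonglongrightarrow> bus x \<xi> - bus y \<xi>"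
  using tendsto_diff[OF bus_lim[OF assms(1,3,4)] bus_lim[OF assms(2,3,4)]] by simp

text \<open>The factor -2 gives the boundary products the form required by
  \<open>cross_ratio_formula\<close>. On the diagonal \<open>real_of_ereal\<close> turns \<infinity>
  into 0, but the inequalities concern distinct points only.\<close>

definition wt :: "(real \<Rightarrow> 'a) set \<Rightarrow> (real \<Rightarrow> 'a) set \<Rightarrow> real" where
  "wt \<xi> \<eta> = - 2 * real_of_ereal (G base (Inr \<xi>, Inr \<eta>))"

lemma G_commute:
  assumes x: "x \<in> mspace X" and \<xi>: "\<xi> \<in> bd" and \<eta>: "\<eta> \<in> bd"
  shows "G x (Inr \<xi>, Inr \<eta>) = G x (Inr \<eta>, Inr \<xi>)"
proof -
  obtain \<gamma> where \<gamma>: "\<gamma> \<in> \<xi>" using boundary_nonempty[OF \<xi>] .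
  obtain \<gamma>' where \<gamma>': "\<gamma>' \<in> \<eta>" using boundary_nonempty[OF \<eta>] .
  have "(\<lambda>n. ereal (gromov_product X x (\<gamma> (real n)) (\<gamma>' (real n)))) \<longlonglongrightarrow> G x (Inr \<eta>, Inr \<xi>)"
    using extension_rays[OF G[OF x] \<eta> \<gamma>' \<xi> \<gamma>] by (subst gromov_product_commute)
  from LIMSEQ_unique[OF extension_rays[OF G[OF x] \<xi> \<gamma> \<eta> \<gamma>'] this] show ?thesis .
qed

lemma wt_sym: "\<xi> \<in> bd \<Longrightarrow> \<eta> \<in> bd \<Longrightarrow> wt \<xi> \<eta> = wt \<eta> \<xi>"
  unfolding wt_def using G_commute[OF base] by simp

lemma G_nonneg:
  assumes x: "x \<in> mspace X" and \<xi>: "\<xi> \<in> bd" and \<eta>: "\<eta> \<in> bd"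
  shows "0 \<le> G x (Inr \<xi>, Inr \<eta>)"
proof -
  obtain \<gamma> where \<gamma>: "\<gamma> \<in> \<xi>" using boundary_nonempty[OF \<xi>] .
  obtain \<gamma>' where \<gamma>': "\<gamma>' \<in> \<eta>" using boundary_nonempty[OF \<eta>] .
  show ?thesis
    using gromov_product_nonneg[OF x in_X[OF \<xi> \<gamma>] in_X[OF \<eta> \<gamma>']]
    by (intro LIMSEQ_le_const[OF extension_rays[OF G[OF x] \<xi> \<gamma> \<eta> \<gamma>']]) auto
qed

text \<open>Moving the base point of a Gromov product from \<open>base\<close> to \<open>x\<close>
  adds half the sum of two distance differences. In the limit along rays these become Busemann
  values, and finiteness for distinct ends allows computing in the reals.\<close>

lemma boundary_product_bus:
  assumes x: "x \<in> mspace X" and \<xi>: "\<xi> \<in> bd" and \<eta>: "\<eta> \<in> bd" and ne: "\<xi> \<noteq> \<eta>"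
  shows "boundary_product X x \<xi> \<eta> = ereal ((bus x \<xi> + bus x \<eta> - wt \<xi> \<eta>) / 2)"
proof -
  obtain \<gamma> where \<gamma>: "\<gamma> \<in> \<xi>" using boundary_nonempty[OF \<xi>] .
  obtain \<gamma>' where \<gamma>': "\<gamma>' \<in> \<eta>" using boundary_nonempty[OF \<eta>] .
  obtain \<delta> where \<delta>: "geodesic_space X" "slim_triangles X \<delta>"
    using good by (auto simp: good_space_def gromov_hyperbolic_def)
  obtain v where v: "G base (Inr \<xi>, Inr \<eta>) = ereal v"
    using distinct_ends_product_finite[OF \<delta> base G[OF base] \<xi> \<eta> ne] G_nonneg[OF base \<xi> \<eta>]
    by (cases "G base (Inr \<xi>, Inr \<eta>)") auto
  have "(\<lambda>n. gromov_product X base (\<gamma> (real n)) (\<gamma>' (real n))) \<longlonglongrightarrow> v"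
    using extension_rays[OF G[OF base] \<xi> \<gamma> \<eta> \<gamma>'] v by simp
  then have "(\<lambda>n. gromov_product X base (\<gamma> (real n)) (\<gamma>' (real n)) +
      ((mdist X x (\<gamma> (real n)) - mdist X base (\<gamma> (real n))) +
       (mdist X x (\<gamma>' (real n)) - mdist X base (\<gamma>' (real n)))) / 2) \<longlonglongrightarrow> v + (bus x \<xi> + bus x \<eta>) / 2"
    using bus_lim[OF x \<xi> \<gamma>] bus_lim[OF x \<eta> \<gamma>'] by (intro tendsto_intros) auto
  then have "(\<lambda>n. gromov_product X x (\<gamma> (real n)) (\<gamma>' (real n))) \<longlonglongrightarrow> v + (bus x \<xi> + bus x \<eta>) / 2"
    by (rule Lim_transform_eventually)
      (simp add: gromov_product_def mdist_commute[of X _ x] mdist_commute[of X _ base] field_simps)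
  then have "boundary_product X x \<xi> \<eta> = ereal (v + (bus x \<xi> + bus x \<eta>) / 2)"
    by (intro boundary_product_eqI[OF good x \<xi> \<gamma> \<eta> \<gamma>'] tendsto_ereal)
  then show ?thesis by (simp add: wt_def v field_simps)
qed

lemma bus_admissible:
  assumes "x \<in> mspace X"
  shows "admissible bd wt (bus x)"
  unfolding admissible_def
proof (intro ballI impI)
  fix \<xi> \<eta> assume "\<xi> \<in> bd" "\<eta> \<in> bd" "\<xi> \<noteq> \<eta>"
  then show "wt \<xi> \<eta> \<le> bus x \<xi> + bus x \<eta>"
    using G_nonneg[OF assms, of \<xi> \<eta>] boundary_product_bus[OF assms, of \<xi> \<eta>]
    by (simp add: boundary_product_G)
qed

lemma line_through:
  assumes x: "x \<in> mspace X" and y: "y \<in> mspace X"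
  obtains \<sigma> where "geodesic_on X UNIV \<sigma>" "\<sigma> 0 = x" "\<sigma> (mdist X x y) = y"
proof -
  obtain S where "geodesic_segment X x y S"
    using good x y unfolding good_space_def geodesic_space_def by blast
  then obtain \<gamma> L where \<gamma>: "L \<ge> 0" "geodesic_on X {0..L} \<gamma>" "\<gamma> 0 = x" "\<gamma> L = y"
    unfolding geodesic_segment_def by metis
  have "0 \<in> {0..L}" "L \<in> {0..L}" using \<gamma>(1) by auto
  from geodesic_onD(2)[OF \<gamma>(2) this] have L: "mdist X x y = L" using \<gamma> by simp
  obtain \<sigma> where "geodesic_on X UNIV \<sigma>" "\<forall>t\<in>{0..L}. \<sigma> t = \<gamma> t"
    using good \<gamma>(2) unfolding good_space_def geodesically_complete_def by blast
  then show ?thesis using that[of \<sigma>] \<gamma> L by simp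
qed

text \<open>Prolong the geodesic from \<open>y\<close> to \<open>x\<close> beyond \<open>x\<close>; its end is opposite to \<open>y\<close> as seen from \<open>x\<close>.\<close>

lemma opposite_end:
  assumes x: "x \<in> mspace X" and y: "y \<in> mspace X"
  shows "\<exists>\<eta>\<in>bd. G x (Inl y, Inr \<eta>) = 0"
proof -
  obtain \<sigma> where \<sigma>: "geodesic_on X UNIV \<sigma>" "\<sigma> 0 = x" "\<sigma> (mdist X x y) = y" using line_through[OF x y] .
  let ?\<beta> = "\<lambda>t. \<sigma> (- t)"
  have d: "mdist X (\<sigma> s) (\<sigma> t) = \<bar>s - t\<bar>" for s t using geodesic_onD(2)[OF \<sigma>(1)] by simp
  have \<beta>: "?\<beta> \<in> geodesic_rays X"
    using geodesic_onD(1)[OF \<sigma>(1)] by (auto simp: geodesic_rays_def geodesic_on_def d is_interval_ci)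
  have "gromov_product X x y (?\<beta> (real n)) = 0" for n
    using d[of "mdist X x y" 0] d[of "- real n" 0] d[of "mdist X x y" "- real n"] \<sigma>(2,3)
    by (simp add: gromov_product_def)
  then have "G x (Inl y, Inr (asymptotic X `` {?\<beta>})) = 0"
    using extension_point_ray[OF G[OF x] y ray_class[OF \<beta>]] LIMSEQ_unique[OF _ tendsto_const]
    by (simp add: zero_ereal_def)
  then show ?thesis using ray_class(1)[OF \<beta>] by blast
qed

lemma G_diagonal:
  assumes x: "x \<in> mspace X" and \<xi>: "\<xi> \<in> bd"
  shows "G x (Inr \<xi>, Inr \<xi>) = \<infinity>"
proof -
  obtain \<gamma> where \<gamma>: "\<gamma> \<in> \<xi>" using boundary_nonempty[OF \<xi>] .
  have le: "real n - mdist X x (\<gamma> 0) \<le> gromov_product X x (\<gamma> (real n)) (\<gamma> (real n))" for n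
    using mdist_triangle[OF in_X[OF \<xi> \<gamma>] x in_X[OF \<xi> \<gamma>], of 0 "real n"] in_X[OF \<xi> \<gamma>, of "real n"]
      ray_dist[OF boundary_rep(1)[OF \<xi> \<gamma>], of 0 "real n"] mdist_commute[of X _ x]
    by (simp add: gromov_product_def)
  have "filterlim (\<lambda>n. real n - mdist X x (\<gamma> 0)) at_top sequentially"
    using filterlim_tendsto_add_at_top[OF tendsto_const[of "- mdist X x (\<gamma> 0)"] filterlim_real_sequentially]
    by simp
  then have "filterlim (\<lambda>n. gromov_product X x (\<gamma> (real n)) (\<gamma> (real n))) at_top sequentially"
    by (rule filterlim_at_top_mono) (use le in simp)
  then have "(\<lambda>n. ereal (gromov_product X x (\<gamma> (real n)) (\<gamma> (real n)))) \<longlonglongrightarrow> \<infinity>"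
    by (simp add: tendsto_PInfty filterlim_at_top_dense)
  then show ?thesis using extension_rays[OF G[OF x] \<xi> \<gamma> \<xi> \<gamma>] LIMSEQ_unique by blast
qed

text \<open>Each point of a ray toward \<xi> has an opposite end. As the boundary is finite, one
  \<eta> is opposite to infinitely many of these points, and continuity gives (\<xi>|\<eta>) = 0 at
  \<open>x\<close>, which is the required equality; \<eta> = \<xi> is excluded by the infinite
  diagonal value.\<close>

lemma bus_tight:
  assumes x: "x \<in> mspace X"
  shows "tight bd wt (bus x)"
  unfolding tight_def
proof (intro conjI ballI bus_admissible x)
  fix \<xi> assume \<xi>: "\<xi> \<in> bd"
  obtain \<gamma> where \<gamma>: "\<gamma> \<in> \<xi>" using boundary_nonempty[OF \<xi>] .
  have "\<forall>n. \<exists>\<eta>\<in>bd. G x (Inl (\<gamma> (real n)), Inr \<eta>) = 0"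
    using opposite_end[OF x in_X[OF \<xi> \<gamma>]] by simp
  then obtain h where h: "\<And>n. h n \<in> bd" "\<And>n. G x (Inl (\<gamma> (real n)), Inr (h n)) = 0" by metis
  have "finite (range h)" using h(1) finite_boundary by (meson finite_subset image_subsetI)
  from pigeonhole_infinite[OF infinite_UNIV_nat this]
  obtain n0 where "infinite {n. h n = h n0}" by auto
  from infinite_enumerate[OF this]
  obtain r :: "nat \<Rightarrow> nat" where r: "strict_mono r" "\<And>n. h (r n) = h n0" by auto
  let ?\<eta> = "h n0"
  have "limitin (cone_topology X) ((\<lambda>n. Inl (\<gamma> (real n))) \<circ> r) (Inr \<xi>) sequentially"
    by (rule limitin_subsequence[OF r(1) ray_limitin[OF \<xi> \<gamma>]])
  moreover have "limitin (cone_topology X) (\<lambda>n. Inr ?\<eta>) (Inr ?\<eta>) sequentially"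
    using h(1) by (simp add: limitin_const_iff topspace_cone_topology)
  ultimately have "(\<lambda>n. G x (Inl (\<gamma> (real (r n))), Inr ?\<eta>)) \<longlonglongrightarrow> G x (Inr \<xi>, Inr ?\<eta>)"
    using extension_limit[OF G[OF x]] by (fastforce simp: comp_def)
  moreover have "G x (Inl (\<gamma> (real (r n))), Inr ?\<eta>) = 0" for n using h(2)[of "r n"] r(2)[of n] by simp
  ultimately have zero: "G x (Inr \<xi>, Inr ?\<eta>) = 0"
    using LIMSEQ_unique[OF _ tendsto_const] by simp
  then have ne: "?\<eta> \<noteq> \<xi>" using G_diagonal[OF x \<xi>] by auto
  then have "bus x \<xi> + bus x ?\<eta> = wt \<xi> ?\<eta>"
    using zero boundary_product_bus[OF x \<xi> h(1)[of n0]] by (simp add: boundary_product_G zero_ereal_def)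
  then show "\<exists>\<eta>\<in>bd. \<eta> \<noteq> \<xi> \<and> bus x \<xi> + bus x \<eta> = wt \<xi> \<eta>" using ne h(1) by blast
qed

text \<open>The reverse triangle inequality gives one bound. The maximum is attained at the end of a
  geodesic from \<open>x\<close> to \<open>y\<close> prolonged beyond \<open>y\<close>, along which
  the difference of distances is eventually the full distance.\<close>

lemma bus_isometric:
  assumes x: "x \<in> mspace X" and y: "y \<in> mspace X"
  shows "mdist X x y = Max ((\<lambda>\<xi>. \<bar>bus x \<xi> - bus y \<xi>\<bar>) ` bd)"
proof (rule sym, rule Max_eqI)
  show "finite ((\<lambda>\<xi>. \<bar>bus x \<xi> - bus y \<xi>\<bar>) ` bd)" using finite_boundary by simp
next
  fix b assume "b \<in> (\<lambda>\<xi>. \<bar>bus x \<xi> - bus y \<xi>\<bar>) ` bd"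
  then obtain \<xi> where \<xi>: "\<xi> \<in> bd" "b = \<bar>bus x \<xi> - bus y \<xi>\<bar>" by blast
  obtain \<gamma> where \<gamma>: "\<gamma> \<in> \<xi>" using boundary_nonempty[OF \<xi>(1)] .
  have "\<bar>mdist X x (\<gamma> (real n)) - mdist X y (\<gamma> (real n))\<bar> \<le> mdist X x y" for n
    using mdist_reverse_triangle[OF x y in_X[OF \<xi>(1) \<gamma>]] by simp
  then show "b \<le> mdist X x y"
    unfolding \<xi>(2) by (intro LIMSEQ_le_const2[OF tendsto_rabs[OF bus_diff[OF x y \<xi>(1) \<gamma>]]]) auto
next
  obtain \<sigma> where \<sigma>: "geodesic_on X UNIV \<sigma>" "\<sigma> 0 = x" "\<sigma> (mdist X x y) = y" using line_through[OF x y] .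
  have d: "mdist X (\<sigma> s) (\<sigma> t) = \<bar>s - t\<bar>" for s t using geodesic_onD(2)[OF \<sigma>(1)] by simp
  have \<sigma>r: "\<sigma> \<in> geodesic_rays X"
    using geodesic_onD(1)[OF \<sigma>(1)] by (auto simp: geodesic_rays_def geodesic_on_def d is_interval_ci)
  let ?\<xi> = "asymptotic X `` {\<sigma>}"
  have "\<forall>\<^sub>F n in sequentially. mdist X x y < real n"
    using filterlim_real_sequentially by (simp add: filterlim_at_top_dense)
  then have "\<forall>\<^sub>F n in sequentially. mdist X x (\<sigma> (real n)) - mdist X y (\<sigma> (real n)) = mdist X x y"
  proof eventually_elim
    case (elim n)
    then show ?case using d[of 0 "real n"] d[of "mdist X x y" "real n"] \<sigma>(2,3) by simp
  qed
  then have "(\<lambda>n. mdist X x (\<sigma> (real n)) - mdist X y (\<sigma> (real n))) \<longlonglongrightarrow> mdist X x y"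
    by (rule tendsto_eventually)
  then have "bus x ?\<xi> - bus y ?\<xi> = mdist X x y"
    using bus_diff[OF x y ray_class[OF \<sigma>r]] LIMSEQ_unique by blast
  then have "mdist X x y = \<bar>bus x ?\<xi> - bus y ?\<xi>\<bar>" by simp
  then show "mdist X x y \<in> (\<lambda>\<xi>. \<bar>bus x \<xi> - bus y \<xi>\<bar>) ` bd"
    using ray_class(1)[OF \<sigma>r] by (rule image_eqI)
qed

section \<open>Comparison of \<open>X\<close> with the model\<close>

lemma model_filling:
  fixes Y :: "'y metric"
  assumes "tight_model bd wt Y c"
  shows "hyperbolic_filling X Y (inv_into bd (tight_model.endp Y c))"
proof -
  interpret T: tight_model bd wt Y c by (rule assms)
  let ?f = "inv_into bd T.endp"
  have inj: "inj_on T.endp bd" using T.endp_inj by (auto simp: inj_on_def)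
  have f: "?f (T.endp \<xi>) = \<xi>" if "\<xi> \<in> bd" for \<xi> using inj that by simp
  have topX: "boundary_topology X = discrete_topology bd"
    using good finite_boundary by (intro boundary_topology_discrete) (auto simp: good_space_def)
  have topY: "boundary_topology Y = discrete_topology (T.endp ` bd)"
    using T.hyperbolic_model finite_boundary boundary_topology_discrete[of Y] by (simp add: T.boundary_model)
  have "homeomorphic_maps (boundary_topology Y) (boundary_topology X) ?f T.endp"
    unfolding homeomorphic_maps_def topX topY by (auto simp: f)
  then have homeo: "homeomorphic_map (boundary_topology Y) (boundary_topology X) ?f"
    by (auto simp: homeomorphic_map_maps)
  have "cross_ratio X x (?f \<xi>) (?f \<xi>') (?f \<eta>) (?f \<eta>') = cross_ratio Y y \<xi> \<xi>' \<eta> \<eta>'"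
    if y: "y \<in> mspace Y" and x: "x \<in> mspace X"
      and ends: "\<xi> \<in> gromov_boundary Y" "\<xi>' \<in> gromov_boundary Y" "\<eta> \<in> gromov_boundary Y" "\<eta>' \<in> gromov_boundary Y"
      and dist: "distinct [\<xi>, \<xi>', \<eta>, \<eta>']" for x y \<xi> \<xi>' \<eta> \<eta>'
  proof -
    obtain i i' j j' where ij: "i \<in> bd" "i' \<in> bd" "j \<in> bd" "j' \<in> bd"
      "\<xi> = T.endp i" "\<xi>' = T.endp i'" "\<eta> = T.endp j" "\<eta>' = T.endp j'"
      using ends by (auto simp: T.boundary_model)
    have "distinct [i, i', j, j']" using dist ij by auto
    \<comment> \<open>Boundary products of both spaces are built from the same weights
      \<open>wt\<close>; only the cancelling terms \<open>bus x\<close> and \<open>c y\<close>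
      differ.\<close>
    from cross_ratio_formula[of bd X x "\<lambda>\<xi>. \<xi>" "bus x" wt, OF boundary_product_bus[OF x] ij(1-4) this]
      cross_ratio_formula[of bd Y y T.endp "c y" wt, OF T.boundary_product_model[OF y] ij(1-4) this]
    show ?thesis using ij f by simp
  qed
  then show ?thesis
    unfolding hyperbolic_filling_def moebius_homeomorphism_def using T.good_model homeo by blast
qed

text \<open>An embedding that induces the given boundary map shifts each Busemann function by a constant.
  Deep in the end \<open>\<xi>\<close> all pairs containing \<open>\<xi>\<close> are tight, before and after the shift, so the
  constants of any two distinct boundary points cancel; hence they vanish.\<close>

lemma embedding_preserves_bus:
  fixes Y :: "'y metric"
  assumes model: "tight_model bd wt Y c"
    and H: "isometric_embedding Y X H" "boundary_extension_is Y X H (inv_into bd (tight_model.endp Y c))"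
    and y: "y \<in> mspace Y" and \<xi>: "\<xi> \<in> bd"
  shows "bus (H y) \<xi> = c y \<xi>"
proof -
  interpret T: tight_model bd wt Y c by (rule model)
  have HX: "H z \<in> mspace X" if "z \<in> mspace Y" for z using H(1) that by (auto simp: isometric_embedding_def)
  have Hd: "mdist X (H z) (H z') = mdist Y z z'" if "z \<in> mspace Y" "z' \<in> mspace Y" for z z'
    using H(1) that by (auto simp: isometric_embedding_def)
  have inj: "inj_on T.endp bd" using T.endp_inj by (auto simp: inj_on_def)
  have diff: "bus (H z) \<eta> - bus (H z') \<eta> = c z \<eta> - c z' \<eta>"
    if z: "z \<in> mspace Y" "z' \<in> mspace Y" and \<eta>: "\<eta> \<in> bd" for z z' \<eta>
  proof -
    obtain \<gamma> where \<gamma>: "\<gamma> \<in> T.endp \<eta>" using T.endp_nonempty[OF \<eta>] .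
    then have \<gamma>r: "\<gamma> \<in> geodesic_rays Y" by (simp add: T.endp_def)
    have "\<eta> = asymptotic X `` {H \<circ> \<gamma>}"
      using H(2) \<gamma>r T.asymptotic_class[OF \<gamma> \<eta>] inj \<eta> by (auto simp: boundary_extension_is_def)
    moreover have "H \<circ> \<gamma> \<in> geodesic_rays X"
      using ray_in_mspace[OF \<gamma>r] HX Hd ray_dist[OF \<gamma>r]
      by (auto simp: geodesic_rays_def geodesic_on_def is_interval_ci)
    ultimately have H\<gamma>: "H \<circ> \<gamma> \<in> \<eta>" using ray_class(2) by metis
    have "\<forall>\<^sub>F n in sequentially. mdist X (H z) ((H \<circ> \<gamma>) (real n)) - mdist X (H z') ((H \<circ> \<gamma>) (real n)) = c z \<eta> - c z' \<eta>"
      using T.distance_to_end[OF z(1) \<gamma> \<eta>] T.distance_to_end[OF z(2) \<gamma> \<eta>]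
      by eventually_elim (simp add: Hd z ray_in_mspace[OF \<gamma>r])
    then have "(\<lambda>n. mdist X (H z) ((H \<circ> \<gamma>) (real n)) - mdist X (H z') ((H \<circ> \<gamma>) (real n))) \<longlonglongrightarrow> c z \<eta> - c z' \<eta>"
      by (rule tendsto_eventually)
    then show ?thesis using bus_diff[OF HX[OF z(1)] HX[OF z(2)] \<eta> H\<gamma>] LIMSEQ_unique by blast
  qed
  define k where "k \<eta> = bus (H y) \<eta> - c y \<eta>" for \<eta>
  have k: "bus (H z) \<eta> = c z \<eta> + k \<eta>" if "z \<in> mspace Y" "\<eta> \<in> bd" for z \<eta>
    using diff[OF that(1) y that(2)] by (simp add: k_def)
  have cancel: "k \<eta> + k \<zeta> = 0" if \<eta>: "\<eta> \<in> bd" and \<zeta>: "\<zeta> \<in> bd" "\<zeta> \<noteq> \<eta>" for \<eta> \<zeta>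
  proof -
    \<comment> \<open>The margin keeps coordinate \<open>\<eta>\<close> deep after the shift by
      \<open>k \<eta>\<close>.\<close>
    define K where "K = 2 * T.W + 1 + \<bar>k \<eta>\<bar>"
    define p where "p = T.level K \<eta>"
    have p: "p \<in> mspace Y" "c p \<eta> = - K" using T.level[OF \<eta>] by (auto simp: p_def)
    have "c p \<eta> < - 2 * T.W" by (simp add: p K_def)
    from T.deep_star[OF p(1) \<eta> this \<zeta>] have 1: "c p \<eta> + c p \<zeta> = wt \<eta> \<zeta>" .
    \<comment> \<open>The Busemann coordinates of \<open>H p\<close> are tight, hence those of some
      point of \<open>Y\<close>; this makes \<open>deep_star\<close> available for them.\<close>
    obtain q where q: "q \<in> mspace Y" "\<forall>i\<in>bd. c q i = bus (H p) i"
      using T.coord_surj[OF bus_tight[OF HX[OF p(1)]]] by blast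
    have "c q \<eta> < - 2 * T.W" using q(2) \<eta> k[OF p(1) \<eta>] by (simp add: p K_def)
    from T.deep_star[OF q(1) \<eta> this \<zeta>] have "bus (H p) \<eta> + bus (H p) \<zeta> = wt \<eta> \<zeta>" using q(2) \<eta> \<zeta> by simp
    then show ?thesis using 1 k[OF p(1)] \<eta> \<zeta> by simp
  qed
  have third: "\<exists>\<zeta>\<in>bd. \<zeta> \<noteq> \<xi> \<and> \<zeta> \<noteq> \<eta>" for \<eta>
  proof (rule ccontr)
    assume "\<not> ?thesis"
    then have "bd \<subseteq> {\<xi>, \<eta>}" by blast
    then have "card bd \<le> card {\<xi>, \<eta>}" by (intro card_mono) auto
    also have "\<dots> \<le> 2" by (simp add: card_insert_if)
    finally show False using card_boundary by simp
  qed
  obtain \<eta> where \<eta>: "\<eta> \<in> bd" "\<eta> \<noteq> \<xi>" using third[of \<xi>] by blast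
  obtain \<zeta> where \<zeta>: "\<zeta> \<in> bd" "\<zeta> \<noteq> \<xi>" "\<zeta> \<noteq> \<eta>" using third[of \<eta>] by blast
  \<comment> \<open>Two points would only give opposite constants; three vanishing pairwise sums
    leave no choice.\<close>
  have "k \<xi> = 0"
    using cancel[OF \<xi> \<eta>] cancel[OF \<xi> \<zeta>(1,2)] cancel[OF \<eta>(1) \<zeta>(1,3)] by linarith
  then show ?thesis by (simp add: k_def)
qed

text \<open>Only surjectivity of the coordinates is still missing: a tight function belongs to a
  point of the real model, and the embedding into \<open>X\<close> keeps its coordinates.
  Hyperconvexity and injectivity of models then apply to \<open>X\<close> itself.\<close>

lemma maximal_is_model:
  assumes max: "maximal_gromov_hyperbolic X"
  shows "tight_model bd wt X bus"
proof -
  have "\<exists>(Y :: real metric) c. tight_model bd wt Y c"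
    by (rule tight_model_exists[OF finite_boundary card_boundary]) (rule wt_sym)
  then obtain Y :: "real metric" and c where model: "tight_model bd wt Y c" by blast
  obtain H where H: "isometric_embedding Y X H" "boundary_extension_is Y X H (inv_into bd (tight_model.endp Y c))"
    using max model_filling[OF model] unfolding maximal_gromov_hyperbolic_def by blast
  show ?thesis
  proof
    fix f assume "tight bd wt f"
    then obtain y where y: "y \<in> mspace Y" "\<forall>\<xi>\<in>bd. c y \<xi> = f \<xi>"
      using tight_model.coord_surj[OF model] by blast
    moreover have "H y \<in> mspace X" using H(1) y(1) by (auto simp: isometric_embedding_def)
    ultimately show "\<exists>x\<in>mspace X. \<forall>\<xi>\<in>bd. bus x \<xi> = f \<xi>"
      using embedding_preserves_bus[OF model H y(1)] by (intro bexI[of _ "H y"]) auto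
  qed (use finite_boundary card_boundary wt_sym bus_tight bus_isometric in auto)
qed

end

theorem theorem4p6:
  fixes X :: "'a metric"
  assumes "maximal_gromov_hyperbolic X"
    and "finite (gromov_boundary X)"
    and "card (gromov_boundary X) \<ge> 4"
  shows "injective_space TYPE('b) X \<and> hyperconvex X"
proof -
  interpret good_finite_boundary X
    using assms by unfold_locales (auto simp: maximal_gromov_hyperbolic_def)
  interpret tight_model "gromov_boundary X" wt X bus
    by (rule maximal_is_model[OF assms(1)])
  show ?thesis using injective_model hyperconvex_model by blast
qed

end
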